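(* Let $k$ be an even integer and let $s\in\mathbb{C}$ with $2\,\mathrm{Re}(s)+k>3$. Let $E_k^{(2)}(Z,s)$ be the real analytic Siegel Eisenstein series of weight $k$ and degree $2$, with Fourier expansion $$E_k^{(2)}(X+iY,s)=\sum_{N}A(N,Y;s)\,e^{2\pi i\,\mathrm{tr}(NX)},$$ where $N$ runs over all half-integral symmetric matrices $N=\begin{pmatrix} n & r/2\\ r/2 & m\end{pmatrix}$ ($n,r,m\in\mathbb{Z}$). Put $A(N,Y;s)=0$ if $N$ is not half-integral. Then for all prime numbers $p$, all half-integral $N=\begin{pmatrix} n & r/2\\ r/2 & m\end{pmatrix}$ and all real symmetric positive definite $2\times 2$ matrices $Y$, $$p^{k-1}A\left(\begin{pmatrix} \frac{n}{p} & \frac{r}{2p}\\ \frac{r}{2p} & m\end{pmatrix},\,pY;\,s\right)-A\left(\begin{pmatrix} n & \frac r2\\ \frac r2 & pm\end{pmatrix},\,Y;\,s\right)$$ $$=p^{k-1}A\left(\begin{pmatrix} n & \frac{r}{2p}\\ \frac{r}{2p} & \frac{m}{p}\end{pmatrix},\,Y\left[\begin{pmatrix}1&0\\0&p\end{pmatrix}\right];\,s\right)-A\left(\begin{pmatrix} pn & \frac r2\\ \frac r2 & m\end{pmatrix},\,Y\left[\begin{pmatrix}p^{-1/2}&0\\0&p^{1/2}\end{pmatrix}\right];\,s\right).$$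
   Context: $\mathbb{H}_2$ is the Siegel upper half-space of degree $2$: symmetric complex $2\times2$ matrices $Z=X+iY$ with $X,Y$ real and $Y$ positive definite. $\Gamma_2=\mathrm{Sp}_2(\mathbb{Z})$ is the group of integral symplectic $4\times 4$ matrices $g=\begin{pmatrix}A&B\\C&D\end{pmatrix}$ ($2\times2$ blocks), acting by $g(Z)=(AZ+B)(CZ+D)^{-1}$; $j(g,Z)=\det(CZ+D)$; $\Gamma_{2,0}\subset\Gamma_2$ is the subgroup with $C=0$; $\delta(Z)=\det(\mathrm{Im}\,Z)$. For $k$ even and $2\,\mathrm{Re}(s)+k>3$ the Eisenstein series is the absolutely and locally uniformly convergent series $$E_k^{(2)}(Z,s)=\sum_{g\in\Gamma_{2,0}\backslash\Gamma_2}j(g,Z)^{-k}\,\delta(g(Z))^{s}.$$ It is periodic in $X$ under integral symmetric matrices, so it has a Fourier expansion in $X$ whose coefficients $A(N,Y;s)$ depend on $Y$ and $s$. A matrix is half-integral if it has the form $\begin{pmatrix} n & r/2\\ r/2 & m\end{pmatrix}$ with $n,r,m\in\mathbb{Z}$. Notation: $G[H]=H^tGH$. *)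

theory Defs
  imports "HOL-Analysis.Analysis"
begin

definition sym2 :: "'a::zero \<Rightarrow> 'a \<Rightarrow> 'a \<Rightarrow> 'a^2^2" where
  "sym2 a b c = vector [vector [a, b], vector [b, c]]"

definition pos_def_sym :: "real^2^2 \<Rightarrow> bool" where
  "pos_def_sym Y \<longleftrightarrow> transpose Y = Y \<and> (\<forall>x. x \<noteq> 0 \<longrightarrow> x \<bullet> (Y *v x) > 0)"

definition half_integral :: "real^2^2 \<Rightarrow> bool" where
  "half_integral N \<longleftrightarrow>
     (\<exists>n r m :: int. N = sym2 (of_int n) (of_int r / 2) (of_int m))"

definition gbracket :: "real^2^2 \<Rightarrow> real^2^2 \<Rightarrow> real^2^2" where
  "gbracket G H = transpose H ** G ** H"

text \<open>A \<open>4 \<times> 4\<close> matrix is indexed by the sum type \<open>2 + 2\<close>, so that its \<open>2 \<times> 2\<close> blocks are read off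
  with \<open>Inl\<close> and \<open>Inr\<close>.\<close>

type_synonym imat4 = "int^(2 + 2)^(2 + 2)"

definition blockA :: "imat4 \<Rightarrow> int^2^2" where "blockA g = (\<chi> i j. g $ Inl i $ Inl j)"
definition blockB :: "imat4 \<Rightarrow> int^2^2" where "blockB g = (\<chi> i j. g $ Inl i $ Inr j)"
definition blockC :: "imat4 \<Rightarrow> int^2^2" where "blockC g = (\<chi> i j. g $ Inr i $ Inl j)"
definition blockD :: "imat4 \<Rightarrow> int^2^2" where "blockD g = (\<chi> i j. g $ Inr i $ Inr j)"

definition sympJ :: imat4 where
  "sympJ = (\<chi> i j. case (i, j) of
       (Inl a, Inr b) \<Rightarrow> (if a = b then 1 else 0)
     | (Inr a, Inl b) \<Rightarrow> (if a = b then - 1 else 0)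
     | _ \<Rightarrow> 0)"

definition Gamma2 :: "imat4 set" where
  "Gamma2 = {g. transpose g ** sympJ ** g = sympJ}"

definition Gamma20 :: "imat4 set" where
  "Gamma20 = {g \<in> Gamma2. blockC g = 0}"

definition Gamma20_cosets :: "imat4 set set" where
  "Gamma20_cosets = {(\<lambda>u. u ** g) ` Gamma20 | g. g \<in> Gamma2}"

abbreviation cmat :: "int^2^2 \<Rightarrow> complex^2^2" where
  "cmat \<equiv> map_matrix of_int"

definition autj :: "imat4 \<Rightarrow> complex^2^2 \<Rightarrow> complex" where
  "autj g Z = det (cmat (blockC g) ** Z + cmat (blockD g))"

definition symp_act :: "imat4 \<Rightarrow> complex^2^2 \<Rightarrow> complex^2^2" where
  "symp_act g Z =
     (cmat (blockA g) ** Z + cmat (blockB g)) **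
     matrix_inv (cmat (blockC g) ** Z + cmat (blockD g))"

definition delta :: "complex^2^2 \<Rightarrow> real" where
  "delta Z = det (map_matrix Im Z)"

text \<open>For even \<open>k\<close> and \<open>Z\<close> in the Siegel upper half-space the summand does not depend on the
  representative \<open>g\<close> of the coset, since \<open>j(ug,Z) = det(D\<^sub>u) j(g,Z)\<close> with \<open>det(D\<^sub>u) \<in> {1,-1}\<close> and
  \<open>delta(ug(Z)) = delta(g(Z)) > 0\<close> for \<open>u \<in> Gamma20\<close>.\<close>

definition Eis2 :: "int \<Rightarrow> complex \<Rightarrow> complex^2^2 \<Rightarrow> complex" where
  "Eis2 k s Z = (\<Sum>\<^sub>\<infinity>c\<in>Gamma20_cosets.
     let g = (SOME g. g \<in> c)
     in autj g Z powi (- k) * complex_of_real (delta (symp_act g Z)) powr s)"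

definition siegel_point :: "real^2^2 \<Rightarrow> real^2^2 \<Rightarrow> complex^2^2" where
  "siegel_point X Y = (\<chi> i j. Complex (X $ i $ j) (Y $ i $ j))"

text \<open>The Fourier coefficient is the integral over the unit cube of the coordinates of the symmetric
  matrix \<open>X\<close>; this is a fundamental domain of volume 1 for translation by integral symmetric
  matrices, whose dual lattice under \<open>tr(NX)\<close> is that of the half-integral matrices.\<close>

definition Eis2_coeff :: "int \<Rightarrow> complex \<Rightarrow> real^2^2 \<Rightarrow> real^2^2 \<Rightarrow> complex" where
  "Eis2_coeff k s N Y =
     (if half_integral N
      then integral (cbox (0, 0, 0) (1, 1, 1))
             (\<lambda>(x1, x2, x3). let X = sym2 x1 x2 x3 in
                Eis2 k s (siegel_point X Y) *
                exp (- (2 * complex_of_real pi * \<i> * complex_of_real (trace (N ** X)))))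
      else 0)"

end

theory Submission
  imports Defs
begin

text \<open>The cosets of \<open>Gamma20\<close> correspond to the primitive vectors \<open>P = (a, u, h, v, w)\<close>, up to sign, on the
  quadric \<open>h\<^sup>2 + a w = u v\<close> (the Pluecker coordinates of the lower rows), and
  \<open>det (C Z + D) = a (x z - y\<^sup>2) + u x + 2 h y + v z + w\<close> for \<open>Z = ((x, y), (y, z))\<close>. Counting these vectors
  with the divisor bound gives absolute convergence for \<open>2 Re s + k > 3\<close>.

  The Hecke operator \<open>T\<^sub>p\<close> acting on \<open>x\<close> substitutes \<open>(p x, p y, z)\<close> and \<open>((x + b) / p, y, z)\<close>,
  \<open>0 \<le> b < p\<close>, into the series. Each of these \<open>p + 1\<close> series becomes a sum over the primitive vectors of the
  quadric \<open>p h\<^sup>2 + a w = u v\<close>, in which every vector occurs exactly once undivided and \<open>p\<close> times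
  multiplied by \<open>p\<close>. The total is therefore a multiple of one sum over that quadric, which is
  symmetric under \<open>x \<leftrightarrow> z\<close>, \<open>u \<leftrightarrow> v\<close>; so \<open>T\<^sub>p\<close> acting on \<open>z\<close> gives the same function. Comparing
  Fourier coefficients yields the relation.\<close>

section \<open>Integral symplectic matrices\<close>

text \<open>The quadric with p h^2 is forced by the substitutions. Putting (p x, p y, z) into the
  form of (a, u, h, v, w) gives p a (x z - p y^2) + p u x + 2 p h y + v z + w, and ((x + b) / p, y,
  z) gives 1 / p times the form of the same shape with coefficients (a, u, h, p v + b a, p w + b u).
  In both cases h^2 + a w = u v turns into the equation with p h^2 for the new coefficients, and x
  and z play symmetric roles in the new form. This symmetry carries the whole relation, so no
  Fourier coefficient is ever computed. The obstacle is that a sum over cosets hides it. One needs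
  that the minors of the lower rows reach every primitive vector of the first quadric, which is
  shown by descent, and that the sums may be rearranged freely, for which 2 Re s + k > 3 is
  used.\<close>

lemma UNIV_22: "(UNIV :: (2+2) set) = {Inl 1, Inl 2, Inr 1, Inr 2}"
  by (auto simp: UNIV_2 UNIV_Plus_UNIV[symmetric] Plus_def simp del: UNIV_Plus_UNIV)

lemma sum_22: "(\<Sum>i\<in>UNIV. f i) = f (Inl 1) + f (Inl 2) + f (Inr 1) + f (Inr (2::2))"
  for f :: "2 + 2 \<Rightarrow> 'a::comm_monoid_add"
  by (simp add: UNIV_22 add.assoc)

lemma forall_22: "(\<forall>i::2+2. P i) \<longleftrightarrow> P (Inl 1) \<and> P (Inl 2) \<and> P (Inr 1) \<and> P (Inr 2)"
proof -
  have "(\<forall>i::2+2. P i) \<longleftrightarrow> (\<forall>i\<in>UNIV. P i)" by simp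
  then show ?thesis unfolding UNIV_22 by simp
qed

lemma sympJ_nth [simp]:
  "sympJ $ Inl a $ Inl b = 0" "sympJ $ Inr a $ Inr b = 0"
  "sympJ $ Inl a $ Inr b = (if a = b then 1 else 0)"
  "sympJ $ Inr a $ Inl b = (if a = b then - 1 else 0)"
  by (simp_all add: sympJ_def)

lemma sympJ_sq: "sympJ ** sympJ = - mat 1"
  by (simp add: vec_eq_iff forall_22 matrix_matrix_mult_def sum_22 mat_def)

text \<open>The embedding into real matrices is multiplicative and injective, and over the reals a
  one-sided inverse of a square matrix is two-sided.\<close>

lemma int_matrix_left_inverse_imp_right:
  fixes A B :: "int^'n^'n"
  assumes "A ** B = mat 1"
  shows "B ** A = mat 1"
proof -
  let ?r = "map_matrix real_of_int"
  have hom: "?r (X ** Y) = ?r X ** ?r Y" for X Y :: "int^'n^'n"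
    by (simp add: vec_eq_iff matrix_matrix_mult_def)
  have one: "?r (mat 1 :: int^'n^'n) = mat 1"
    by (simp add: vec_eq_iff mat_def)
  have "?r A ** ?r B = mat 1" using assms hom one by metis
  then have "?r B ** ?r A = mat 1" by (simp add: matrix_left_right_inverse)
  then have "?r (B ** A) = ?r (mat 1 :: int^'n^'n)" by (simp only: hom one)
  then show ?thesis by (simp add: vec_eq_iff)
qed

definition sympinv :: "imat4 \<Rightarrow> imat4" where
  "sympinv g = - sympJ ** transpose g ** sympJ"

lemma matrix_neg_left: "(- A) ** B = - (A ** B)" for A :: "'a::ring_1^'n^'m" and B :: "'a^'k^'n"
  by (simp add: vec_eq_iff matrix_matrix_mult_def sum_negf)

lemma matrix_neg_right: "A ** (- B) = - (A ** B)" for A :: "'a::ring_1^'n^'m" and B :: "'a^'k^'n"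
  by (simp add: vec_eq_iff matrix_matrix_mult_def sum_negf)

lemma sympinv_left:
  assumes "g \<in> Gamma2"
  shows "sympinv g ** g = mat 1"
proof -
  have "sympinv g ** g = - (sympJ ** (transpose g ** sympJ ** g))"
    by (simp add: sympinv_def matrix_neg_left matrix_mul_assoc)
  also have "\<dots> = mat 1"
    using assms by (simp add: Gamma2_def sympJ_sq)
  finally show ?thesis .
qed

lemma sympinv_right: "g \<in> Gamma2 \<Longrightarrow> g ** sympinv g = mat 1"
  using sympinv_left int_matrix_left_inverse_imp_right by blast

text \<open>\<open>Gamma2\<close> is defined by relations between columns, while cosets are governed
  by the lower rows. That \<open>sympinv g\<close> is also a right inverse carries the relations
  over to rows.\<close>

lemma Gamma2_transpose:
  assumes "g \<in> Gamma2"
  shows "g ** sympJ ** transpose g = sympJ"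
proof -
  have "sympJ = - ((g ** sympinv g) ** - sympJ)"
    by (simp add: sympinv_right[OF assms] matrix_neg_right)
  also have "\<dots> = - (g ** sympJ ** transpose g ** (sympJ ** sympJ))"
    by (simp add: sympinv_def matrix_neg_left matrix_neg_right matrix_mul_assoc)
  also have "\<dots> = g ** sympJ ** transpose g"
    by (simp add: sympJ_sq matrix_neg_right)
  finally show ?thesis by simp
qed

lemma Gamma2_mult:
  assumes "g \<in> Gamma2" "h \<in> Gamma2"
  shows "g ** h \<in> Gamma2"
proof -
  have "transpose (g ** h) ** sympJ ** (g ** h) = transpose h ** (transpose g ** sympJ ** g) ** h"
    by (simp add: matrix_transpose_mul matrix_mul_assoc)
  then show ?thesis using assms by (simp add: Gamma2_def)
qed

lemma Gamma2_inv:
  assumes "g \<in> Gamma2"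
  shows "sympinv g \<in> Gamma2"
proof -
  have "transpose (sympinv g) ** sympJ ** sympinv g
      = transpose (sympinv g) ** (transpose g ** sympJ ** g) ** sympinv g"
    using assms by (simp add: Gamma2_def)
  also have "\<dots> = transpose (g ** sympinv g) ** sympJ ** (g ** sympinv g)"
    by (simp add: matrix_transpose_mul matrix_mul_assoc)
  also have "\<dots> = sympJ" by (simp add: sympinv_right[OF assms] transpose_mat)
  finally show ?thesis by (simp add: Gamma2_def)
qed

lemma Gamma2_one: "mat 1 \<in> Gamma2"
  by (simp add: Gamma2_def transpose_mat)

lemma blockC_mult: "blockC (g ** h) = blockC g ** blockA h + blockD g ** blockC h"
  by (simp add: vec_eq_iff blockA_def blockC_def blockD_def matrix_matrix_mult_def sum_22 sum_2)

lemma blockC_sympinv: "blockC (sympinv g) = - transpose (blockC g)"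
  by (simp add: vec_eq_iff blockC_def sympinv_def matrix_matrix_mult_def sum_22 transpose_def forall_2)

lemma Gamma20_mult: "g \<in> Gamma20 \<Longrightarrow> h \<in> Gamma20 \<Longrightarrow> g ** h \<in> Gamma20"
  by (simp add: Gamma20_def Gamma2_mult blockC_mult)

lemma Gamma20_inv: "g \<in> Gamma20 \<Longrightarrow> sympinv g \<in> Gamma20"
  by (simp add: Gamma20_def Gamma2_inv blockC_sympinv transpose_def vec_eq_iff)

lemma Gamma20_one: "mat 1 \<in> Gamma20"
proof -
  have "blockC (mat 1) = 0" by (simp add: blockC_def mat_def vec_eq_iff)
  then show ?thesis by (simp add: Gamma20_def Gamma2_one)
qed

lemma Gamma20_coset_eq:
  assumes "u \<in> Gamma20" 
  shows "(\<lambda>x. x ** (u ** g)) ` Gamma20 = (\<lambda>x. x ** g) ` Gamma20"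
proof (intro equalityI subsetI)
  fix y assume "y \<in> (\<lambda>x. x ** (u ** g)) ` Gamma20"
  then obtain x where "x \<in> Gamma20" "y = x ** (u ** g)" by auto
  then show "y \<in> (\<lambda>x. x ** g) ` Gamma20"
    using assms Gamma20_mult[of x u] by (auto simp: matrix_mul_assoc)
next
  fix y assume "y \<in> (\<lambda>x. x ** g) ` Gamma20"
  then obtain x where x: "x \<in> Gamma20" "y = x ** g" by auto
  have "sympinv u ** u = mat 1" using assms sympinv_left by (auto simp: Gamma20_def)
  then have "y = (x ** sympinv u) ** (u ** g)"
    using x by (metis matrix_mul_assoc matrix_mul_rid)
  then show "y \<in> (\<lambda>x. x ** (u ** g)) ` Gamma20"
    using x assms Gamma20_mult Gamma20_inv by blast
qed

section \<open>Pluecker coordinates of cosets\<close>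

definition sform :: "int^(2+2) \<Rightarrow> int^(2+2) \<Rightarrow> int" where
  "sform x y = x $ Inl 1 * y $ Inr 1 + x $ Inl 2 * y $ Inr 2 - x $ Inr 1 * y $ Inl 1 - x $ Inr 2 * y $ Inl 2"

lemma sympJ_sandwich: "(g ** sympJ ** transpose h) $ i $ j = sform (g $ i) (h $ j)"
  by (simp add: matrix_matrix_mult_def sum_22 transpose_def sform_def)

lemma Gamma2_rows: "g \<in> Gamma2 \<Longrightarrow> sform (g $ i) (g $ j) = sympJ $ i $ j"
  using Gamma2_transpose sympJ_sandwich by metis

lemma Gamma2_cols:
  "g \<in> Gamma2 \<longleftrightarrow> (\<forall>i j. sform (column i g) (column j g) = sympJ $ i $ j)"
proof -
  have "(transpose g ** sympJ ** g) $ i $ j = sform (column i g) (column j g)" for i j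
    using sympJ_sandwich[of "transpose g" "transpose g" i j]
    by (simp add: column_def transpose_def)
  then show ?thesis by (simp add: Gamma2_def vec_eq_iff)
qed

type_synonym vec5 = "int \<times> int \<times> int \<times> int \<times> int"

text \<open>The \<open>2 \<times> 2\<close> minors \<open>([c\<^sub>1,c\<^sub>2], [c\<^sub>1,d\<^sub>2], [c\<^sub>2,d\<^sub>2], [d\<^sub>1,c\<^sub>2], [d\<^sub>1,d\<^sub>2])\<close> of
  \<open>(C, D)\<close>; the sixth one is \<open>[c\<^sub>1,d\<^sub>1] = - [c\<^sub>2,d\<^sub>2]\<close>, since the rows are symplectically orthogonal.
  With this relation the Pluecker equation becomes the one of \<open>isotropic 1\<close> below.\<close>

definition wedge :: "int^(2+2) \<Rightarrow> int^(2+2) \<Rightarrow> vec5" where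
  "wedge x y =
    (x $ Inl 1 * y $ Inl 2 - x $ Inl 2 * y $ Inl 1,
     x $ Inl 1 * y $ Inr 2 - x $ Inr 2 * y $ Inl 1,
     x $ Inl 2 * y $ Inr 2 - x $ Inr 2 * y $ Inl 2,
     x $ Inr 1 * y $ Inl 2 - x $ Inl 2 * y $ Inr 1,
     x $ Inr 1 * y $ Inr 2 - x $ Inr 2 * y $ Inr 1)"

definition plucker :: "imat4 \<Rightarrow> vec5" where
  "plucker g = wedge (g $ Inr 1) (g $ Inr 2)"

definition smult5 :: "int \<Rightarrow> vec5 \<Rightarrow> vec5" where
  "smult5 c = (\<lambda>(a, u, h, v, w). (c * a, c * u, c * h, c * v, c * w))"

text \<open>For t = 1 this is the Pluecker quadric, for t = p the one of the Hecke operator. The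
  divisor condition is primitivity; it also excludes the zero vector, whose entries are divisible by
  every integer.\<close>

definition isotropic :: "int \<Rightarrow> vec5 set" where
  "isotropic t = {(a, u, h, v, w). t * h\<^sup>2 + a * w = u * v \<and>
     (\<forall>q. q dvd a \<longrightarrow> q dvd u \<longrightarrow> q dvd h \<longrightarrow> q dvd v \<longrightarrow> q dvd w \<longrightarrow> q dvd 1)}"

lemma isotropic_iff:
  "(a, u, h, v, w) \<in> isotropic t \<longleftrightarrow> t * h\<^sup>2 + a * w = u * v \<and>
     (\<forall>q. q dvd a \<longrightarrow> q dvd u \<longrightarrow> q dvd h \<longrightarrow> q dvd v \<longrightarrow> q dvd w \<longrightarrow> q dvd 1)"
  by (simp add: isotropic_def)

lemma zero_notin_isotropic: "(0, 0, 0, 0, 0) \<notin> isotropic t"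
  unfolding isotropic_iff using dvd_0_left_iff[of "1::int"] by fastforce

text \<open>The vectors b and d are dual to x and y under the symplectic form. By Cauchy-Binet the
  determinant 1 of the four pairings is an integral combination of the minors of x and y, so every
  common divisor of the minors divides 1.\<close>

lemma wedge_in_isotropic:
  assumes "sform x y = 0" "sform b x = 1" "sform b y = 0" "sform d x = 0" "sform d y = 1"
  shows "wedge x y \<in> isotropic 1"
proof -
  define x1 x2 x3 x4 where "x1 = x $ Inl 1" "x2 = x $ Inl 2" "x3 = x $ Inr 1" "x4 = x $ Inr 2"
  define y1 y2 y3 y4 where "y1 = y $ Inl 1" "y2 = y $ Inl 2" "y3 = y $ Inr 1" "y4 = y $ Inr 2"
  define b1 b2 b3 b4 where "b1 = b $ Inl 1" "b2 = b $ Inl 2" "b3 = b $ Inr 1" "b4 = b $ Inr 2"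
  define d1 d2 d3 d4 where "d1 = d $ Inl 1" "d2 = d $ Inl 2" "d3 = d $ Inr 1" "d4 = d $ Inr 2"
  note defs = x1_x2_x3_x4_def y1_y2_y3_y4_def b1_b2_b3_b4_def d1_d2_d3_d4_def
  define A U H V W where "A = x1 * y2 - x2 * y1" "U = x1 * y4 - x4 * y1" "H = x2 * y4 - x4 * y2"
    "V = x3 * y2 - x2 * y3" "W = x3 * y4 - x4 * y3"
  note Defs = A_U_H_V_W_def
  have xy: "x1 * y3 + x2 * y4 - x3 * y1 - x4 * y2 = 0"
    using assms(1) by (simp add: sform_def defs)
  have H': "x1 * y3 - x3 * y1 = - H" using xy by (simp add: Defs)
  have quad: "H\<^sup>2 + A * W = U * V"
  proof -
    have "A * W - U * V = H * (x1 * y3 - x3 * y1)" by (simp add: Defs) algebra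
    then show ?thesis by (simp add: H' power2_eq_square)
  qed
  have "1 = sform b x * sform d y - sform b y * sform d x" using assms by simp
  also have "\<dots> = (b3*d4-b4*d3)*A + (b3*d2-b2*d3)*(-U) + (b1*d3-b3*d1)*(x1*y3-x3*y1)
     + (b4*d1 - b1*d4)*V + (b1*d2-b2*d1)*W + (b2*d4-b4*d2)*H"
    by (simp add: sform_def defs Defs) algebra
  finally have bez: "1 = \<dots>" .
  have "q dvd 1" if "q dvd A" "q dvd U" "q dvd H" "q dvd V" "q dvd W" for q
    unfolding bez H' using that by (intro dvd_add dvd_mult) auto
  moreover have "wedge x y = (A, U, H, V, W)" by (simp add: wedge_def defs Defs)
  ultimately show ?thesis using quad by (auto simp: isotropic_iff)
qed

lemma plucker_isotropic:
  assumes "g \<in> Gamma2"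
  shows "plucker g \<in> isotropic 1"
  unfolding plucker_def
  by (rule wedge_in_isotropic[where b = "g $ Inl 1" and d = "g $ Inl 2"])
     (simp_all add: Gamma2_rows[OF assms])

text \<open>If \<open>x\<close> lies in the plane \<open>\<langle>y, y'\<rangle>\<close> then \<open>x \<and> y \<and> y' = 0\<close>, and contracting this with the
  symplectic form gives \<open>\<langle>x, y\<rangle> y' = \<langle>x, y'\<rangle> y\<close>.\<close>

lemma sform_eq_0_of_wedge_eq:
  assumes "sform x x' = 0" "sform y y' = 0"
    and "wedge x x' = smult5 e (wedge y y')" "e \<noteq> 0" "wedge y y' \<in> isotropic 1"
  shows "sform x y = 0" "sform x y' = 0"
proof -
  define x1 x2 x3 x4 where "x1 = x $ Inl 1" "x2 = x $ Inl 2" "x3 = x $ Inr 1" "x4 = x $ Inr 2"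
  define z1 z2 z3 z4 where "z1 = x' $ Inl 1" "z2 = x' $ Inl 2" "z3 = x' $ Inr 1" "z4 = x' $ Inr 2"
  define y1 y2 y3 y4 where "y1 = y $ Inl 1" "y2 = y $ Inl 2" "y3 = y $ Inr 1" "y4 = y $ Inr 2"
  define t1 t2 t3 t4 where "t1 = y' $ Inl 1" "t2 = y' $ Inl 2" "t3 = y' $ Inr 1" "t4 = y' $ Inr 2"
  note defs = x1_x2_x3_x4_def y1_y2_y3_y4_def z1_z2_z3_z4_def t1_t2_t3_t4_def
  define A U H V W where "A = y1 * t2 - y2 * t1" "U = y1 * t4 - y4 * t1" "H = y2 * t4 - y4 * t2"
    "V = y3 * t2 - y2 * t3" "W = y3 * t4 - y4 * t3"
  note Defs = A_U_H_V_W_def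
  have w: "wedge y y' = (A, U, H, V, W)" by (simp add: wedge_def defs Defs)
  have eqs: "x1 * z2 - x2 * z1 = e * A" "x1 * z4 - x4 * z1 = e * U" "x2 * z4 - x4 * z2 = e * H"
    "x3 * z2 - x2 * z3 = e * V" "x3 * z4 - x4 * z3 = e * W"
    using assms(3) unfolding w by (simp_all add: wedge_def defs smult5_def)
  have H': "y1 * t3 - y3 * t1 = - H"
    using assms(2) by (simp add: sform_def defs Defs)
  have eqH: "x1 * z3 - x3 * z1 = - (e * H)"
    using assms(1) eqs(3) by (simp add: sform_def defs)
  define S T where "S = sform x y" and "T = sform x y'"
  have S: "S = x1 * y3 + x2 * y4 - x3 * y1 - x4 * y2" and T: "T = x1 * t3 + x2 * t4 - x3 * t1 - x4 * t2"
    by (simp_all add: S_def T_def sform_def defs)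
  have e0: "e * X = 0 \<Longrightarrow> X = 0" for X using assms(4) by simp
  \<comment> \<open>Up to sign, the left sides of \<open>w1\<close> to \<open>w4\<close> are the
    coordinates of x \<and> y \<and> y'. Multiplied by e they become those of x \<and> x \<and> x' =
    0.\<close>
  have w1: "x2 * H - x1 * V + x3 * A = 0" 
    by (rule e0, use eqs eqH in algebra)
  have w2: "x1 * H - x2 * U + x4 * A = 0"
    by (rule e0, use eqs eqH in algebra)
  have w3: "x1 * W - x4 * H - x3 * U = 0"
    by (rule e0, use eqs eqH in algebra)
  have w4: "x2 * W - x4 * V - x3 * H = 0"
    by (rule e0, use eqs eqH in algebra)
  have k1: "S * t1 = T * y1" 
    using w2 H' unfolding S T Defs by algebra
  have k2: "S * t2 = T * y2"
    using w1 H' unfolding S T Defs by algebra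
  have k3: "S * t3 = T * y3"
    using w4 H' unfolding S T Defs by algebra
  have k4: "S * t4 = T * y4"
    using w3 H' unfolding S T Defs by algebra
  \<comment> \<open>The relations say S y' = T y. Hence S (y \<and> y') = y \<and> T y = 0, likewise
    T (y \<and> y') = 0, and a non-zero minor forces S = T = 0.\<close>
  have "S * A = 0" "S * U = 0" "S * H = 0" "S * V = 0" "S * W = 0"
    "T * A = 0" "T * U = 0" "T * H = 0" "T * V = 0" "T * W = 0"
    unfolding Defs using k1 k2 k3 k4 by algebra+
  moreover have "\<not> (A = 0 \<and> U = 0 \<and> H = 0 \<and> V = 0 \<and> W = 0)"
    using assms(5) zero_notin_isotropic unfolding w by auto
  ultimately show "sform x y = 0" "sform x y' = 0"
    unfolding S_def[symmetric] T_def[symmetric] by auto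
qed

text \<open>This is the coset criterion: g h^-1 has vanishing lower left block exactly when the
  lower rows of g are orthogonal to those of h, that is, when both span the same Lagrangian
  plane.\<close>

lemma blockC_mult_sympinv:
  "blockC (g ** sympinv h) $ i $ j = sform (g $ Inr i) (h $ Inr j)"
proof -
  have "g ** sympinv h = - ((g ** sympJ ** transpose h) ** sympJ)"
    by (simp add: sympinv_def matrix_neg_left matrix_neg_right matrix_mul_assoc)
  then have "blockC (g ** sympinv h) $ i $ j = - (((g ** sympJ ** transpose h) ** sympJ) $ Inr i $ Inl j)"
    by (simp add: blockC_def)
  also have "\<dots> = sform (g $ Inr i) (h $ Inr j)"
    by (simp add: matrix_matrix_mult_def[of "g ** sympJ ** transpose h"] sum_22 sympJ_sandwich)
       (use forall_2[of "\<lambda>j. _ j"] exhaust_2[of j] in auto)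
  finally show ?thesis .
qed

lemma plucker_eq_imp_coset:
  assumes "g \<in> Gamma2" "h \<in> Gamma2" "plucker g = smult5 e (plucker h)" "e \<noteq> 0"
  shows "\<exists>u\<in>Gamma20. g = u ** h"
proof -
  have 1: "sform (g $ Inr 1) (h $ Inr 1) = 0 \<and> sform (g $ Inr 1) (h $ Inr 2) = 0"
    using sform_eq_0_of_wedge_eq[of "g $ Inr 1" "g $ Inr 2" "h $ Inr 1" "h $ Inr 2" e]
      assms plucker_isotropic[of h]
    by (simp add: plucker_def Gamma2_rows)
  \<comment> \<open>The conclusion of \<open>sform_eq_0_of_wedge_eq\<close> concerns the first
    vector of the wedge. Exchanging the rows of g reaches the second one and turns e into
    -e.\<close>
  have neg: "wedge y x = smult5 (-1) (wedge x y)" for x y by (simp add: wedge_def smult5_def)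
  have 2: "sform (g $ Inr 2) (h $ Inr 1) = 0 \<and> sform (g $ Inr 2) (h $ Inr 2) = 0"
    using sform_eq_0_of_wedge_eq[of "g $ Inr 2" "g $ Inr 1" "h $ Inr 1" "h $ Inr 2" "-e"]
      assms plucker_isotropic[of h]
    by (simp add: plucker_def Gamma2_rows neg[of "g $ Inr 2"] ) (auto simp: smult5_def split: prod.splits)
  have "blockC (g ** sympinv h) = 0"
    using 1 2 by (simp add: vec_eq_iff blockC_mult_sympinv forall_2)
  then have "g ** sympinv h \<in> Gamma20"
    using assms by (simp add: Gamma20_def Gamma2_mult Gamma2_inv)
  moreover have "g = (g ** sympinv h) ** h"
    using sympinv_left[OF assms(2)] by (metis matrix_mul_assoc matrix_mul_rid)
  ultimately show ?thesis by blast
qed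

text \<open>With C = 0 the lower rows of u g are D times those of g, so all minors are multiplied by
  det D. The symplectic relation A D^t = 1 makes det D a unit.\<close>

lemma plucker_Gamma20_mult:
  assumes "u \<in> Gamma20"
  shows "\<exists>e\<in>{1, -1}. \<forall>g. plucker (u ** g) = smult5 e (plucker g)"
proof -
  have C0: "blockC u = 0" and u: "u \<in> Gamma2" using assms by (auto simp: Gamma20_def)
  have c: "u $ Inr i $ Inl j = 0" for i j
  proof -
    have "blockC u $ i $ j = 0" by (simp add: C0)
    then show ?thesis by (simp add: blockC_def)
  qed
  let ?e = "det (blockD u)"
  have e: "?e = u $ Inr 1 $ Inr 1 * u $ Inr 2 $ Inr 2 - u $ Inr 1 $ Inr 2 * u $ Inr 2 $ Inr 1"
    by (simp add: det_2 blockD_def)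
  have r: "sform (u $ Inl i) (u $ Inr j) = (if i = j then 1 else 0)" for i j
    by (simp add: Gamma2_rows[OF u])
  have "det (blockA u) * ?e = 1"
  proof -
    have r': "u $ Inl i $ Inl 1 * u $ Inr j $ Inr 1 + u $ Inl i $ Inl 2 * u $ Inr j $ Inr 2 = (if i = j then 1 else 0)" for i j
      using r[of i j] by (simp add: sform_def c)
    show ?thesis
      using r'[of 1 1] r'[of 1 2] r'[of 2 1] r'[of 2 2]
      unfolding e by (simp add: det_2 blockA_def) algebra
  qed
  then have "?e dvd 1" by (metis dvd_triv_right)
  then have "?e \<in> {1, -1}" by auto
  moreover have "plucker (u ** g) = smult5 ?e (plucker g)" for g
    unfolding plucker_def wedge_def smult5_def e
    by (simp add: matrix_matrix_mult_def sum_22 c algebra_simps)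
  ultimately show ?thesis by blast
qed

section \<open>Surjectivity onto the primitive isotropic vectors\<close>

definition of_rows :: "int list list \<Rightarrow> imat4" where
  "of_rows M = (let ix = (\<lambda>i. if i = Inl 1 then 0 else if i = Inl 2 then 1 else if i = Inr 1 then 2 else 3)
     in (\<chi> i j. M ! ix i ! ix j))"

text \<open>\<open>trans1\<close>, \<open>trans2\<close>, \<open>trans3\<close> translate the
  entries x, z, y of Z by n; \<open>inv1\<close> and \<open>inv2\<close> are the inversions in the
  two diagonally embedded copies of SL(2).\<close>

definition trans1 :: "int \<Rightarrow> imat4" where
  "trans1 n = of_rows [[1, 0, n, 0], [0, 1, 0, 0], [0, 0, 1, 0], [0, 0, 0, 1]]"

definition trans2 :: "int \<Rightarrow> imat4" where
  "trans2 n = of_rows [[1, 0, 0, 0], [0, 1, 0, n], [0, 0, 1, 0], [0, 0, 0, 1]]"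

definition trans3 :: "int \<Rightarrow> imat4" where
  "trans3 n = of_rows [[1, 0, 0, n], [0, 1, n, 0], [0, 0, 1, 0], [0, 0, 0, 1]]"

definition inv1 :: imat4 where
  "inv1 = of_rows [[0, 0, -1, 0], [0, 1, 0, 0], [1, 0, 0, 0], [0, 0, 0, 1]]"

definition inv2 :: imat4 where
  "inv2 = of_rows [[1, 0, 0, 0], [0, 0, 0, -1], [0, 0, 1, 0], [0, 1, 0, 0]]"

lemmas gens_def = trans1_def trans2_def trans3_def inv1_def inv2_def of_rows_def

lemma gens_Gamma2:
  "trans1 n \<in> Gamma2" "trans2 n \<in> Gamma2" "trans3 n \<in> Gamma2" "inv1 \<in> Gamma2" "inv2 \<in> Gamma2"
  by (simp_all add: Gamma2_cols forall_22 sform_def column_def gens_def)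

lemma plucker_mult_gens:
  assumes "g \<in> Gamma2" "plucker g = (a, u, h, v, w)"
  shows "plucker (g ** trans1 n) = (a, u, h, v + n * a, w + n * u)"
    and "plucker (g ** trans2 n) = (a, u + n * a, h, v, w + n * v)"
    and "plucker (g ** trans3 n) = (a, u, h - n * a, v, w + 2 * n * h - n\<^sup>2 * a)"
    and "plucker (g ** inv1) = (v, w, h, - a, - u)"
    and "plucker (g ** inv2) = (u, - a, h, w, - v)"
proof -
  \<comment> \<open>\<open>trans3\<close> brings in the sixth minor [c1, d1], which is -h by
    orthogonality of the lower rows.\<close>
  have h: "g $ Inr 1 $ Inl 1 * g $ Inr 2 $ Inr 1 - g $ Inr 1 $ Inr 1 * g $ Inr 2 $ Inl 1 = - h"
    using Gamma2_rows[OF assms(1), of "Inr 1" "Inr 2"] assms(2)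
    by (simp add: sform_def plucker_def wedge_def)
  show "plucker (g ** trans1 n) = (a, u, h, v + n * a, w + n * u)"
    "plucker (g ** trans2 n) = (a, u + n * a, h, v, w + n * v)"
    "plucker (g ** inv1) = (v, w, h, - a, - u)"
    "plucker (g ** inv2) = (u, - a, h, w, - v)"
    using assms(2) unfolding plucker_def wedge_def
    by (auto simp: gens_def matrix_matrix_mult_def sum_22 algebra_simps)
  show "plucker (g ** trans3 n) = (a, u, h - n * a, v, w + 2 * n * h - n\<^sup>2 * a)"
    using assms(2) h unfolding plucker_def wedge_def
    by (auto simp: gens_def matrix_matrix_mult_def sum_22 algebra_simps power2_eq_square)
       algebra+
qed

definition lagr :: "vec5 set" where
  "lagr = plucker ` Gamma2"

lemma lagr_closed:
  assumes "(a, u, h, v, w) \<in> lagr"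
  shows "(a, u, h, v + n * a, w + n * u) \<in> lagr"
    and "(a, u + n * a, h, v, w + n * v) \<in> lagr"
    and "(a, u, h - n * a, v, w + 2 * n * h - n\<^sup>2 * a) \<in> lagr"
    and "(v, w, h, - a, - u) \<in> lagr"
    and "(u, - a, h, w, - v) \<in> lagr"
    and "(- a, - u, - h, - v, - w) \<in> lagr"
proof -
  obtain g where g: "g \<in> Gamma2" "plucker g = (a, u, h, v, w)"
    using assms unfolding lagr_def by force
  \<comment> \<open>This element has C = 0 and det D = -1, so multiplication from the left changes
    the sign of all minors.\<close>
  let ?s = "of_rows [[-1, 0, 0, 0], [0, 1, 0, 0], [0, 0, -1, 0], [0, 0, 0, 1]]"
  have "?s \<in> Gamma2"
    by (simp add: Gamma2_cols forall_22 sform_def column_def gens_def)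
  then have s: "?s ** g \<in> Gamma2" using g Gamma2_mult by blast
  have "plucker (?s ** g) = (- a, - u, - h, - v, - w)"
    using g(2) unfolding plucker_def wedge_def
    by (auto simp: of_rows_def matrix_matrix_mult_def sum_22 algebra_simps)
  then show "(- a, - u, - h, - v, - w) \<in> lagr" 
    unfolding lagr_def using s by (metis imageI)
  note [simp] = plucker_mult_gens[OF g]
  have c: "plucker (g ** x) \<in> lagr" if "x \<in> Gamma2" for x
    unfolding lagr_def using that g Gamma2_mult by blast
  show "(a, u, h, v + n * a, w + n * u) \<in> lagr"
    "(a, u + n * a, h, v, w + n * v) \<in> lagr"
    "(a, u, h - n * a, v, w + 2 * n * h - n\<^sup>2 * a) \<in> lagr"
    "(v, w, h, - a, - u) \<in> lagr"
    "(u, - a, h, w, - v) \<in> lagr"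
    using c[OF gens_Gamma2(1), of n] c[OF gens_Gamma2(2), of n] c[OF gens_Gamma2(3), of n]
      c[OF gens_Gamma2(4)] c[OF gens_Gamma2(5)] by simp_all
qed

text \<open>The descent passes to a smaller vector and then has to come back, so every move must be
  reversible: a translation is undone by -n, an inversion by its third power.\<close>

lemma lagr_gens_iff:
  "(a, u, h, v + n * a, w + n * u) \<in> lagr \<longleftrightarrow> (a, u, h, v, w) \<in> lagr"
  "(a, u + n * a, h, v, w + n * v) \<in> lagr \<longleftrightarrow> (a, u, h, v, w) \<in> lagr"
  "(a, u, h - n * a, v, w + 2 * n * h - n\<^sup>2 * a) \<in> lagr \<longleftrightarrow> (a, u, h, v, w) \<in> lagr"
  "(v, w, h, - a, - u) \<in> lagr \<longleftrightarrow> (a, u, h, v, w) \<in> lagr"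
  "(u, - a, h, w, - v) \<in> lagr \<longleftrightarrow> (a, u, h, v, w) \<in> lagr"
proof -
  show "(a, u, h, v + n * a, w + n * u) \<in> lagr \<longleftrightarrow> (a, u, h, v, w) \<in> lagr"
    using lagr_closed(1)[of a u h v w n] lagr_closed(1)[of a u h "v + n * a" "w + n * u" "-n"] by auto
  show "(a, u + n * a, h, v, w + n * v) \<in> lagr \<longleftrightarrow> (a, u, h, v, w) \<in> lagr"
    using lagr_closed(2)[of a u h v w n] lagr_closed(2)[of a "u + n * a" h v "w + n * v" "-n"] by auto
  show "(a, u, h - n * a, v, w + 2 * n * h - n\<^sup>2 * a) \<in> lagr \<longleftrightarrow> (a, u, h, v, w) \<in> lagr"
    using lagr_closed(3)[of a u h v w n]
      lagr_closed(3)[of a u "h - n * a" v "w + 2 * n * h - n\<^sup>2 * a" "-n"]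
    by (auto simp: algebra_simps power2_eq_square)
  show "(v, w, h, - a, - u) \<in> lagr \<longleftrightarrow> (a, u, h, v, w) \<in> lagr"
    using lagr_closed(4)[of a u h v w] lagr_closed(4)[of v w h "-a" "-u"]
      lagr_closed(4)[of "-a" "-u" h "-v" "-w"] lagr_closed(4)[of "-v" "-w" h a u] by auto
  show "(u, - a, h, w, - v) \<in> lagr \<longleftrightarrow> (a, u, h, v, w) \<in> lagr"
    using lagr_closed(5)[of a u h v w] lagr_closed(5)[of u "-a" h w "-v"]
      lagr_closed(5)[of "-a" "-u" h "-v" "-w"] lagr_closed(5)[of "-u" a h "-w" v] by auto
qed

text \<open>These moves fix h and preserve a w - u v. Therefore t can be arbitrary, and the same
  moves act on the quadric with t = p in the Hecke part.\<close>

lemma isotropic_gens: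
  assumes "(a, u, h, v, w) \<in> isotropic t"
  shows "(a, u, h, v + n * a, w + n * u) \<in> isotropic t"
    and "(a, u + n * a, h, v, w + n * v) \<in> isotropic t"
    and "(v, w, h, - a, - u) \<in> isotropic t"
    and "(u, - a, h, w, - v) \<in> isotropic t"
  using assms unfolding isotropic_iff
  by (auto simp: algebra_simps dvd_add_left_iff dvd_add_right_iff)

lemma lagr_unit: "(1, 0, 0, 0, 0) \<in> lagr"
proof -
  have "plucker (mat 1) = (0, 0, 0, 0, 1)"
    by (simp add: plucker_def wedge_def mat_def)
  then have "(0, 0, 0, 0, 1) \<in> lagr"
    unfolding lagr_def using Gamma2_one by (metis imageI)
  from lagr_closed(4)[OF lagr_closed(5)[OF this]] lagr_closed(6) show ?thesis by fastforce
qed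

text \<open>The moves act on \<open>((a, u), (v, w))\<close> by row and column operations of \<open>SL(2,\<int>)\<close>, so the
  descent is the Euclidean algorithm on the entries.\<close>

lemma isotropic_subset_lagr_aux:
  assumes "a \<noteq> 0" "(a, u, h, v, w) \<in> isotropic 1"
  shows "(a, u, h, v, w) \<in> lagr"
  using assms
proof (induction "nat \<bar>a\<bar>" arbitrary: a u h v w rule: less_induct)
  case less
  have mod_less: "nat \<bar>x mod b\<bar> < nat \<bar>b\<bar>" if "b \<noteq> 0" for x b :: int
    using that abs_mod_less by simp
  \<comment> \<open>Stated for every b with |b| = |a|, since it is applied to -a as well as to
    a.\<close>
  have not_dvd_u: "(b, u, h, v, w) \<in> lagr"
    if b: "nat \<bar>b\<bar> = nat \<bar>a\<bar>" "b \<noteq> 0" "\<not> b dvd u" "(b, u, h, v, w) \<in> isotropic 1" for b u h v w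
  proof -
    define w' where "w' = w + - (u div b) * v"
    have m: "u + - (u div b) * b = u mod b" by (simp add: minus_div_mult_eq_mod)
    have "(b, u mod b, h, v, w') \<in> isotropic 1"
      using isotropic_gens(2)[OF b(4), of "- (u div b)"] unfolding m w'_def .
    from isotropic_gens(4)[OF this] have "(u mod b, - b, h, w', - v) \<in> isotropic 1" .
    moreover have "nat \<bar>u mod b\<bar> < nat \<bar>a\<bar>" "u mod b \<noteq> 0"
      using mod_less[of b u] b by (simp_all add: dvd_eq_mod_eq_0)
    ultimately have "(u mod b, - b, h, w', - v) \<in> lagr"
      using less(1) by blast
    then have "(b, u mod b, h, v, w') \<in> lagr" by (rule iffD1[OF lagr_gens_iff(5)])
    then show ?thesis
      using lagr_gens_iff(2)[of b u "- (u div b)" h v w] unfolding m w'_def by simp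
  qed
  have not_dvd_v: "(a, u, h, v, w) \<in> lagr" if "\<not> a dvd v"
  proof -
    define w' where "w' = w + - (v div a) * u"
    have m: "v + - (v div a) * a = v mod a" by (simp add: minus_div_mult_eq_mod)
    have "(a, u, h, v mod a, w') \<in> isotropic 1"
      using isotropic_gens(1)[OF less(3), of "- (v div a)"] unfolding m w'_def .
    from isotropic_gens(3)[OF this] have "(v mod a, w', h, - a, - u) \<in> isotropic 1" .
    moreover have "nat \<bar>v mod a\<bar> < nat \<bar>a\<bar>" "v mod a \<noteq> 0"
      using mod_less[of a v] that less(2) by (simp_all add: dvd_eq_mod_eq_0)
    ultimately have "(v mod a, w', h, - a, - u) \<in> lagr"
      using less(1) by blast
    then have "(a, u, h, v mod a, w') \<in> lagr" by (rule iffD1[OF lagr_gens_iff(4)])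
    then show ?thesis
      using lagr_gens_iff(1)[of a u h v "- (v div a)" w] unfolding m w'_def by simp
  qed
  show ?case
  proof (cases "a dvd u \<and> a dvd v")
    case False
    then show ?thesis using not_dvd_u[of a] not_dvd_v less by blast
  next
    case True
    then obtain u' v' where uv: "u = a * u'" "v = a * v'" by (meson dvdE)
    define w' where "w' = w - v' * u"
    have P': "(a, u, h, 0, w') \<in> isotropic 1"
      using isotropic_gens(1)[OF less(3), of "-v'"] by (simp add: uv w'_def algebra_simps)
    have from_zero: "(a, u, h, v, w) \<in> lagr" if "(a, u, h, 0, w') \<in> lagr"
      using lagr_closed(1)[OF that, of "v'"] by (simp add: uv w'_def algebra_simps)
    show ?thesis
    proof (cases "a dvd w'")
      case False
      \<comment> \<open>Two inversions and one translation carry w' into the second entry, as w' - u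
        next to the pivot -a. As a divides u but not w', \<open>not_dvd_u\<close> applies.\<close>
      have "(0, w', h, - a, - u) \<in> isotropic 1" using isotropic_gens(3)[OF P'] .
      then have "(0, w', h, - a, - u + w') \<in> isotropic 1"
        using isotropic_gens(1)[of 0 w' h "-a" "-u" 1 1] by simp
      from isotropic_gens(3)[OF this] have "(- a, - u + w', h, 0, - w') \<in> isotropic 1" by simp
      moreover have "\<not> - a dvd - u + w'"
      proof
        assume "- a dvd - u + w'"
        then have "a dvd w' - u" by simp
        then have "a dvd (w' - u) + u" using True dvd_add by blast
        then show False using False by simp
      qed
      ultimately have "(- a, - u + w', h, 0, - w') \<in> lagr"
        using not_dvd_u[of "-a"] less(2) by simp
      then have "(0, w', h, - a, - u + w') \<in> lagr"
        using lagr_gens_iff(4)[of "-a" "-u+w'" h 0 w'] lagr_gens_iff(4)[of 0 w' h "-a" "-u+w'"] by simp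
      then have "(0, w', h, - a, - u) \<in> lagr"
        using lagr_gens_iff(1)[of 0 w' h "-a" 1 "-u"] by simp
      then show ?thesis using from_zero lagr_gens_iff(4)[of 0 w' h a u] by simp
    next
      case dw: True
      \<comment> \<open>Here a divides u, 0 and w', and a^2 divides h^2, so a divides every entry
        and primitivity gives a = 1 or a = -1. Such a vector arises from (a, 0, 0, 0, 0) by
        translations.\<close>
      have h2: "h\<^sup>2 = - (a * w')" using P' by (simp add: isotropic_iff)
      obtain c where c: "w' = a * c" using dw by (rule dvdE)
      have "h\<^sup>2 = a\<^sup>2 * (- c)" unfolding h2 c by (simp add: power2_eq_square)
      then have "a\<^sup>2 dvd h\<^sup>2" by (metis dvd_triv_left)
      then have "a dvd h" by simp
      then have "a dvd 1" using P'[unfolded isotropic_iff, THEN conjunct2, THEN spec, of a] dw True by simp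
      then have "\<bar>a\<bar> = 1" by simp
      then have a: "a = 1 \<or> a = - 1" by linarith
      obtain h' where h': "h = a * h'" using \<open>a dvd h\<close> by (rule dvdE)
      have w': "w' = - a * h'\<^sup>2"
        using a h2 unfolding h' by (elim disjE) (simp_all add: power2_eq_square)
      have "(a, 0, 0, 0, 0) \<in> lagr" using a lagr_unit lagr_closed(6)[OF lagr_unit] by auto
      then have "(a, 0, h, 0, w') \<in> lagr"
        using lagr_closed(3)[of a 0 0 0 0 "-h'"] unfolding h' w' by (simp add: mult.commute[of a])
      then have "(a, u, h, 0, w') \<in> lagr"
        using lagr_closed(2)[of a 0 h 0 w' u'] unfolding uv(1) by (simp add: mult.commute[of a])
      then show ?thesis using from_zero by blast
    qed
  qed
qed

text \<open>The descent starts from a non-zero first entry. The inversions bring any non-zero one of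
  a, u, v, w into that place, and if all four vanish, so does h.\<close>

lemma isotropic_eq_lagr: "isotropic 1 = lagr"
proof
  show "lagr \<subseteq> isotropic 1" using plucker_isotropic by (auto simp: lagr_def)
  have P2: "(a, u, h, v, w) \<in> lagr" if P: "(a, u, h, v, w) \<in> isotropic 1" "a \<noteq> 0 \<or> u \<noteq> 0" for a u h v w
    using isotropic_subset_lagr_aux[of a u h v w] isotropic_subset_lagr_aux[of u "-a" h w "-v"]
      P isotropic_gens(4)[OF P(1)] lagr_gens_iff(5)[of u a h w v] by auto
  have P4: "(a, u, h, v, w) \<in> lagr"
    if P: "(a, u, h, v, w) \<in> isotropic 1" "a \<noteq> 0 \<or> u \<noteq> 0 \<or> v \<noteq> 0 \<or> w \<noteq> 0" for a u h v w
    using P2[of a u h v w] P2[of v w h "-a" "-u"] P isotropic_gens(3)[OF P(1)]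
      lagr_gens_iff(4)[of v w h a u] by auto
  show "isotropic 1 \<subseteq> lagr"
  proof
    fix P :: vec5 assume P: "P \<in> isotropic 1"
    obtain a u h v w where P': "P = (a, u, h, v, w)" by (cases P)
    show "P \<in> lagr"
    proof (cases "a \<noteq> 0 \<or> u \<noteq> 0 \<or> v \<noteq> 0 \<or> w \<noteq> 0")
      case False
      then have "h = 0" using P P' by (simp add: isotropic_iff)
      then show ?thesis using False P P' zero_notin_isotropic by auto
    qed (use P4[of a u h v w] P P' in simp)
  qed
qed

section \<open>The Eisenstein series as a sum over isotropic vectors\<close>

definition Fpl :: "vec5 \<Rightarrow> complex \<Rightarrow> complex \<Rightarrow> complex \<Rightarrow> complex" where
  "Fpl = (\<lambda>(a, u, h, v, w) x y z. of_int a * (x * z - y\<^sup>2) + of_int u * x + 2 * of_int h * y + of_int v * z + of_int w)"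

lemma Fpl_eq: "Fpl (a, u, h, v, w) x y z =
    of_int a * (x * z - y\<^sup>2) + of_int u * x + 2 * of_int h * y + of_int v * z + of_int w"
  by (simp add: Fpl_def)

lemma Fpl_smult5: "Fpl (smult5 c P) x y z = of_int c * Fpl P x y z"
  by (cases P) (simp add: Fpl_eq smult5_def algebra_simps)

lemma sym2_nth [simp]:
  "sym2 a b c $ 1 $ 1 = a" "sym2 a b c $ 1 $ 2 = b" "sym2 a b c $ 2 $ 1 = b" "sym2 a b c $ 2 $ 2 = c"
  by (simp_all add: sym2_def)

text \<open>Expanding the determinant, y has the coefficient [c2, d2] - [c1, d1]. Orthogonality of
  the lower rows makes the two minors opposite, whence 2 h y.\<close>

lemma autj_eq_Fpl:
  assumes "g \<in> Gamma2"
  shows "autj g (sym2 x y z) = Fpl (plucker g) x y z"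
proof -
  have "of_int (sform (g $ Inr 1) (g $ Inr 2)) = (0 :: complex)"
    by (simp add: Gamma2_rows[OF assms])
  then show ?thesis
    by (simp add: autj_def det_2 matrix_matrix_mult_def sum_2 plucker_def wedge_def Fpl_eq
        blockC_def blockD_def sform_def) algebra
qed

definition numer :: "imat4 \<Rightarrow> complex^2^2 \<Rightarrow> complex^2^2" where
  "numer g Z = cmat (blockA g) ** Z + cmat (blockB g)"

definition denom :: "imat4 \<Rightarrow> complex^2^2 \<Rightarrow> complex^2^2" where
  "denom g Z = cmat (blockC g) ** Z + cmat (blockD g)"

text \<open>Two points are used so that one identity serves twice: Z' = Z gives the symmetry of the
  image point, and Z' = conj Z gives its imaginary part.\<close>

lemma numer_denom:
  assumes "g \<in> Gamma2" "transpose Z = Z"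
  shows "transpose (numer g Z) ** denom g Z' - transpose (denom g Z) ** numer g Z' = Z - Z'"
proof -
  have c: "complex_of_int (sform (column i g) (column j g)) = of_int (sympJ $ i $ j)" for i j
    using assms Gamma2_cols by metis
  have Z: "Z $ i $ j = Z $ j $ i" for i j 
    using arg_cong[OF assms(2), of "\<lambda>A. A $ j $ i"] by (simp add: transpose_def)
  have "(transpose (numer g Z) ** denom g Z' - transpose (denom g Z) ** numer g Z') $ i $ j
     = (\<Sum>l\<in>UNIV. \<Sum>m\<in>UNIV. Z $ l $ i * Z' $ m $ j * of_int (sform (column (Inl l) g) (column (Inl m) g)))
     + (\<Sum>l\<in>UNIV. Z $ l $ i * of_int (sform (column (Inl l) g) (column (Inr j) g)))
     + (\<Sum>m\<in>UNIV. Z' $ m $ j * of_int (sform (column (Inr i) g) (column (Inl m) g)))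
     + of_int (sform (column (Inr i) g) (column (Inr j) g))" for i j
    by (simp add: numer_def denom_def transpose_def matrix_matrix_mult_def sum_2 sform_def column_def
        blockA_def blockB_def blockC_def blockD_def algebra_simps)
  then have "(transpose (numer g Z) ** denom g Z' - transpose (denom g Z) ** numer g Z') $ i $ j
      = Z $ j $ i - Z' $ i $ j" for i j
    unfolding c by (simp add: sum_2) (use exhaust_2[of i] exhaust_2[of j] in auto)
  then show ?thesis using Z by (simp add: vec_eq_iff)
qed

lemma matrix_diff_right: "A ** (B - C) = A ** B - A ** C"
  for A :: "'a::ring_1^'n^'m" and B C :: "'a^'k^'n"
  by (simp add: vec_eq_iff matrix_matrix_mult_def sum_subtractf algebra_simps)

lemma matrix_diff_left: "(A - B) ** C = A ** C - B ** C"
  for A B :: "'a::ring_1^'n^'m" and C :: "'a^'k^'n"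
  by (simp add: vec_eq_iff matrix_matrix_mult_def sum_subtractf algebra_simps)

text \<open>For the denominator M and the image point W, \<open>numer_denom\<close> yields M^t (W -
  conj W) conj M = Z - conj Z. Taking determinants gives the formula, with the factor -4 = (2 i)^2
  on both sides.\<close>

lemma delta_symp_act:
  assumes "g \<in> Gamma2" "transpose Z = Z" "autj g Z \<noteq> 0"
  shows "delta (symp_act g Z) = delta Z / (norm (autj g Z))\<^sup>2"
proof -
  let ?cj = "map_matrix cnj"
  define M N W where "M = denom g Z" and "N = numer g Z" and "W = symp_act g Z"
  have dM: "det M \<noteq> 0" and j: "autj g Z = det M" using assms(3) by (simp_all add: M_def denom_def autj_def)
  have inv: "M ** matrix_inv M = mat 1" "matrix_inv M ** M = mat 1"
    using dM matrix_inv_def someI_ex[of "\<lambda>A'. M ** A' = mat 1 \<and> A' ** M = mat 1"] by (simp_all add: invertible_det_nz[symmetric] invertible_def matrix_inv_def)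
  have W: "W = N ** matrix_inv M" by (simp add: W_def N_def M_def symp_act_def numer_def denom_def)
  have WM: "W ** M = N" by (simp add: W matrix_mul_assoc[symmetric] inv)
  have cj_mult: "?cj (A ** B) = ?cj A ** ?cj B" for A B :: "complex^2^2"
    by (simp add: vec_eq_iff matrix_matrix_mult_def)
  have cjM: "?cj M = denom g (?cj Z)" "?cj N = numer g (?cj Z)"
    by (simp_all add: M_def N_def denom_def numer_def vec_eq_iff matrix_matrix_mult_def)
  have "transpose N ** M = transpose M ** N"
    using numer_denom[OF assms(1,2), of Z] by (simp add: M_def N_def)
  then have "transpose N ** M ** matrix_inv M = transpose M ** W ** M ** matrix_inv M"
    by (simp add: WM[symmetric] matrix_mul_assoc)
  then have Nt: "transpose N = transpose M ** W"
    by (simp add: matrix_mul_assoc[symmetric] inv)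
  have cjN: "?cj N = ?cj W ** ?cj M" unfolding WM[symmetric] cj_mult ..
  have "transpose M ** (W - ?cj W) ** ?cj M = transpose N ** ?cj M - transpose M ** ?cj N"
    unfolding cjN Nt by (simp add: matrix_mul_assoc matrix_diff_right matrix_diff_left)
  also have "\<dots> = Z - ?cj Z"
    using numer_denom[OF assms(1,2), of "?cj Z"] by (simp add: cjM) (simp add: M_def N_def)
  finally have "det M * det (W - ?cj W) * det (?cj M) = det (Z - ?cj Z)"
    by (metis det_mul det_transpose)
  moreover have "det (X - ?cj X) = - 4 * complex_of_real (delta X)" for X :: "complex^2^2"
    by (simp add: det_2 delta_def complex_diff_cnj algebra_simps)
  moreover have "det (?cj M) = cnj (det M)" by (simp add: det_2)
  ultimately have "(det M * cnj (det M)) * delta W = delta Z" 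
    by (simp add: algebra_simps)
  then have "complex_of_real ((norm (det M))\<^sup>2 * delta W) = complex_of_real (delta Z)"
    by (simp only: complex_norm_square of_real_mult)
  then have "(norm (det M))\<^sup>2 * delta W = delta Z" using of_real_eq_iff by blast
  then show ?thesis using dM by (simp add: j W_def field_simps)
qed

text \<open>With x = j(g, Z) and d = delta(Z) this is the summand of the Eisenstein series. It sees
  a vector only through the value x, so rescaling vectors becomes rescaling x.\<close>

definition eterm :: "int \<Rightarrow> complex \<Rightarrow> real \<Rightarrow> complex \<Rightarrow> complex" where
  "eterm k s d x = x powi (- k) * complex_of_real (d / (norm x)\<^sup>2) powr s"

lemma eterm_minus: "even k \<Longrightarrow> eterm k s d (- x) = eterm k s d x"
  by (simp add: eterm_def)

definition EisP :: "int \<Rightarrow> complex \<Rightarrow> complex \<Rightarrow> complex \<Rightarrow> complex \<Rightarrow> complex" where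
  "EisP k s x y z = (\<Sum>\<^sub>\<infinity>P\<in>isotropic 1. eterm k s (Im x * Im z - (Im y)\<^sup>2) (Fpl P x y z))"

lemma coset_rep:
  assumes "c \<in> Gamma20_cosets"
  shows "(SOME g. g \<in> c) \<in> Gamma2" "c = (\<lambda>u. u ** (SOME g. g \<in> c)) ` Gamma20"
proof -
  obtain g where g: "g \<in> Gamma2" "c = (\<lambda>u. u ** g) ` Gamma20"
    using assms by (auto simp: Gamma20_cosets_def)
  have "mat 1 ** g \<in> c" using g Gamma20_one by blast
  then have "(SOME g. g \<in> c) \<in> c" by (metis someI)
  then obtain u where u: "u \<in> Gamma20" "(SOME g. g \<in> c) = u ** g" using g by auto
  then show "(SOME g. g \<in> c) \<in> Gamma2" using g Gamma2_mult by (auto simp: Gamma20_def)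
  show "c = (\<lambda>u. u ** (SOME g. g \<in> c)) ` Gamma20"
    unfolding u(2) Gamma20_coset_eq[OF u(1)] by (fact g(2))
qed

lemma smult5_1 [simp]: "smult5 1 P = P"
  by (cases P) (simp add: smult5_def)

lemma smult5_smult5: "smult5 c (smult5 d P) = smult5 (c * d) P"
  by (cases P) (simp add: smult5_def)

text \<open>The minors of a representative are determined by its coset only up to sign. Recording
  the sign e gives an honest bijection, which is two-valued because P and -P differ for a primitive
  P.\<close>

lemma bij_betw_cosets:
  "bij_betw (\<lambda>(c, e). smult5 e (plucker (SOME g. g \<in> c))) (Gamma20_cosets \<times> {1, -1}) (isotropic 1)"
  unfolding bij_betw_def
proof
  let ?r = "\<lambda>c::imat4 set. SOME g. g \<in> c"
  have neq: "smult5 (-1) P \<noteq> P" if "P \<in> isotropic 1" for P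
  proof
    assume "smult5 (-1) P = P"
    then have "P = (0, 0, 0, 0, 0)" by (cases P) (auto simp: smult5_def)
    then show False using that zero_notin_isotropic by auto
  qed
  show "inj_on (\<lambda>(c, e). smult5 e (plucker (?r c))) (Gamma20_cosets \<times> {1, -1})"
  proof (rule inj_onI, clarify)
    fix c d :: "imat4 set" and e f :: int
    assume A: "c \<in> Gamma20_cosets" "d \<in> Gamma20_cosets" "e \<in> {1, - 1}" "f \<in> {1, - 1}"
      and eq: "smult5 e (plucker (?r c)) = smult5 f (plucker (?r d))"
    have "plucker (?r c) = smult5 e (smult5 e (plucker (?r c)))"
      using A by (auto simp: smult5_smult5)
    also have "\<dots> = smult5 (e * f) (plucker (?r d))" by (simp add: eq smult5_smult5)
    finally have p: "plucker (?r c) = smult5 (e * f) (plucker (?r d))" .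
    then obtain u where u: "u \<in> Gamma20" "?r c = u ** ?r d"
      using plucker_eq_imp_coset[of "?r c" "?r d" "e * f"] coset_rep(1)[OF A(1)] coset_rep(1)[OF A(2)] A(3,4)
      by fastforce
    have "c = d"
      by (subst coset_rep(2)[OF A(1)], subst coset_rep(2)[OF A(2)])
         (simp only: u(2) Gamma20_coset_eq[OF u(1)])
    moreover have "e = f"
      using p \<open>c = d\<close> neq[of "plucker (?r d)"] plucker_isotropic[OF coset_rep(1)[OF A(2)]] A by auto
    ultimately show "c = d \<and> e = f" by simp
  qed
  show "(\<lambda>(c, e). smult5 e (plucker (?r c))) ` (Gamma20_cosets \<times> {1, -1}) = isotropic 1"
  proof (intro equalityI subsetI)
    fix P assume "P \<in> (\<lambda>(c, e). smult5 e (plucker (?r c))) ` (Gamma20_cosets \<times> {1, -1})"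
    then obtain c e where "c \<in> Gamma20_cosets" "e \<in> {1, -1}" "P = smult5 e (plucker (?r c))" by auto
    then have "plucker (?r c) \<in> lagr" "P = plucker (?r c) \<or> P = smult5 (-1) (plucker (?r c))"
      using coset_rep(1) by (auto simp: lagr_def)
    then show "P \<in> isotropic 1"
      unfolding isotropic_eq_lagr
      by (cases "plucker (?r c)") (auto simp: smult5_def dest: lagr_closed(6))
  next
    fix P :: vec5 assume "P \<in> isotropic 1"
    then obtain g where g: "g \<in> Gamma2" "P = plucker g"
      by (auto simp: isotropic_eq_lagr lagr_def)
    define c where "c = (\<lambda>u. u ** g) ` Gamma20"
    have c: "c \<in> Gamma20_cosets" using g by (auto simp: c_def Gamma20_cosets_def)
    have "mat 1 ** g \<in> c" unfolding c_def using Gamma20_one by blast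
    then have "(SOME g. g \<in> c) \<in> c" by (metis someI)
    then obtain u where u: "u \<in> Gamma20" "?r c = u ** g" by (auto simp: c_def)
    obtain e where e1: "e \<in> {1, -1}" "\<And>g. plucker (u ** g) = smult5 e (plucker g)"
      using plucker_Gamma20_mult[OF u(1)] by blast
    have e: "e \<in> {1, -1}" "plucker (?r c) = smult5 e P"
      using e1 by (simp_all add: u(2) g(2))
    have "smult5 e (plucker (?r c)) = P" using e by (auto simp: smult5_smult5)
    then show "P \<in> (\<lambda>(c, e). smult5 e (plucker (?r c))) ` (Gamma20_cosets \<times> {1, -1})"
      using c e(1) by force
  qed
qed

text \<open>A coset accounts for both P and -P, and for even k these have equal terms; hence the
  factor 2.\<close>

lemma Eis2_eq_EisP:
  assumes "even k"
    and nz: "\<And>P. P \<in> isotropic 1 \<Longrightarrow> Fpl P x y z \<noteq> 0"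
    and sm: "(\<lambda>P. eterm k s (Im x * Im z - (Im y)\<^sup>2) (Fpl P x y z)) summable_on isotropic 1"
  shows "2 * Eis2 k s (sym2 x y z) = EisP k s x y z"
proof -
  let ?r = "\<lambda>c::imat4 set. SOME g. g \<in> c"
  let ?d = "Im x * Im z - (Im y)\<^sup>2"
  let ?f = "\<lambda>P. eterm k s ?d (Fpl P x y z)"
  let ?g = "\<lambda>c. ?f (plucker (?r c))"
  have fneg: "?f (smult5 e P) = ?f P" if "e \<in> {1, -1}" for e P
    using that assms(1) by (auto simp: Fpl_smult5 eterm_minus)
  have trm: "autj g (sym2 x y z) powi (- k) * complex_of_real (delta (symp_act g (sym2 x y z))) powr s
      = ?f (plucker g)" if "g \<in> Gamma2" for g
  proof -
    have "delta (sym2 x y z) = ?d" by (simp add: delta_def det_2 power2_eq_square)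
    moreover have "transpose (sym2 x y z) = sym2 x y z"
      by (simp add: transpose_def vec_eq_iff forall_2)
    ultimately show ?thesis
      using delta_symp_act[OF that, of "sym2 x y z"] nz plucker_isotropic[OF that]
      by (simp add: autj_eq_Fpl[OF that] eterm_def)
  qed
  have E: "Eis2 k s (sym2 x y z) = infsum ?g Gamma20_cosets"
    unfolding Eis2_def Let_def by (intro infsum_cong trm coset_rep(1))
  have sm2: "(\<lambda>(c, e). ?f (smult5 e (plucker (?r c)))) summable_on Gamma20_cosets \<times> {1, -1}"
    using summable_on_reindex_bij_betw[OF bij_betw_cosets, of ?f] sm
    by (simp add: case_prod_unfold)
  have "EisP k s x y z = infsum (\<lambda>(c, e). ?f (smult5 e (plucker (?r c)))) (Gamma20_cosets \<times> {1, -1})"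
    unfolding EisP_def using infsum_reindex_bij_betw[OF bij_betw_cosets, of ?f]
    by (simp add: case_prod_unfold)
  also have "\<dots> = infsum (\<lambda>c. infsum (\<lambda>e. ?f (smult5 e (plucker (?r c)))) {1, -1}) Gamma20_cosets"
    using infsum_Sigma'_banach[of _ Gamma20_cosets "\<lambda>_. {1, -1}"] sm2 by fastforce
  also have "\<dots> = infsum (\<lambda>c. 2 * ?g c) Gamma20_cosets"
    by (intro infsum_cong) (simp add: fneg)
  also have "\<dots> = 2 * Eis2 k s (sym2 x y z)" by (simp add: E infsum_cmult_right')
  finally show ?thesis by simp
qed

section \<open>Absolute convergence\<close>

definition ndiv :: "nat \<Rightarrow> nat" where "ndiv n = card {d. d dvd n}"

lemma ndiv_mult_le: 
  assumes "a > 0" "b > 0"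
  shows "ndiv (a * b) \<le> ndiv a * ndiv b"
proof -
  have "{d. d dvd a * b} \<subseteq> (\<lambda>(x, y). x * y) ` ({d. d dvd a} \<times> {d. d dvd b})"
    using division_decomp[of _ a b] by force
  then have "card {d. d dvd a * b} \<le> card ({d. d dvd a} \<times> {d. d dvd b})"
    using assms by (intro surj_card_le) auto
  then show ?thesis by (simp add: ndiv_def card_cartesian_product)
qed

lemma ndiv_prime_power:
  assumes "prime p"
  shows "ndiv (p ^ e) \<le> e + 1"
proof -
  have "{d. d dvd p ^ e} \<subseteq> (\<lambda>i. p ^ i) ` {..e}"
    using assms divides_primepow_nat by auto
  then have "card {d. d dvd p ^ e} \<le> card {..e}" by (intro surj_card_le) auto
  then show ?thesis by (simp add: ndiv_def)
qed

text \<open>A prime power p^e contributes at most e + 1, which is at most p^(e \<epsilon>) once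
  p^\<epsilon> \<ge> 2. Only the smaller primes, fewer than B in number, cost a factor K.\<close>

lemma ndiv_bound:
  fixes \<epsilon> :: real
  assumes "\<epsilon> > 0"
  shows "\<exists>C>0. \<forall>n>0. real (ndiv n) \<le> C * real n powr \<epsilon>"
proof -
  \<comment> \<open>For this K, the product K (1 + e \<epsilon> ln 2) is e + 1 plus non-negative
    terms, and 1 + e \<epsilon> ln 2 is at most 2^(e \<epsilon>), hence at most p^(e \<epsilon>). B
    is chosen so that p \<ge> B implies p^\<epsilon> \<ge> 2.\<close>
  define K where "K = 1 + 1 / (\<epsilon> * ln 2)"
  define B where "B = nat \<lceil>2 powr (1 / \<epsilon>)\<rceil>"
  define c where "c n = card {q. prime q \<and> q < B \<and> q dvd n}" for n
  have K1: "K \<ge> 1" using assms by (simp add: K_def)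
  have small: "real (e + 1) \<le> K * real (p ^ e) powr \<epsilon>" if "prime p" for p e
  proof -
    have "real (e + 1) \<le> K * (1 + real e * \<epsilon> * ln 2)"
    proof -
      have "0 \<le> real e * \<epsilon> * ln 2" using assms by simp
      moreover have "K * (1 + real e * \<epsilon> * ln 2) = 1 + real e * \<epsilon> * ln 2 + 1 / (\<epsilon> * ln 2) + real e"
        using assms by (simp add: K_def field_simps)
      moreover have "0 \<le> 1 / (\<epsilon> * ln 2)" using assms by simp
      ultimately show ?thesis by linarith
    qed
    also have "1 + real e * \<epsilon> * ln 2 \<le> exp (real e * \<epsilon> * ln 2)" by (rule exp_ge_add_one_self)
    also have "\<dots> = (2 ^ e) powr \<epsilon>" by (simp add: powr_def ln_realpow mult_ac)
    also have "\<dots> \<le> real (p ^ e) powr \<epsilon>"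
      using assms prime_ge_2_nat[OF that] by (intro powr_mono2) (auto intro: power_mono)
    finally show ?thesis using K1 by simp
  qed
  have large: "real (e + 1) \<le> real (p ^ e) powr \<epsilon>" if "prime p" "\<not> p < B" for p e
  proof -
    have "2 powr (1 / \<epsilon>) \<le> real B" unfolding B_def by linarith
    also have "\<dots> \<le> real p" using that by simp
    finally have "(2 powr (1 / \<epsilon>)) powr \<epsilon> \<le> real p powr \<epsilon>"
      using assms by (intro powr_mono2) auto
    then have p2: "2 \<le> real p powr \<epsilon>" using assms by (simp add: powr_powr)
    have "e + 1 \<le> 2 ^ e" by (induction e) auto
    then have "real (e + 1) \<le> 2 ^ e" by (metis of_nat_le_iff of_nat_numeral of_nat_power)
    also have "\<dots> \<le> (real p powr \<epsilon>) ^ e" using p2 by (intro power_mono) auto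
    also have "\<dots> = real (p ^ e) powr \<epsilon>"
      using prime_gt_0_nat[OF that(1)] by (simp add: powr_power powr_realpow[symmetric] powr_powr mult.commute)
    finally show ?thesis .
  qed
  have main: "real (ndiv n) \<le> K ^ c n * real n powr \<epsilon>" if "n > 0" for n
    using that
  proof (induction n rule: less_induct)
    case (less n)
    show ?case
    proof (cases "n = 1")
      case True
      then show ?thesis using K1 by (simp add: ndiv_def)
    next
      case False
      then obtain p where p: "prime p" "p dvd n" using prime_factor_nat by blast
      obtain e m where em: "n = p ^ e * m" "\<not> p dvd m"
        using multiplicity_decompose'[of n p] p less by (metis neq0_conv not_prime_unit)
      have m0: "m > 0" using em less by (cases m) auto
      have e0: "e > 0" using em p by (cases e) auto
      have "1 < p ^ e" by (rule one_less_power[OF prime_gt_1_nat[OF p(1)] e0])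
      then have mn: "m < n" using em m0 by simp
      have fin: "finite {q. prime q \<and> q < B \<and> q dvd k}" for k by simp
      have dvd_pow: "x = p" if "prime x" "x dvd p ^ e" for x
        using that p(1) prime_dvd_power primes_dvd_imp_eq by blast
      have eq: "{q. prime q \<and> q < B \<and> q dvd n} 
          = {q. prime q \<and> q < B \<and> q dvd m} \<union> (if p < B then {p} else {})"
        using p unfolding em(1) by (auto simp: prime_dvd_mult_iff dest: dvd_pow)
      have cn: "c n = c m + (if p < B then 1 else 0)"
        unfolding c_def eq using em(2) by (simp add: card_insert_if)
      have "real (ndiv n) \<le> real (e + 1) * real (ndiv m)"
        using ndiv_mult_le[of "p ^ e" m] ndiv_prime_power[OF p(1), of e] m0 em
        by (metis \<open>1 < p ^ e\<close> gr0I le_trans mult_le_mono1 not_one_less_zero of_nat_le_iff of_nat_mult)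
      also have "\<dots> \<le> ((if p < B then K else 1) * real (p ^ e) powr \<epsilon>) * (K ^ c m * real m powr \<epsilon>)"
        using small[OF p(1)] large[OF p(1)] less(1)[OF mn m0] K1 by (intro mult_mono) auto
      also have "\<dots> = K ^ c n * real n powr \<epsilon>"
      proof -
        have 1: "K ^ c n = (if p < B then K else 1) * K ^ c m" by (simp add: cn)
        have 2: "real n powr \<epsilon> = real (p ^ e) powr \<epsilon> * real m powr \<epsilon>"
          unfolding em(1) of_nat_mult by (simp add: powr_mult)
        show ?thesis unfolding 1 2 by (simp only: mult_ac)
      qed
      finally show ?thesis .
    qed
  qed
  have cB: "c n \<le> B" for n
  proof -
    have "c n \<le> card {..<B}" unfolding c_def by (rule card_mono) auto
    then show ?thesis by simp
  qed
  have "real (ndiv n) \<le> K ^ B * real n powr \<epsilon>" if "n > 0" for n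
  proof -
    have "K ^ c n \<le> K ^ B" using K1 cB by (intro power_increasing) auto
    then have "K ^ c n * real n powr \<epsilon> \<le> K ^ B * real n powr \<epsilon>" by (intro mult_right_mono) auto
    then show ?thesis using main[OF that] by linarith
  qed
  then show ?thesis using K1 by (intro exI[of _ "K ^ B"]) auto
qed

section \<open>Weighted sums over fibres\<close>

lemma summable_on_times:
  fixes f :: "'a \<Rightarrow> real" and g :: "'b \<Rightarrow> real"
  assumes "f summable_on A" "g summable_on B" "\<And>x. f x \<ge> 0" "\<And>y. g y \<ge> 0"
  shows "(\<lambda>(x, y). f x * g y) summable_on A \<times> B"
proof (rule summable_on_SigmaI)
  show "((\<lambda>y. case (x, y) of (x, y) \<Rightarrow> f x * g y) has_sum f x * infsum g B) B" for x
    using has_sum_cmult_right[OF has_sum_infsum[OF assms(2)]] by simp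
  show "(\<lambda>x. f x * infsum g B) summable_on A" using assms(1) by (rule summable_on_cmult_left)
qed (use assms in auto)

text \<open>This replaces counting of solutions: if the weights on the fibres have uniformly bounded
  sums, passing from the base to the total space costs only the factor C.\<close>

lemma summable_on_fibres:
  fixes G :: "'a \<Rightarrow> real" and W :: "'b \<Rightarrow> real"
  assumes G: "G summable_on A" and nonneg: "\<And>x. G x \<ge> 0" "\<And>y. W y \<ge> 0"
    and W: "\<And>x. x \<in> A \<Longrightarrow> W summable_on B x" "\<And>x. x \<in> A \<Longrightarrow> infsum W (B x) \<le> C"
  shows "(\<lambda>(x, y). G x * W y) summable_on Sigma A B"
proof (rule summable_on_SigmaI)
  show "((\<lambda>y. case (x, y) of (x, y) \<Rightarrow> G x * W y) has_sum G x * infsum W (B x)) (B x)" if "x \<in> A" for x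
    using has_sum_cmult_right[OF has_sum_infsum[OF W(1)[OF that]]] by simp
  show "(\<lambda>x. G x * infsum W (B x)) summable_on A"
  proof (rule summable_on_comparison_test[where f = "\<lambda>x. G x * C"])
    show "(\<lambda>x. G x * C) summable_on A" using G by (rule summable_on_cmult_left)
  qed (use nonneg W in \<open>auto intro: mult_left_mono mult_nonneg_nonneg infsum_nonneg\<close>)
qed (use nonneg in auto)

definition iw :: "real \<Rightarrow> int \<Rightarrow> real" where
  "iw \<theta> x = (1 + \<bar>of_int x\<bar>) powr (- \<theta>)"

lemma iw_nonneg [simp]: "iw \<theta> x \<ge> 0" by (simp add: iw_def)

lemma iw_summable:
  assumes "\<theta> > 1"
  shows "iw \<theta> summable_on UNIV"
proof -
  have "summable (\<lambda>n. real (Suc n) powr (- \<theta>))"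
    using assms by (subst summable_Suc_iff) (simp add: summable_real_powr_iff)
  then have nat: "(\<lambda>n. real (Suc n) powr (- \<theta>)) summable_on UNIV"
    by (subst summable_on_UNIV_nonneg_real_iff) auto
  have 1: "iw \<theta> summable_on range int"
    using nat by (subst summable_on_reindex) (auto simp: iw_def comp_def add.commute)
  have 2: "iw \<theta> summable_on range (\<lambda>n. - int n)"
    using nat by (subst summable_on_reindex) (auto simp: iw_def comp_def add.commute inj_on_def)
  have "(UNIV :: int set) = range int \<union> range (\<lambda>n. - int n)"
    by (auto simp: image_iff) (metis int_cases2)
  then show ?thesis using summable_on_union[OF 1 2] by simp
qed

text \<open>The weight is chosen so that its sum over each hyperbola \<open>x y = m\<close>, including the degenerate
  one, is bounded independently of \<open>m\<close>; by the divisor bound it decays slowly where \<open>x y \<noteq> 0\<close>.\<close>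

definition pw :: "real \<Rightarrow> int \<times> int \<Rightarrow> real" where
  "pw \<theta> = (\<lambda>(x, y). if x * y = 0 then iw \<theta> x * iw \<theta> y else 1 / ndiv (nat \<bar>x * y\<bar>))"

lemma pw_nonneg [simp]: "pw \<theta> q \<ge> 0" by (simp add: pw_def split: prod.splits)

lemma ndiv_pos: "n > 0 \<Longrightarrow> ndiv n > 0"
  unfolding ndiv_def by (subst card_gt_0_iff) auto

text \<open>For m \<noteq> 0 there are at most 2 \<open>ndiv\<close> |m| solutions (a divisor and a
  sign), each of weight 1 / \<open>ndiv\<close> |m|, so the sum is at most 2. For m = 0 the weight
  is part of a product of two convergent series.\<close>

lemma pw_fibre:
  assumes "\<theta> > 1"
  shows "\<exists>C. \<forall>m. pw \<theta> summable_on {(x, y). x * y = m} \<and> infsum (pw \<theta>) {(x, y). x * y = m} \<le> C"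
proof -
  have sum0: "pw \<theta> summable_on {(x, y). x * y = 0}"
  proof -
    have "(\<lambda>(x, y). iw \<theta> x * iw \<theta> y) summable_on UNIV \<times> UNIV"
      using iw_summable[OF assms] by (intro summable_on_times) auto
    then have "(\<lambda>(x, y). iw \<theta> x * iw \<theta> y) summable_on {(x, y). x * y = 0}"
      by (rule summable_on_subset_banach) auto
    moreover have "(\<lambda>(x, y). iw \<theta> x * iw \<theta> y) summable_on {(x, y). x * y = 0}
        \<longleftrightarrow> pw \<theta> summable_on {(x, y). x * y = 0}"
      by (rule summable_on_cong) (auto simp: pw_def)
    ultimately show ?thesis by simp
  qed
  define C where "C = max 2 (infsum (pw \<theta>) {(x, y). x * y = 0})"
  have "pw \<theta> summable_on {(x, y). x * y = m} \<and> infsum (pw \<theta>) {(x, y). x * y = m} \<le> C" for m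
  proof (cases "m = 0")
    case True
    then show ?thesis using sum0 by (simp add: C_def)
  next
    case False
    let ?S = "{(x, y). x * y = m}"
    let ?D = "{d. d dvd nat \<bar>m\<bar>}"
    have finD: "finite ?D" by (rule finite_divisors_nat) (use False in simp)
    have sub: "?S \<subseteq> (\<lambda>(e, d). (e * int d, m div (e * int d))) ` ({1, -1} \<times> ?D)"
    proof
      fix q assume "q \<in> ?S"
      then obtain x y where q: "q = (x, y)" "x * y = m" by auto
      then have x0: "x \<noteq> 0" using False by auto
      have "nat \<bar>x\<bar> dvd nat \<bar>m\<bar>" using q(2) by (auto simp: nat_abs_mult_distrib)
      moreover have "q = (\<lambda>(e, d). (e * int d, m div (e * int d))) (sgn x, nat \<bar>x\<bar>)"
        using x0 q by (auto simp: sgn_mult_abs)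
      moreover have "sgn x \<in> {1, -1}" using x0 by (auto simp: sgn_if)
      ultimately show "q \<in> (\<lambda>(e, d). (e * int d, m div (e * int d))) ` ({1, -1} \<times> ?D)" by blast
    qed
    have fin: "finite ?S" by (rule finite_subset[OF sub]) (use finD in auto)
    have "card ?S \<le> card ({1, -1::int} \<times> ?D)"
      by (rule surj_card_le[OF _ sub]) (use finD in auto)
    then have card: "card ?S \<le> 2 * ndiv (nat \<bar>m\<bar>)"
      by (simp add: card_cartesian_product ndiv_def)
    have "infsum (pw \<theta>) ?S = sum (pw \<theta>) ?S" using fin by (rule infsum_finite)
    also have "\<dots> = (\<Sum>q\<in>?S. 1 / real (ndiv (nat \<bar>m\<bar>)))"
      by (rule sum.cong) (use False in \<open>auto simp: pw_def\<close>)
    also have "\<dots> \<le> 2"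
      using card ndiv_pos[of "nat \<bar>m\<bar>"] False by (simp add: field_simps)
    finally show ?thesis using fin by (simp add: C_def)
  qed
  then show ?thesis by blast
qed

section \<open>Summability over the quadric\<close>

definition height :: "vec5 \<Rightarrow> real" where
  "height = (\<lambda>(a, u, h, v, w). of_int (Max {\<bar>a\<bar>, \<bar>u\<bar>, \<bar>h\<bar>, \<bar>v\<bar>, \<bar>w\<bar>}))"

lemma height_bounds:
  "\<bar>of_int a\<bar> \<le> height (a, u, h, v, w)" "\<bar>of_int u\<bar> \<le> height (a, u, h, v, w)"
  "\<bar>of_int h\<bar> \<le> height (a, u, h, v, w)" "\<bar>of_int v\<bar> \<le> height (a, u, h, v, w)"
  "\<bar>of_int w\<bar> \<le> height (a, u, h, v, w)"
proof -
  have "\<bar>x\<bar> \<le> Max {\<bar>a\<bar>, \<bar>u\<bar>, \<bar>h\<bar>, \<bar>v\<bar>, \<bar>w\<bar>}" if "x \<in> {a, u, h, v, w}" for x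
    using that by (intro Max_ge) auto
  then have "\<bar>of_int x\<bar> \<le> height (a, u, h, v, w)" if "x \<in> {a, u, h, v, w}" for x
    using that unfolding height_def by (simp only: prod.case of_int_abs[symmetric] of_int_le_iff)
  then show "\<bar>of_int a\<bar> \<le> height (a, u, h, v, w)" "\<bar>of_int u\<bar> \<le> height (a, u, h, v, w)"
    "\<bar>of_int h\<bar> \<le> height (a, u, h, v, w)" "\<bar>of_int v\<bar> \<le> height (a, u, h, v, w)"
    "\<bar>of_int w\<bar> \<le> height (a, u, h, v, w)" by simp_all
qed

lemma height_le:
  assumes "\<bar>of_int a\<bar> \<le> B" "\<bar>of_int u\<bar> \<le> B" "\<bar>of_int h\<bar> \<le> B" "\<bar>of_int v\<bar> \<le> B" "\<bar>of_int w\<bar> \<le> B"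
  shows "height (a, u, h, v, w) \<le> B"
proof -
  define M where "M = Max {\<bar>a\<bar>, \<bar>u\<bar>, \<bar>h\<bar>, \<bar>v\<bar>, \<bar>w\<bar>}"
  have "M \<in> {\<bar>a\<bar>, \<bar>u\<bar>, \<bar>h\<bar>, \<bar>v\<bar>, \<bar>w\<bar>}"
    unfolding M_def by (rule Max_in) simp_all
  then show ?thesis using assms unfolding height_def prod.case M_def[symmetric] by auto
qed

lemma height_ge_1:
  assumes "P \<in> isotropic t"
  shows "height P \<ge> 1"
proof -
  obtain a u h v w where P: "P = (a, u, h, v, w)" by (cases P)
  have "a \<noteq> 0 \<or> u \<noteq> 0 \<or> h \<noteq> 0 \<or> v \<noteq> 0 \<or> w \<noteq> 0"
    using assms zero_notin_isotropic unfolding P by auto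
  moreover have "1 \<le> \<bar>real_of_int x\<bar>" if "x \<noteq> 0" for x using that by simp
  ultimately show ?thesis using height_bounds[where a=a and u=u and h=h and v=v and w=w] 
    unfolding P by (meson order_trans)
qed

text \<open>The vectors are fibred by (h, u, v), the fibre being a w = u v - h^2. \<open>G1\<close>
  weighs h, u, v separately, at the cost of 3 \<theta> in the exponent, and for a w \<noteq> 0 the
  pair (a, w) adds only 2 \<epsilon>. For a w = 0 it would add \<theta>, which is too much; but then
  u v = h^2, and \<open>G2\<close> weighs (u, v) as a point of a hyperbola, so that the total is
  again 3 \<theta>.\<close>

lemma height_summable:
  assumes "\<alpha> > 3"
  shows "(\<lambda>P. height P powr (- \<alpha>)) summable_on isotropic 1"
proof -
  \<comment> \<open>The total exponent 3 \<theta> + 2 \<epsilon> equals 3 + 6 t, so the first bound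
    on t keeps it below \<alpha>. The bound 1 / 2 gives 2 \<epsilon> \<le> \<theta>, by which
    \<open>pw_ge\<close> covers both cases.\<close>
  define t where "t = min ((\<alpha> - 3) / 6) (1 / 2)"
  define \<theta> where "\<theta> = 1 + t"
  define \<epsilon> where "\<epsilon> = 3 * t / 2"
  have t: "t > 0" "6 * t \<le> \<alpha> - 3" "t \<le> 1 / 2" using assms by (auto simp: t_def min_def)
  have th: "\<theta> > 1" "\<epsilon> > 0" "2 * \<epsilon> \<le> \<theta>" "3 * \<theta> + 2 * \<epsilon> \<le> \<alpha>" using t by (simp_all add: \<theta>_def \<epsilon>_def)
  obtain K where K: "K > 0" "\<And>n. n > 0 \<Longrightarrow> real (ndiv n) \<le> K * real n powr \<epsilon>"
    using ndiv_bound[OF th(2)] by blast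
  obtain C where C: "\<And>m. pw \<theta> summable_on {(x, y). x * y = m}" "\<And>m. infsum (pw \<theta>) {(x, y). x * y = m} \<le> C"
    using pw_fibre[OF th(1)] by blast
  define G1 where "G1 = (\<lambda>(h, u, v). iw \<theta> h * (iw \<theta> u * iw \<theta> v))"
  define G2 where "G2 = (\<lambda>(h, u, v). if u * v = h\<^sup>2 then iw \<theta> h * pw \<theta> (u, v) else 0)"
  define G where "G q = G1 q + G2 q" for q
  have "(\<lambda>(u, v). iw \<theta> u * iw \<theta> v) summable_on UNIV \<times> UNIV"
    using iw_summable[OF th(1)] by (intro summable_on_times) auto
  then have "(\<lambda>(h, q). iw \<theta> h * (case q of (u, v) \<Rightarrow> iw \<theta> u * iw \<theta> v)) summable_on UNIV \<times> (UNIV \<times> UNIV)"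
    using iw_summable[OF th(1)] by (intro summable_on_times) auto
  then have s1: "G1 summable_on UNIV" by (simp add: G1_def case_prod_unfold)
  have "(\<lambda>(h, q). iw \<theta> h * pw \<theta> q) summable_on Sigma UNIV (\<lambda>h. {(x, y). x * y = h\<^sup>2})"
    using C iw_summable[OF th(1)] by (intro summable_on_fibres[where C = C]) auto
  also have "?this \<longleftrightarrow> G2 summable_on UNIV"
    by (rule summable_on_cong_neutral) (auto simp: G2_def split: if_splits)
  finally have s2: "G2 summable_on UNIV" .
  have Gn: "G q \<ge> 0" for q unfolding G_def G1_def G2_def by (auto split: prod.splits)
  have sG: "G summable_on UNIV" unfolding G_def using s1 s2 by (rule summable_on_add)
  have sT: "(\<lambda>(q, r). G q * pw \<theta> r) summable_on Sigma UNIV (\<lambda>(h, u, v). {(a, w). a * w = u * v - h\<^sup>2})"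
    using C sG Gn by (intro summable_on_fibres[where C = C]) (auto split: prod.splits)
  let ?\<phi> = "\<lambda>(a, u, h, v, w). ((h, u, v), (a, w)) :: (int \<times> int \<times> int) \<times> int \<times> int"
  have inj: "inj_on ?\<phi> (isotropic 1)" by (auto simp: inj_on_def)
  have "?\<phi> ` isotropic 1 \<subseteq> Sigma UNIV (\<lambda>(h, u, v). {(a, w). a * w = u * v - h\<^sup>2})"
    by (auto simp: isotropic_def)
  then have "(\<lambda>(q, r). G q * pw \<theta> r) summable_on ?\<phi> ` isotropic 1"
    using sT summable_on_subset_banach by blast
  then have sP: "(\<lambda>P. case ?\<phi> P of (q, r) \<Rightarrow> G q * pw \<theta> r) summable_on isotropic 1"
    using summable_on_reindex[OF inj, of "\<lambda>(q, r). G q * pw \<theta> r"] by (simp only: o_def)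
  \<comment> \<open>\<open>1 / K\<close> comes from the divisor bound and
    \<open>2 powr (- \<theta>)\<close> from 1 + |x| \<le> 2 N. Up to four weights are multiplied
    below, whence c^4.\<close>
  define c where "c = min (1 / K) (2 powr (- \<theta>))"
  have c0: "c > 0" using K by (simp add: c_def)
  have iw_ge: "iw \<theta> x \<ge> c * N powr (- \<theta>)" if "N \<ge> 1" "\<bar>of_int x\<bar> \<le> N" for x N
  proof -
    have "(2 * N) powr (- \<theta>) \<le> iw \<theta> x"
      unfolding iw_def using that th by (intro powr_mono2') auto
    moreover have "c * N powr (- \<theta>) \<le> 2 powr (- \<theta>) * N powr (- \<theta>)"
      unfolding c_def by (intro mult_right_mono) auto
    moreover have "(2 * N) powr (- \<theta>) = 2 powr (- \<theta>) * N powr (- \<theta>)"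
      using that by (simp add: powr_mult)
    ultimately show ?thesis by linarith
  qed
  have iw0: "iw \<theta> 0 = 1" by (simp add: iw_def)
  have pw_ge1: "pw \<theta> (x, y) \<ge> c * N powr (- (2 * \<epsilon>))"
    if "N \<ge> 1" "\<bar>of_int x\<bar> \<le> N" "\<bar>of_int y\<bar> \<le> N" "x * y \<noteq> 0" for x y N
  proof -
    let ?n = "nat \<bar>x * y\<bar>"
    have n0: "?n > 0" using that by simp
    have "real ?n = \<bar>of_int x\<bar> * \<bar>of_int y\<bar>" by (simp add: abs_mult)
    also have "\<dots> \<le> N * N" using that by (intro mult_mono) auto
    finally have "real ?n powr \<epsilon> \<le> (N * N) powr \<epsilon>" using th by (intro powr_mono2) auto
    also have "\<dots> = N powr (2 * \<epsilon>)" using that by (simp add: powr_mult powr_add[symmetric])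
    finally have "K * real ?n powr \<epsilon> \<le> K * N powr (2 * \<epsilon>)" using K by simp
    then have le: "real (ndiv ?n) \<le> K * N powr (2 * \<epsilon>)" using K(2)[OF n0] by linarith
    have "c * N powr (- (2 * \<epsilon>)) \<le> 1 / K * N powr (- (2 * \<epsilon>))"
      unfolding c_def by (intro mult_right_mono) auto
    also have "\<dots> = 1 / (K * N powr (2 * \<epsilon>))" by (simp add: powr_minus_divide)
    also have "\<dots> \<le> 1 / real (ndiv ?n)" using le ndiv_pos[OF n0] by (intro divide_left_mono) auto
    finally show ?thesis using that by (simp add: pw_def)
  qed
  have pw_ge: "pw \<theta> (x, y) \<ge> c * N powr (- \<theta>)"
    if N: "N \<ge> 1" "\<bar>of_int x\<bar> \<le> N" "\<bar>of_int y\<bar> \<le> N" for x y N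
  proof (cases "x * y = 0")
    case True
    then show ?thesis using iw_ge[OF N(1,2)] iw_ge[OF N(1,3)] by (auto simp: pw_def iw0)
  next
    case False
    have "N powr (- \<theta>) \<le> N powr (- (2 * \<epsilon>))" using N th by (intro powr_mono) auto
    then have "c * N powr (- \<theta>) \<le> c * N powr (- (2 * \<epsilon>))" using c0 by simp
    then show ?thesis using pw_ge1[OF N False] by linarith
  qed
  have bound: "norm (height P powr (- \<alpha>)) \<le> (1 / c ^ 4) * (case ?\<phi> P of (q, r) \<Rightarrow> G q * pw \<theta> r)"
    if P: "P \<in> isotropic 1" for P
  proof -
    obtain a u h v w where Pe: "P = (a, u, h, v, w)" by (cases P)
    define N where "N = height P"
    have N1: "N \<ge> 1" using height_ge_1[OF P] by (simp add: N_def)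
    have b: "\<bar>of_int a\<bar> \<le> N" "\<bar>of_int u\<bar> \<le> N" "\<bar>of_int h\<bar> \<le> N" "\<bar>of_int v\<bar> \<le> N" "\<bar>of_int w\<bar> \<le> N"
      unfolding N_def Pe by (rule height_bounds)+
    have eq: "h\<^sup>2 + a * w = u * v" using P by (simp add: Pe isotropic_iff)
    have c1: "c \<le> 1"
    proof -
      have "2 powr (- \<theta>) \<le> 2 powr 0" using th by (intro powr_mono) auto
      then show ?thesis by (simp add: c_def)
    qed
    have pos: "0 \<le> c * N powr r" for r using c0 by simp
    have "c ^ 4 * N powr (- \<alpha>) \<le> G (h, u, v) * pw \<theta> (a, w)"
    proof (cases "a * w = 0")
      case True
      have "c ^ 4 * N powr (- \<alpha>) \<le> c ^ 3 * N powr (- (3 * \<theta>))"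
        using c0 c1 N1 th by (intro mult_mono power_decreasing powr_mono) auto
      also have "\<dots> = ((c * N powr (- \<theta>)) * (c * N powr (- \<theta>))) * (c * N powr (- \<theta>))"
        by (simp add: power3_eq_cube powr_add[symmetric])
      also have "\<dots> \<le> (iw \<theta> h * pw \<theta> (u, v)) * pw \<theta> (a, w)"
        using N1 b iw_ge pw_ge pos by (intro mult_mono) (auto intro!: mult_nonneg_nonneg)
      also have "\<dots> \<le> G (h, u, v) * pw \<theta> (a, w)"
        using eq True by (intro mult_right_mono) (auto simp: G_def G1_def G2_def)
      finally show ?thesis .
    next
      case False
      have "c ^ 4 * N powr (- \<alpha>) \<le> c ^ 4 * N powr (- (3 * \<theta> + 2 * \<epsilon>))"
        using c0 N1 th by (intro mult_left_mono powr_mono) auto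
      also have "\<dots> = ((c * N powr (- \<theta>)) * ((c * N powr (- \<theta>)) * (c * N powr (- \<theta>)))) * (c * N powr (- (2 * \<epsilon>)))"
      proof -
        have "- (3 * \<theta> + 2 * \<epsilon>) = - \<theta> + (- \<theta> + - \<theta>) + - (2 * \<epsilon>)" by simp
        then show ?thesis by (simp only: powr_add power4_eq_xxxx mult_ac)
      qed
      also have "\<dots> \<le> (iw \<theta> h * (iw \<theta> u * iw \<theta> v)) * pw \<theta> (a, w)"
        using N1 b iw_ge pw_ge1 pos False by (intro mult_mono) (auto intro!: mult_nonneg_nonneg)
      also have "\<dots> \<le> G (h, u, v) * pw \<theta> (a, w)"
        by (intro mult_right_mono) (auto simp: G_def G1_def G2_def)
      finally show ?thesis .
    qed
    then show ?thesis using c0 by (simp add: Pe N_def[unfolded Pe, symmetric] field_simps)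
  qed
  have "(\<lambda>P. (1 / c ^ 4) * (case ?\<phi> P of (q, r) \<Rightarrow> G q * pw \<theta> r)) summable_on isotropic 1"
    using sP by (rule summable_on_cmult_right)
  then show ?thesis
    by (rule summable_on_comparison_test) (use bound in auto)
qed

section \<open>Dependence on the real part\<close>

lemma Fpl_Complex:
  "Fpl (a, u, h, v, w) (Complex x1 y1) (Complex x2 y2) (Complex x3 y3) =
    Complex
     (w + u * x1 + 2 * h * x2 + v * x3 + a * (x1 * x3 - x2\<^sup>2) - a * (y1 * y3 - y2\<^sup>2))
     ((u + a * x3) * y1 + 2 * (h - a * x2) * y2 + (v + a * x1) * y3)"
  by (simp add: Fpl_eq complex_eq_iff power2_eq_square algebra_simps)

text \<open>After a real translation \<open>x = 0\<close>. Then \<open>|F|\<^sup>2 = w\<^sup>2 + a\<^sup>2 d\<^sup>2 + tr((T Y)\<^sup>2)\<close> on the quadric,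
  where \<open>T = ((u, h), (h, v))\<close>, and the trace is diagonalised by the Cholesky decomposition of \<open>Y\<close>.\<close>

lemma norm_sq_on_quadric:
  fixes a u h v w y1 y2 y3 :: real
  assumes "y1 > 0" "h\<^sup>2 + a * w = u * v"
  defines "d \<equiv> y1 * y3 - y2\<^sup>2" and "c \<equiv> y2 / y1"
  shows "(w - a * d)\<^sup>2 + (u * y1 + 2 * h * y2 + v * y3)\<^sup>2 =
    w\<^sup>2 + (a * d)\<^sup>2 + (y1 * (u + 2 * c * h + c\<^sup>2 * v))\<^sup>2 + 2 * d * (h + c * v)\<^sup>2 + (d / y1 * v)\<^sup>2"
proof -
  have y2: "y2 = c * y1" using assms(1) by (simp add: c_def)
  define e where "e = d / y1"
  have d: "d = e * y1" using assms(1) by (simp add: e_def)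
  have "y1 * y3 = (e + c\<^sup>2 * y1) * y1"
    using d unfolding d_def y2 by (simp add: power2_eq_square algebra_simps)
  then have y3: "y3 = e + c\<^sup>2 * y1" using assms(1) by simp
  have aw: "a * w = u * v - h\<^sup>2" using assms(2) by simp
  have 1: "(w - a * d)\<^sup>2 = w\<^sup>2 + (a * d)\<^sup>2 - 2 * d * (u * v - h\<^sup>2)"
    unfolding aw[symmetric] by (simp add: power2_eq_square algebra_simps)
  show ?thesis
    unfolding 1 e_def[symmetric] unfolding d y3 y2 by (simp add: power2_eq_square algebra_simps)
qed

text \<open>With Y fixed and X in a box, a single constant works for all vectors and all points.
  This uniformity in X is what the majorant requires.\<close>

lemma height_le_Fpl:
  assumes y: "y1 > 0" "y1 * y3 - y2\<^sup>2 > 0"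
  shows "\<exists>c>0. \<forall>P\<in>isotropic 1. \<forall>x1 x2 x3. \<bar>x1\<bar> \<le> R \<longrightarrow> \<bar>x2\<bar> \<le> R \<longrightarrow> \<bar>x3\<bar> \<le> R \<longrightarrow>
    height P \<le> c * norm (Fpl P (Complex x1 y1) (Complex x2 y2) (Complex x3 y3))"
proof -
  define d where "d = y1 * y3 - y2\<^sup>2"
  define c where "c = y2 / y1"
  have d0: "d > 0" using y by (simp add: d_def)
  \<comment> \<open>The squares in \<open>norm_sq_on_quadric\<close> form a triangular system: one
    bounds V, the next then H, the next then U. \<open>Kv\<close>, \<open>Kh\<close>,
    \<open>Ku\<close> are the resulting constants, and the terms with r undo the
    translation.\<close>
  define Kv where "Kv = y1 / d"
  define Kh where "Kh = 1 / sqrt d + \<bar>c\<bar> * Kv"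
  define Ku where "Ku = 1 / y1 + 2 * \<bar>c\<bar> * Kh + c\<^sup>2 * Kv"
  define Ka where "Ka = 1 / d"
  define r where "r = \<bar>R\<bar>"
  define K where "K = Ka + (Ku + r * Ka) + (Kh + r * Ka) + (Kv + r * Ka)
      + (1 + r * (Ku + r * Ka) + 2 * r * (Kh + r * Ka) + r * (Kv + r * Ka) + 2 * r\<^sup>2 * Ka)"
  have K0: "Kv \<ge> 0" "Kh \<ge> 0" "Ku \<ge> 0" "Ka \<ge> 0" "r \<ge> 0"
    using d0 y by (simp_all add: Kv_def Kh_def Ku_def Ka_def r_def)
  have "height P \<le> K * norm (Fpl P (Complex x1 y1) (Complex x2 y2) (Complex x3 y3))"
    if P: "P \<in> isotropic 1" and x: "\<bar>x1\<bar> \<le> R" "\<bar>x2\<bar> \<le> R" "\<bar>x3\<bar> \<le> R" for P x1 x2 x3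
  proof -
    obtain a' u' h' v' w' where Pe: "P = (a', u', h', v', w')" by (cases P)
    define a u h v w where "a = real_of_int a'" "u = real_of_int u'" "h = real_of_int h'"
      "v = real_of_int v'" "w = real_of_int w'"
    note defs = a_u_h_v_w_def
    define f where "f = norm (Fpl P (Complex x1 y1) (Complex x2 y2) (Complex x3 y3))"
    \<comment> \<open>The vector after the real translation that moves the point to X = 0. It still
      satisfies the equation of the quadric, though no longer with integral entries.\<close>
    define U H V W where "U = u + a * x3" "H = h - a * x2" "V = v + a * x1"
      "W = w + u * x1 + 2 * h * x2 + v * x3 + a * (x1 * x3 - x2\<^sup>2)"
    note Defs = U_H_V_W_def
    have "h'\<^sup>2 + a' * w' = u' * v'" using P by (simp add: Pe isotropic_iff)
    then have "real_of_int (h'\<^sup>2 + a' * w') = real_of_int (u' * v')" by (simp only:)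
    then have q0: "h\<^sup>2 + a * w = u * v" by (simp add: defs)
    have q: "H\<^sup>2 + a * W = U * V"
      using q0 unfolding Defs by (simp add: power2_eq_square algebra_simps)
    have "f\<^sup>2 = (W - a * d)\<^sup>2 + (U * y1 + 2 * H * y2 + V * y3)\<^sup>2"
      unfolding f_def Pe Fpl_Complex by (simp add: cmod_power2 Defs d_def defs)
    also have "\<dots> = W\<^sup>2 + (a * d)\<^sup>2 + (y1 * (U + 2 * c * H + c\<^sup>2 * V))\<^sup>2 + 2 * d * (H + c * V)\<^sup>2 + (d / y1 * V)\<^sup>2"
      unfolding d_def c_def by (rule norm_sq_on_quadric[OF y(1) q])
    also have "2 * d * (H + c * V)\<^sup>2 = 2 * (sqrt d * (H + c * V))\<^sup>2" using d0 by (simp add: power_mult_distrib)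
    finally have f2: "f\<^sup>2 = W\<^sup>2 + (a * d)\<^sup>2 + (y1 * (U + 2 * c * H + c\<^sup>2 * V))\<^sup>2
      + 2 * (sqrt d * (H + c * V))\<^sup>2 + (d / y1 * V)\<^sup>2" .
    have f0: "f \<ge> 0" by (simp add: f_def)
    have le: "\<bar>t\<bar> \<le> f" if "t\<^sup>2 \<le> f\<^sup>2" for t using that f0 abs_le_square_iff[of t f] by simp
    have sq: "0 \<le> W\<^sup>2" "0 \<le> (a * d)\<^sup>2" "0 \<le> (y1 * (U + 2 * c * H + c\<^sup>2 * V))\<^sup>2"
      "0 \<le> (sqrt d * (H + c * V))\<^sup>2" "0 \<le> (d / y1 * V)\<^sup>2" by simp_all
    have e1: "\<bar>W\<bar> \<le> f" by (rule le) (use f2 sq in linarith)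
    have e2: "\<bar>a * d\<bar> \<le> f" by (rule le) (use f2 sq in linarith)
    have e3: "\<bar>y1 * (U + 2 * c * H + c\<^sup>2 * V)\<bar> \<le> f" by (rule le) (use f2 sq in linarith)
    have e4: "\<bar>sqrt d * (H + c * V)\<bar> \<le> f" by (rule le) (use f2 sq in linarith)
    have e5: "\<bar>d / y1 * V\<bar> \<le> f" by (rule le) (use f2 sq in linarith)
    have div: "\<bar>t\<bar> \<le> 1 / k * f" if "\<bar>k * t\<bar> \<le> f" "k > 0" for k t
      using that by (simp add: abs_mult pos_le_divide_eq mult.commute)
    have ba: "\<bar>a\<bar> \<le> Ka * f" using e2 d0 by (simp add: Ka_def abs_mult field_simps)
    have bV: "\<bar>V\<bar> \<le> Kv * f" using e5 d0 y by (simp add: Kv_def abs_mult field_simps)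
    have "\<bar>H + c * V\<bar> \<le> 1 / sqrt d * f" using div[OF e4] d0 by simp
    moreover have "\<bar>c * V\<bar> \<le> \<bar>c\<bar> * (Kv * f)" unfolding abs_mult using bV by (intro mult_left_mono) auto
    ultimately have bH: "\<bar>H\<bar> \<le> Kh * f" unfolding Kh_def by (simp add: algebra_simps; linarith)
    have "\<bar>U + 2 * c * H + c\<^sup>2 * V\<bar> \<le> 1 / y1 * f" using div[OF e3 y(1)] .
    moreover have "\<bar>2 * c * H\<bar> \<le> 2 * \<bar>c\<bar> * (Kh * f)" unfolding abs_mult using bH by (intro mult_mono) auto
    moreover have "\<bar>c\<^sup>2 * V\<bar> \<le> c\<^sup>2 * (Kv * f)" unfolding abs_mult using bV by (intro mult_mono) auto
    ultimately have bU: "\<bar>U\<bar> \<le> Ku * f" unfolding Ku_def by (simp add: algebra_simps; linarith)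
    have x': "\<bar>x1\<bar> \<le> r" "\<bar>x2\<bar> \<le> r" "\<bar>x3\<bar> \<le> r" using x by (simp_all add: r_def)
    have ax: "\<bar>a * t\<bar> \<le> r * (Ka * f)" if "\<bar>t\<bar> \<le> r" for t
      unfolding abs_mult using mult_mono[OF ba that] K0 f0 by (simp add: mult.commute)
    have bu: "\<bar>u\<bar> \<le> (Ku + r * Ka) * f" using bU ax[OF x'(3)] unfolding Defs by (simp add: algebra_simps; linarith)
    have bh: "\<bar>h\<bar> \<le> (Kh + r * Ka) * f" using bH ax[OF x'(2)] unfolding Defs by (simp add: algebra_simps; linarith)
    have bv: "\<bar>v\<bar> \<le> (Kv + r * Ka) * f" using bV ax[OF x'(1)] unfolding Defs by (simp add: algebra_simps; linarith)
    have w1: "\<bar>u * x1\<bar> \<le> (Ku + r * Ka) * f * r" unfolding abs_mult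
      using bu x' K0 f0 by (intro mult_mono) auto
    have w2: "\<bar>h * x2\<bar> \<le> (Kh + r * Ka) * f * r" unfolding abs_mult
      using bh x' K0 f0 by (intro mult_mono) auto
    have w3: "\<bar>v * x3\<bar> \<le> (Kv + r * Ka) * f * r" unfolding abs_mult
      using bv x' K0 f0 by (intro mult_mono) auto
    have "\<bar>x1 * x3\<bar> \<le> r * r" "\<bar>x2 * x2\<bar> \<le> r * r" unfolding abs_mult
      using x' K0 by (intro mult_mono; simp)+
    then have "\<bar>x1 * x3 - x2\<^sup>2\<bar> \<le> 2 * r\<^sup>2" by (simp add: power2_eq_square; linarith)
    then have w4: "\<bar>a * (x1 * x3 - x2\<^sup>2)\<bar> \<le> (Ka * f) * (2 * r\<^sup>2)" unfolding abs_mult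
      using ba K0 f0 by (intro mult_mono) auto
    define kw where "kw = 1 + r * (Ku + r * Ka) + 2 * r * (Kh + r * Ka) + r * (Kv + r * Ka) + 2 * r\<^sup>2 * Ka"
    have "\<bar>w\<bar> \<le> f + (Ku + r * Ka) * f * r + 2 * ((Kh + r * Ka) * f * r) + (Kv + r * Ka) * f * r + (Ka * f) * (2 * r\<^sup>2)"
      using e1 w1 w2 w3 w4 unfolding Defs by linarith
    also have "\<dots> = kw * f" by (simp add: kw_def algebra_simps)
    finally have bw: "\<bar>w\<bar> \<le> kw * f" .
    have Kge: "Ka \<le> K" "Ku + r * Ka \<le> K" "Kh + r * Ka \<le> K" "Kv + r * Ka \<le> K" "kw \<le> K"
      using K0 by (simp_all add: K_def kw_def)
    have up: "\<bar>t\<bar> \<le> K * f" if "\<bar>t\<bar> \<le> k * f" "k \<le> K" for t k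
      using that mult_right_mono[OF that(2) f0] by linarith
    show ?thesis unfolding f_def[symmetric] unfolding Pe
      by (rule height_le; fold defs; rule up) (rule ba bu bh bv bw Kge)+
  qed
  moreover have "K > 0" using K0 by (simp add: K_def add_nonneg_pos add_pos_nonneg)
  ultimately show ?thesis by blast
qed

section \<open>Majorants and continuity in the real part\<close>

lemma norm_eterm:
  assumes "x \<noteq> 0" "d > 0"
  shows "norm (eterm k s d x) = d powr Re s * norm x powr (- (2 * Re s + of_int k))"
proof -
  have "norm (complex_of_real (d / (norm x)\<^sup>2) powr s) = (d / (norm x)\<^sup>2) powr Re s"
    using assms by (subst norm_powr_real_powr) auto
  also have "\<dots> = d powr Re s * norm x powr (- (2 * Re s))"
    using assms by (simp add: powr_divide powr_minus_divide powr_powr flip: powr_numeral)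
  finally have 1: "norm (complex_of_real (d / (norm x)\<^sup>2) powr s) = d powr Re s * norm x powr (- (2 * Re s))" .
  have 2: "norm (x powi (- k)) = norm x powr (of_int (- k))"
    using assms by (subst powr_real_of_int') (auto simp: norm_power_int)
  have "of_int (- k) + - (2 * Re s) = - (2 * Re s + of_int k)" by simp
  then have 3: "norm x powr (of_int (- k)) * norm x powr (- (2 * Re s)) = norm x powr (- (2 * Re s + of_int k))"
    by (simp only: powr_add[symmetric])
  show ?thesis unfolding eterm_def norm_mult 1 2 3[symmetric] by (simp only: mult_ac)
qed

text \<open>One majorant serves three purposes: absolute convergence at a point, the Weierstrass
  test on balls, and, through the same height bound, non-vanishing of j(g, Z).\<close>

lemma eterm_dominated:
  assumes y: "y1 > 0" "y1 * y3 - y2\<^sup>2 > 0" and "2 * Re s + of_int k > 3"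
  shows "\<exists>M. M summable_on isotropic 1 \<and> (\<forall>P\<in>isotropic 1. \<forall>x1 x2 x3. \<bar>x1\<bar> \<le> R \<longrightarrow> \<bar>x2\<bar> \<le> R \<longrightarrow> \<bar>x3\<bar> \<le> R \<longrightarrow>
    Fpl P (Complex x1 y1) (Complex x2 y2) (Complex x3 y3) \<noteq> 0 \<and>
    norm (eterm k s (y1 * y3 - y2\<^sup>2) (Fpl P (Complex x1 y1) (Complex x2 y2) (Complex x3 y3))) \<le> M P)"
proof -
  define \<alpha> where "\<alpha> = 2 * Re s + of_int k"
  define D where "D = y1 * y3 - y2\<^sup>2"
  obtain c where c: "c > 0" "\<And>P x1 x2 x3. P \<in> isotropic 1 \<Longrightarrow> \<bar>x1\<bar> \<le> R \<Longrightarrow> \<bar>x2\<bar> \<le> R \<Longrightarrow> \<bar>x3\<bar> \<le> R \<Longrightarrow>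
    height P \<le> c * norm (Fpl P (Complex x1 y1) (Complex x2 y2) (Complex x3 y3))"
    using height_le_Fpl[OF y] by meson
  define M where "M P = D powr Re s * c powr \<alpha> * height P powr (- \<alpha>)" for P
  have "M summable_on isotropic 1"
    unfolding M_def using assms(3) by (intro summable_on_cmult_right height_summable) (simp add: \<alpha>_def)
  moreover have "F \<noteq> 0 \<and> norm (eterm k s D F) \<le> M P"
    if P: "P \<in> isotropic 1" and x: "\<bar>x1\<bar> \<le> R" "\<bar>x2\<bar> \<le> R" "\<bar>x3\<bar> \<le> R"
      and F: "F = Fpl P (Complex x1 y1) (Complex x2 y2) (Complex x3 y3)" for P x1 x2 x3 F
  proof -
    have h: "1 \<le> height P" "height P \<le> c * norm F" using c(2)[OF P x] height_ge_1[OF P] by (simp_all add: F)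
    then have F0: "F \<noteq> 0" using c(1) by auto
    have "norm (eterm k s D F) = D powr Re s * norm F powr (- \<alpha>)"
      using norm_eterm[OF F0] y by (simp add: D_def \<alpha>_def)
    also have "norm F powr (- \<alpha>) = c powr \<alpha> * (c * norm F) powr (- \<alpha>)"
      using c(1) by (simp add: powr_mult powr_minus)
    also have "\<dots> \<le> c powr \<alpha> * height P powr (- \<alpha>)"
      using h assms(3) by (intro mult_left_mono powr_mono2') (auto simp: \<alpha>_def)
    finally have "norm (eterm k s D F) \<le> M P" by (simp add: M_def mult_left_mono mult.assoc)
    with F0 show ?thesis by simp
  qed
  ultimately show ?thesis unfolding D_def by blast
qed

lemma continuous_on_eterm:
  assumes "continuous_on S f" "\<And>x. x \<in> S \<Longrightarrow> f x \<noteq> 0" "d > 0"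
  shows "continuous_on S (\<lambda>x. eterm k s d (f x))"
proof -
  \<comment> \<open>The base of the complex power is a positive real, so a real logarithm describes
    it and no branch cut interferes.\<close>
  have "eterm k s d (f x) = f x powi (- k) * exp (s * complex_of_real (ln (d / (norm (f x))\<^sup>2)))"
    if "x \<in> S" for x
    using assms(2)[OF that] assms(3) by (simp add: eterm_def powr_def Ln_of_real flip: of_real_divide of_real_power)
  moreover have "continuous_on S (\<lambda>x. f x powi (- k) * exp (s * complex_of_real (ln (d / (norm (f x))\<^sup>2))))"
    using assms by (intro continuous_intros) auto
  ultimately show ?thesis by (simp cong: continuous_on_cong)
qed

lemma continuous_EisP:
  assumes y: "y1 > 0" "y1 * y3 - y2\<^sup>2 > 0" and "2 * Re s + of_int k > 3"
  shows "continuous_on UNIV (\<lambda>(x1, x2, x3). EisP k s (Complex x1 y1) (Complex x2 y2) (Complex x3 y3))"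
    (is "continuous_on UNIV ?E")
proof -
  let ?F = "\<lambda>P (x1, x2, x3). Fpl P (Complex x1 y1) (Complex x2 y2) (Complex x3 y3)"
  let ?t = "\<lambda>P X. eterm k s (y1 * y3 - y2\<^sup>2) (?F P X)"
  have cF: "continuous_on S (?F P)" for S P
    by (cases P) (simp add: Fpl_eq case_prod_unfold Complex_eq, intro continuous_intros)
  have "continuous_on (ball 0 R) ?E" for R
  proof -
    obtain M where M: "M summable_on isotropic 1"
      "\<And>P x1 x2 x3. P \<in> isotropic 1 \<Longrightarrow> \<bar>x1\<bar> \<le> R \<Longrightarrow> \<bar>x2\<bar> \<le> R \<Longrightarrow> \<bar>x3\<bar> \<le> R \<Longrightarrow>
        ?F P (x1, x2, x3) \<noteq> 0 \<and> norm (?t P (x1, x2, x3)) \<le> M P"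
      using eterm_dominated[OF assms, of R] by auto
    have b: "\<bar>x1\<bar> \<le> R \<and> \<bar>x2\<bar> \<le> R \<and> \<bar>x3\<bar> \<le> R" if "(x1, x2, x3) \<in> ball 0 R" for x1 x2 x3 :: real
    proof -
      have n: "norm (x1, x2, x3) < R" using that by simp
      have "\<bar>x1\<bar> \<le> norm (x1, x2, x3)" using norm_fst_le[of x1 "(x2, x3)"] by simp
      moreover have "norm (x2, x3) \<le> norm (x1, x2, x3)" using norm_snd_le[of "(x2, x3)" x1] by simp
      moreover have "\<bar>x2\<bar> \<le> norm (x2, x3)" "\<bar>x3\<bar> \<le> norm (x2, x3)"
        using norm_fst_le[of x2 x3] norm_snd_le[of x3 x2] by simp_all
      ultimately show ?thesis using n by linarith
    qed
    have Mb: "?F P X \<noteq> 0 \<and> norm (?t P X) \<le> M P" if "P \<in> isotropic 1" "X \<in> ball 0 R" for P X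
      using M(2)[OF that(1)] b that(2) by (cases X) blast
    have "uniform_limit (ball 0 R) (\<lambda>A X. \<Sum>P\<in>A. ?t P X) (\<lambda>X. \<Sum>\<^sub>\<infinity>P\<in>isotropic 1. ?t P X)
        (finite_subsets_at_top (isotropic 1))"
      using Mb M(1) by (intro Weierstrass_m_test_general) auto
    moreover have "\<forall>\<^sub>F A in finite_subsets_at_top (isotropic 1). continuous_on (ball 0 R) (\<lambda>X. \<Sum>P\<in>A. ?t P X)"
      unfolding eventually_finite_subsets_at_top
    proof (intro exI[of _ "{}"] conjI allI impI)
      fix A :: "vec5 set" assume A: "finite A \<and> {} \<subseteq> A \<and> A \<subseteq> isotropic 1"
      show "continuous_on (ball 0 R) (\<lambda>X. \<Sum>P\<in>A. ?t P X)"
        using Mb A y by (intro continuous_on_sum continuous_on_eterm cF) auto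
    qed auto
    ultimately have "continuous_on (ball 0 R) (\<lambda>X. \<Sum>\<^sub>\<infinity>P\<in>isotropic 1. ?t P X)"
      by (intro uniform_limit_theorem) auto
    then show ?thesis by (simp add: EisP_def case_prod_unfold)
  qed
  then have "isCont ?E X" for X
    using continuous_on_eq_continuous_at[OF open_ball, of 0 "norm X + 1" ?E] by simp
  then show ?thesis by (simp add: continuous_at_imp_continuous_on)
qed

lemma eterm_summable:
  assumes "Im x > 0" "Im x * Im z - (Im y)\<^sup>2 > 0" "2 * Re s + of_int k > 3"
  shows "(\<lambda>P. eterm k s (Im x * Im z - (Im y)\<^sup>2) (Fpl P x y z)) summable_on isotropic 1"
    and "P \<in> isotropic 1 \<Longrightarrow> Fpl P x y z \<noteq> 0"
proof -
  define R where "R = \<bar>Re x\<bar> + \<bar>Re y\<bar> + \<bar>Re z\<bar>"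
  obtain M where M: "M summable_on isotropic 1" "\<And>P. P \<in> isotropic 1 \<Longrightarrow>
        Fpl P x y z \<noteq> 0 \<and> norm (eterm k s (Im x * Im z - (Im y)\<^sup>2) (Fpl P x y z)) \<le> M P"
  proof -
    have "\<bar>Re x\<bar> \<le> R" "\<bar>Re y\<bar> \<le> R" "\<bar>Re z\<bar> \<le> R" by (simp_all add: R_def)
    then show ?thesis using eterm_dominated[OF assms, of R] that
      by (metis complex_surj)
  qed
  show "(\<lambda>P. eterm k s (Im x * Im z - (Im y)\<^sup>2) (Fpl P x y z)) summable_on isotropic 1"
    by (rule abs_summable_summable, rule summable_on_comparison_test[OF M(1)]) (use M(2) in auto)
  show "P \<in> isotropic 1 \<Longrightarrow> Fpl P x y z \<noteq> 0" using M(2) by blast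
qed

section \<open>Hecke operators\<close>

lemma isotropic_prim:
  assumes "(a, u, h, v, w) \<in> isotropic t" "q dvd a" "q dvd u" "q dvd h" "q dvd v" "q dvd w"
  shows "q dvd 1"
  using assms unfolding isotropic_iff by blast

lemma isotropicI:
  assumes "t * h\<^sup>2 + a * w = u * v"
    and "\<And>q. q dvd a \<Longrightarrow> q dvd u \<Longrightarrow> q dvd h \<Longrightarrow> q dvd v \<Longrightarrow> q dvd w \<Longrightarrow> q dvd 1"
  shows "(a, u, h, v, w) \<in> isotropic t"
  using assms unfolding isotropic_iff by blast

section \<open>Symmetry and periodicity of the series\<close>

definition swap5 :: "vec5 \<Rightarrow> vec5" where
  "swap5 = (\<lambda>(a, u, h, v, w). (a, v, h, u, w))"

lemma bij_swap5: "bij_betw swap5 (isotropic t) (isotropic t)"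
  by (rule bij_betw_byWitness[where f' = swap5]) (auto simp: swap5_def isotropic_def mult.commute)

lemma EisP_swap: "EisP k s z y x = EisP k s x y z"
proof -
  have "Fpl (swap5 P) x y z = Fpl P z y x" for P
    by (cases P) (simp add: swap5_def Fpl_eq algebra_simps)
  then show ?thesis
    unfolding EisP_def
    using infsum_reindex_bij_betw[OF bij_swap5[of 1], of "\<lambda>P. eterm k s (Im x * Im z - (Im y)\<^sup>2) (Fpl P x y z)"]
    by (simp add: mult.commute)
qed

text \<open>These are the coefficients of \<open>Fpl P\<close> after translating (x, y, z) by (l, m,
  n).\<close>

definition shift5 :: "int \<Rightarrow> int \<Rightarrow> int \<Rightarrow> vec5 \<Rightarrow> vec5" where
  "shift5 l m n = (\<lambda>(a, u, h, v, w). (a, u + a * n, h - a * m, v + a * l,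
     w + u * l + 2 * h * m + v * n + a * (l * n - m\<^sup>2)))"

lemma shift5_isotropic:
  assumes "P \<in> isotropic 1"
  shows "shift5 l m n P \<in> isotropic 1"
proof -
  obtain a u h v w where P: "P = (a, u, h, v, w)" by (cases P)
  have q: "h\<^sup>2 + a * w = u * v" using assms by (simp add: P isotropic_iff)
  have "(a, u + a * n, h - a * m, v + a * l, w + u * l + 2 * h * m + v * n + a * (l * n - m\<^sup>2)) \<in> isotropic 1"
  proof (rule isotropicI)
    show "1 * (h - a * m)\<^sup>2 + a * (w + u * l + 2 * h * m + v * n + a * (l * n - m\<^sup>2)) = (u + a * n) * (v + a * l)"
      using q by (simp add: power2_eq_square algebra_simps)
  next
    fix q assume a: "q dvd a" and u': "q dvd u + a * n" and h': "q dvd h - a * m" and v': "q dvd v + a * l"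
      and w': "q dvd w + u * l + 2 * h * m + v * n + a * (l * n - m\<^sup>2)"
    have u: "q dvd u" using dvd_diff[OF u', of "a * n"] a by simp
    have h: "q dvd h" using dvd_add[OF h', of "a * m"] a by simp
    have v: "q dvd v" using dvd_diff[OF v', of "a * l"] a by simp
    have "q dvd u * l + 2 * h * m + v * n + a * (l * n - m\<^sup>2)" using a u h v by simp
    from dvd_diff[OF w' this] have w: "q dvd w" by simp
    show "q dvd 1" using isotropic_prim[OF assms[unfolded P] a u h v w] .
  qed
  then show ?thesis by (simp add: P shift5_def)
qed

lemma EisP_periodic:
  "EisP k s (x + of_int l) (y + of_int m) (z + of_int n) = EisP k s x y z"
proof -
  have inv: "shift5 (-l) (-m) (-n) (shift5 l m n P) = P" for l m n P
    by (cases P) (simp add: shift5_def power2_eq_square algebra_simps)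
  have "bij_betw (shift5 l m n) (isotropic 1) (isotropic 1)"
    by (rule bij_betw_byWitness[where f' = "shift5 (-l) (-m) (-n)"])
       (use inv[of l m n] inv[of "-l" "-m" "-n"] in \<open>auto simp: shift5_isotropic\<close>)
  moreover have "Fpl (shift5 l m n P) x y z = Fpl P (x + of_int l) (y + of_int m) (z + of_int n)" for P
    by (cases P) (simp add: shift5_def Fpl_eq power2_eq_square algebra_simps)
  ultimately show ?thesis
    unfolding EisP_def
    using infsum_reindex_bij_betw[of "shift5 l m n" "isotropic 1" "isotropic 1" "\<lambda>P. eterm k s (Im x * Im z - (Im y)\<^sup>2) (Fpl P x y z)"]
    by simp
qed

section \<open>The p + 1 sublattices of index p\<close>

text \<open>The index \<open>p\<close> sublattices of the first hyperbolic plane \<open>\<int>\<^sup>2\<close> are \<open>c \<equiv> 0\<close> and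
  \<open>d \<equiv> b c\<close> modulo \<open>p\<close>. For each of them the primitive vectors of the quadrics \<open>isotropic 1\<close> and
  \<open>isotropic p\<close> correspond to each other, the image being divided by \<open>p\<close> when possible.\<close>

definition down_inf :: "int \<Rightarrow> vec5 \<Rightarrow> vec5" where
  "down_inf p = (\<lambda>(a, u, h, v, w). if p dvd a \<and> p dvd u then (a div p, u div p, h, v, w)
     else (a, u, p * h, p * v, p * w))"

definition up_inf :: "int \<Rightarrow> vec5 \<Rightarrow> vec5" where
  "up_inf p = (\<lambda>(a, u, h, v, w). if p dvd v \<and> p dvd w then (a, u, h div p, v div p, w div p)
     else (p * a, p * u, h, v, w))"

lemma dvd_cancel_prime:
  assumes "prime (p::int)" "\<not> p dvd q" "q dvd p * x"
  shows "q dvd x"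
proof -
  have "coprime q p" using assms prime_imp_coprime coprime_commute by blast
  then show ?thesis using assms(3) by (simp add: coprime_dvd_mult_right_iff)
qed

text \<open>The divisions are exact and the cases of the two maps match for one reason: if p divides
  v and w on \<open>isotropic 1\<close>, the equation makes p divide h^2 and thus h, and primitivity
  excludes that p divides the remaining entries as well. Away from p,
  \<open>dvd_cancel_prime\<close> keeps primitivity intact.\<close>

lemma bij_down_inf:
  assumes "prime (p::int)"
  shows "bij_betw (down_inf p) (isotropic p) (isotropic 1)"
proof (rule bij_betw_byWitness[where f' = "up_inf p"])
  have p0: "p \<noteq> 0" using assms by auto
  have punit: "\<not> p dvd 1" using assms not_prime_unit by blast
  have sq: "p dvd h" if "p dvd h\<^sup>2" for h using that assms prime_dvd_power by blast
  have A: "down_inf p Q \<in> isotropic 1 \<and> up_inf p (down_inf p Q) = Q" if Q: "Q \<in> isotropic p" for Q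
  proof -
    obtain a u h v w where Qe: "Q = (a, u, h, v, w)" by (cases Q)
    note Q' = Q[unfolded Qe]
    have q: "p * h\<^sup>2 + a * w = u * v" using Q' by (simp add: isotropic_iff)
    show ?thesis
    proof (cases "p dvd a \<and> p dvd u")
      case True
      obtain a' where a': "a = p * a'" using True by (meson dvdE)
      obtain u' where u': "u = p * u'" using True by (meson dvdE)
      have "p * (h\<^sup>2 + a' * w) = p * (u' * v)" using q unfolding a' u' by (simp add: algebra_simps)
      then have q': "h\<^sup>2 + a' * w = u' * v" using p0 by simp
      have nd: "\<not> (p dvd v \<and> p dvd w)"
      proof
        assume vw: "p dvd v \<and> p dvd w"
        have "h\<^sup>2 = u' * v - a' * w" using q' by simp
        then have "p dvd h\<^sup>2" using vw by (simp only: dvd_diff dvd_mult)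
        then have "p dvd h" by (rule sq)
        then show False using isotropic_prim[OF Q'] True vw punit by blast
      qed
      have "(a', u', h, v, w) \<in> isotropic 1"
        by (rule isotropicI) (use q' isotropic_prim[OF Q'] in \<open>auto simp: a' u'\<close>)
      moreover have "down_inf p Q = (a', u', h, v, w)"
        using p0 by (simp add: Qe down_inf_def a' u')
      moreover have "up_inf p (a', u', h, v, w) = Q"
        using nd by (auto simp: up_inf_def Qe a' u')
      ultimately show ?thesis by simp
    next
      case False
      have "(a, u, p * h, p * v, p * w) \<in> isotropic 1"
      proof (rule isotropicI)
        have "p * (p * h\<^sup>2 + a * w) = p * (u * v)" using q by simp
        then show "1 * (p * h)\<^sup>2 + a * (p * w) = u * (p * v)" by (simp add: power2_eq_square algebra_simps)
      next
        fix r assume r: "r dvd a" "r dvd u" "r dvd p * h" "r dvd p * v" "r dvd p * w"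
        have "\<not> p dvd r" using False r dvd_trans by blast
        then show "r dvd 1" using isotropic_prim[OF Q'] r dvd_cancel_prime[OF assms] by blast
      qed
      moreover have "down_inf p Q = (a, u, p * h, p * v, p * w)"
        using False by (auto simp: Qe down_inf_def)
      moreover have "up_inf p (a, u, p * h, p * v, p * w) = Q"
        using p0 by (simp add: up_inf_def Qe)
      ultimately show ?thesis by simp
    qed
  qed
  have B: "up_inf p P \<in> isotropic p \<and> down_inf p (up_inf p P) = P" if P: "P \<in> isotropic 1" for P
  proof -
    obtain a u h v w where Pe: "P = (a, u, h, v, w)" by (cases P)
    note P' = P[unfolded Pe]
    have q: "h\<^sup>2 + a * w = u * v" using P' by (simp add: isotropic_iff)
    show ?thesis
    proof (cases "p dvd v \<and> p dvd w")
      case True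
      obtain v' where v': "v = p * v'" using True by (meson dvdE)
      obtain w' where w': "w = p * w'" using True by (meson dvdE)
      have "h\<^sup>2 = u * v - a * w" using q by simp
      then have "p dvd h\<^sup>2" using True by (simp only: dvd_diff dvd_mult)
      then have "p dvd h" by (rule sq)
      then obtain h' where h': "h = p * h'" by (meson dvdE)
      have "p * (p * h'\<^sup>2 + a * w') = p * (u * v')"
        using q unfolding h' v' w' by (simp add: power2_eq_square algebra_simps)
      then have q': "p * h'\<^sup>2 + a * w' = u * v'" using p0 by simp
      have nd: "\<not> (p dvd a \<and> p dvd u)"
        using isotropic_prim[OF P'] True \<open>p dvd h\<close> punit by blast
      have "(a, u, h', v', w') \<in> isotropic p"
        by (rule isotropicI) (use q' isotropic_prim[OF P'] in \<open>auto simp: h' v' w'\<close>)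
      moreover have "up_inf p P = (a, u, h', v', w')"
        using p0 by (simp add: Pe up_inf_def h' v' w')
      moreover have "down_inf p (a, u, h', v', w') = P"
        using nd by (auto simp: down_inf_def Pe h' v' w')
      ultimately show ?thesis by simp
    next
      case False
      have "(p * a, p * u, h, v, w) \<in> isotropic p"
      proof (rule isotropicI)
        have "p * (h\<^sup>2 + a * w) = p * (u * v)" using q by simp
        then show "p * h\<^sup>2 + p * a * w = p * u * v" by (simp add: algebra_simps)
      next
        fix r assume r: "r dvd p * a" "r dvd p * u" "r dvd h" "r dvd v" "r dvd w"
        have "\<not> p dvd r" using False r dvd_trans by blast
        then show "r dvd 1" using isotropic_prim[OF P'] r dvd_cancel_prime[OF assms] by blast
      qed
      moreover have "up_inf p P = (p * a, p * u, h, v, w)"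
        using False by (auto simp: Pe up_inf_def)
      moreover have "down_inf p (p * a, p * u, h, v, w) = P"
        using p0 by (simp add: down_inf_def Pe)
      ultimately show ?thesis by simp
    qed
  qed
  show "\<forall>a\<in>isotropic p. up_inf p (down_inf p a) = a" "\<forall>a'\<in>isotropic 1. down_inf p (up_inf p a') = a'"
    "down_inf p ` isotropic p \<subseteq> isotropic 1" "up_inf p ` isotropic 1 \<subseteq> isotropic p"
    using A B by blast+
qed

definition flip5 :: "vec5 \<Rightarrow> vec5" where
  "flip5 = (\<lambda>(a, u, h, v, w). (v, w, h, - a, - u))"

definition unflip5 :: "vec5 \<Rightarrow> vec5" where
  "unflip5 = (\<lambda>(a, u, h, v, w). (- v, - w, h, a, u))"

definition shear5 :: "int \<Rightarrow> vec5 \<Rightarrow> vec5" where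
  "shear5 b = (\<lambda>(a, u, h, v, w). (a, u, h, v - b * a, w - b * u))"

lemma bij_flip5: "bij_betw flip5 (isotropic t) (isotropic t)" "bij_betw unflip5 (isotropic t) (isotropic t)"
proof -
  have f: "flip5 P \<in> isotropic t" if "P \<in> isotropic t" for P
    using that isotropic_gens(3) by (cases P) (auto simp: flip5_def)
  have u: "unflip5 P \<in> isotropic t" if "P \<in> isotropic t" for P
  proof -
    have "unflip5 P = flip5 (flip5 (flip5 P))" by (cases P) (simp add: flip5_def unflip5_def)
    then show ?thesis using f that by simp
  qed
  have 1: "unflip5 (flip5 P) = P" "flip5 (unflip5 P) = P" for P
    by (cases P; simp add: flip5_def unflip5_def)+
  show "bij_betw flip5 (isotropic t) (isotropic t)"
    by (rule bij_betw_byWitness[where f' = unflip5]) (use f u 1 in auto)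
  show "bij_betw unflip5 (isotropic t) (isotropic t)"
    by (rule bij_betw_byWitness[where f' = flip5]) (use f u 1 in auto)
qed

lemma bij_shear5: "bij_betw (shear5 b) (isotropic t) (isotropic t)"
proof (rule bij_betw_byWitness[where f' = "shear5 (- b)"])
  have f: "shear5 b P \<in> isotropic t" if "P \<in> isotropic t" for P b
  proof -
    obtain a u h v w where P: "P = (a, u, h, v, w)" by (cases P)
    show ?thesis using isotropic_gens(1)[OF that[unfolded P], of "- b"] by (simp add: P shear5_def)
  qed
  show "shear5 b ` isotropic t \<subseteq> isotropic t" "shear5 (- b) ` isotropic t \<subseteq> isotropic t"
    using f by blast+
qed (auto simp: shear5_def)

text \<open>The shear turns v \<equiv> b a, w \<equiv> b u into v \<equiv> w \<equiv> 0, and the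
  flip turns this into the condition of \<open>down_inf\<close>. Bijectivity is thereby inherited
  from the one case already treated.\<close>

definition down_fin :: "int \<Rightarrow> int \<Rightarrow> vec5 \<Rightarrow> vec5" where
  "down_fin p b Q = unflip5 (down_inf p (flip5 (shear5 b Q)))"

lemma bij_down_fin:
  assumes "prime (p::int)"
  shows "bij_betw (down_fin p b) (isotropic p) (isotropic 1)"
proof -
  have "down_fin p b = unflip5 \<circ> (down_inf p \<circ> (flip5 \<circ> shear5 b))"
    by (simp add: fun_eq_iff down_fin_def)
  then show ?thesis
    by (simp only:) (rule bij_betw_trans[OF bij_betw_trans[OF bij_betw_trans[OF bij_shear5 bij_flip5(1)]
          bij_down_inf[OF assms]] bij_flip5(2)])
qed

definition cond_inf :: "int \<Rightarrow> vec5 \<Rightarrow> bool" where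
  "cond_inf p = (\<lambda>(a, u, h, v, w). p dvd a \<and> p dvd u)"

definition cond_fin :: "int \<Rightarrow> int \<Rightarrow> vec5 \<Rightarrow> bool" where
  "cond_fin p b = (\<lambda>(a, u, h, v, w). p dvd v - b * a \<and> p dvd w - b * u)"

text \<open>Modulo p the rows (a, u) and (v, w) are linearly dependent, since a w \<equiv> u v. If
  (a, u) is non-zero, then (v, w) is b (a, u) for a unique residue b. If (a, u) vanishes, then (v,
  w) does not. So each vector picks one point of the projective line over the field with p
  elements.\<close>

lemma cond_fin_unique:
  assumes p: "prime p" and Q: "Q \<in> isotropic p"
  shows "cond_inf p Q \<Longrightarrow> \<not> cond_fin p b Q"
    and "\<not> cond_inf p Q \<Longrightarrow> \<exists>b0\<in>{0..<p}. \<forall>b\<in>{0..<p}. cond_fin p b Q \<longleftrightarrow> b = b0"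
proof -
  obtain a u h v w where Qe: "Q = (a, u, h, v, w)" by (cases Q)
  note Q' = Q[unfolded Qe]
  have q: "p * h\<^sup>2 + a * w = u * v" using Q' by (simp add: isotropic_iff)
  have p0: "p > 0" using p prime_gt_0_int by blast
  show "\<not> cond_fin p b Q" if "cond_inf p Q"
  proof
    assume "cond_fin p b Q"
    then have vb: "p dvd v - b * a" "p dvd w - b * u" by (simp_all add: cond_fin_def Qe)
    have au: "p dvd a" "p dvd u" using that by (simp_all add: cond_inf_def Qe)
    have v: "p dvd v" using dvd_add[OF vb(1), of "b * a"] au by simp
    have w: "p dvd w" using dvd_add[OF vb(2), of "b * u"] au by simp
    \<comment> \<open>The quadric gives u v - a w = p h^2, so p^2 on the left still leaves p
      dividing h^2, against primitivity.\<close>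
    have "p * p dvd u * v - a * w" using au v w by (intro dvd_diff mult_dvd_mono)
    also have "u * v - a * w = p * h\<^sup>2" using q by simp
    finally have "p dvd h\<^sup>2" using p0 by simp
    then have "p dvd h" using p prime_dvd_power by blast
    then show False using isotropic_prim[OF Q'] au v w p not_prime_unit by blast
  qed
  assume "\<not> cond_inf p Q"
  then have nd: "\<not> (p dvd a \<and> p dvd u)" by (simp add: cond_inf_def Qe)
  have cancel: "p dvd y" if "p dvd x * y" "\<not> p dvd x" for x y
    using that p prime_dvd_mult_iff by blast
  have solve: "\<exists>b. p dvd y - b * x" if "\<not> p dvd x" for x y
  proof -
    have "coprime p x" using that p prime_imp_coprime by blast
    then obtain c d where cd: "c * p + d * x = 1" using bezout_int[of p x] by (auto simp: coprime_iff_gcd_eq_1)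
    have "y - (y * d) * x = y * (c * p + d * x) - (y * d) * x" by (simp add: cd)
    also have "\<dots> = p * (y * c)" by (simp add: algebra_simps)
    finally show ?thesis by (metis dvd_triv_left)
  qed
  have "\<exists>b. p dvd v - b * a \<and> p dvd w - b * u"
  proof (cases "p dvd a")
    case False
    then obtain b where b: "p dvd v - b * a" using solve by blast
    have "a * (w - b * u) = u * (v - b * a) - p * h\<^sup>2" using q by (simp add: algebra_simps)
    then have "p dvd a * (w - b * u)" using b by simp
    then show ?thesis using b cancel False by blast
  next
    case True
    then have nu: "\<not> p dvd u" using nd by simp
    then obtain b where b: "p dvd w - b * u" using solve by blast
    have "u * (v - b * a) = a * (w - b * u) + p * h\<^sup>2" using q by (simp add: algebra_simps)
    then have "p dvd u * (v - b * a)" using b by simp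
    then show ?thesis using b cancel nu by blast
  qed
  then obtain b where b: "p dvd v - b * a" "p dvd w - b * u" by blast
  have iff: "cond_fin p c Q \<longleftrightarrow> p dvd b - c" for c
  proof
    assume "cond_fin p c Q"
    then have c: "p dvd v - c * a" "p dvd w - c * u" by (simp_all add: cond_fin_def Qe)
    have "p dvd a * (b - c)" using dvd_diff[OF c(1) b(1)] by (simp add: algebra_simps)
    moreover have "p dvd u * (b - c)" using dvd_diff[OF c(2) b(2)] by (simp add: algebra_simps)
    ultimately show "p dvd b - c" using nd cancel by blast
  next
    assume d: "p dvd b - c"
    have "v - c * a = (v - b * a) + (b - c) * a" "w - c * u = (w - b * u) + (b - c) * u"
      by (simp_all add: algebra_simps)
    then show "cond_fin p c Q"
      using dvd_add[OF b(1) dvd_mult2[OF d, of a]] dvd_add[OF b(2) dvd_mult2[OF d, of u]]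
      by (simp only: cond_fin_def Qe prod.case)
  qed
  show "\<exists>b0\<in>{0..<p}. \<forall>b\<in>{0..<p}. cond_fin p b Q \<longleftrightarrow> b = b0"
  proof (intro bexI[of _ "b mod p"] ballI)
    show "b mod p \<in> {0..<p}" using p0 by simp
    fix c assume "c \<in> {0..<p}"
    then have "c mod p = c" by simp
    then show "cond_fin p c Q \<longleftrightarrow> c = b mod p"
      unfolding iff by (metis mod_eq_dvd_iff)
  qed
qed

text \<open>The form at (p x, p y, z) of a vector of the first quadric, written in the coordinates
  (p a, p u, h, v, w). It is invariant under exchanging x with z and u with v.\<close>

definition Gpl :: "int \<Rightarrow> vec5 \<Rightarrow> complex \<Rightarrow> complex \<Rightarrow> complex \<Rightarrow> complex" where
  "Gpl p = (\<lambda>(a, u, h, v, w) x y z. of_int a * (x * z - of_int p * y\<^sup>2) + of_int u * x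
     + 2 * of_int p * of_int h * y + of_int v * z + of_int w)"

lemma Fpl_down_inf:
  assumes "p \<noteq> 0"
  shows "Fpl (down_inf p Q) (of_int p * x) (of_int p * y) z = (if cond_inf p Q then 1 else of_int p) * Gpl p Q x y z"
proof -
  obtain a u h v w where Q: "Q = (a, u, h, v, w)" by (cases Q)
  show ?thesis
  proof (cases "p dvd a \<and> p dvd u")
    case True
    obtain a' where a': "a = p * a'" using True by (meson dvdE)
    obtain u' where u': "u = p * u'" using True by (meson dvdE)
    show ?thesis using assms
      by (simp add: Q down_inf_def cond_inf_def Gpl_def a' u' Fpl_eq power2_eq_square algebra_simps)
  next
    case False
    then have "down_inf p Q = (a, u, p * h, p * v, p * w)" "\<not> cond_inf p Q"
      by (auto simp: Q down_inf_def cond_inf_def)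
    then show ?thesis by (simp add: Q Gpl_def Fpl_eq power2_eq_square algebra_simps)
  qed
qed

lemma Fpl_down_fin:
  assumes "p \<noteq> 0"
  shows "Fpl (down_fin p b Q) ((x + of_int b) / of_int p) y z = (if cond_fin p b Q then 1 else of_int p) * (Gpl p Q x y z / of_int p)"
proof -
  obtain a u h v w where Q: "Q = (a, u, h, v, w)" by (cases Q)
  show ?thesis
  proof (cases "p dvd v - b * a \<and> p dvd w - b * u")
    case True
    obtain v' where v': "v - b * a = p * v'" using True by (meson dvdE)
    obtain w' where w': "w - b * u = p * w'" using True by (meson dvdE)
    have v: "v = p * v' + b * a" and w: "w = p * w' + b * u" using v' w' by simp_all
    have "down_fin p b Q = (a, u, h, v', w')" "cond_fin p b Q"
      using assms by (simp_all add: Q down_fin_def shear5_def flip5_def unflip5_def down_inf_def cond_fin_def v w)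
    then show ?thesis using assms
      by (simp add: Q Gpl_def v w Fpl_eq power2_eq_square field_simps)
  next
    case False
    then have "down_fin p b Q = (p * a, p * u, p * h, v - b * a, w - b * u)" "\<not> cond_fin p b Q"
      by (auto simp: Q down_fin_def shear5_def flip5_def unflip5_def down_inf_def cond_fin_def)
    then show ?thesis using assms by (simp add: Q Gpl_def Fpl_eq power2_eq_square field_simps)
  qed
qed

lemma eterm_scale:
  assumes "c > 0"
  shows "eterm k s d (of_real c * x) = of_real c powi (- k) * complex_of_real (1 / c\<^sup>2) powr s * eterm k s d x"
proof -
  have "complex_of_real (d / (norm (of_real c * x))\<^sup>2) = complex_of_real (1 / c\<^sup>2) * complex_of_real (d / (norm x)\<^sup>2)"
    using assms by (simp add: norm_mult power_mult_distrib)
  moreover have "(complex_of_real (1 / c\<^sup>2) * complex_of_real t) powr s = complex_of_real (1 / c\<^sup>2) powr s * complex_of_real t powr s" for t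
    by (rule powr_times_real_left) auto
  ultimately show ?thesis
    by (simp only: eterm_def power_int_mult_distrib) (simp only: mult_ac)
qed

text \<open>The determinant argument of \<open>eterm\<close> is that of the imaginary part at (p x,
  p y, z), which is symmetric in x and z.\<close>

definition EisG :: "int \<Rightarrow> int \<Rightarrow> complex \<Rightarrow> complex \<Rightarrow> complex \<Rightarrow> complex \<Rightarrow> complex" where
  "EisG p k s x y z = (\<Sum>\<^sub>\<infinity>Q\<in>isotropic p.
     eterm k s (of_int p * (Im x * Im z - of_int p * (Im y)\<^sup>2)) (Gpl p Q x y z))"

lemma EisG_swap: "EisG p k s z y x = EisG p k s x y z"
proof -
  have "Gpl p (swap5 P) x y z = Gpl p P z y x" for P
    by (cases P) (simp add: swap5_def Gpl_def algebra_simps)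
  then show ?thesis
    unfolding EisG_def
    using infsum_reindex_bij_betw[OF bij_swap5[of p],
        of "\<lambda>P. eterm k s (of_int p * (Im x * Im z - of_int p * (Im y)\<^sup>2)) (Gpl p P x y z)"]
    by (simp add: mult.commute)
qed

section \<open>Summing over the p + 1 substitutions\<close>

lemma has_sum_sum_finite:
  fixes f :: "'i \<Rightarrow> 'a \<Rightarrow> 'b::{topological_comm_monoid_add}"
  assumes "finite I" "\<And>i. i \<in> I \<Longrightarrow> (f i has_sum S i) A"
  shows "((\<lambda>x. \<Sum>i\<in>I. f i x) has_sum (\<Sum>i\<in>I. S i)) A"
  using assms by (induction I) (auto intro: has_sum_add)

text \<open>Each primitive vector of \<open>isotropic p\<close> meets exactly one of the \<open>p + 1\<close> conditions, so every one of them
  contributes \<open>1 + p\<^bsup>1-k-2s\<^esup>\<close> times its term.\<close>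

lemma Hecke_sum:
  fixes p :: nat
  assumes "prime p" and x: "Im x > 0" and z: "Im x * Im z > real p * (Im y)\<^sup>2" and ks: "2 * Re s + of_int k > 3"
  shows "of_nat p powi k * EisP k s (of_nat p * x) (of_nat p * y) z
      + (\<Sum>b<p. EisP k s ((x + of_nat b) / of_nat p) y z)
    = of_nat p powi k * (1 + of_nat p * (of_nat p powi (- k) * complex_of_real (1 / (real p)\<^sup>2) powr s)) * EisG p k s x y z"
proof -
  define D where "D = real p * (Im x * Im z - real p * (Im y)\<^sup>2)"
  \<comment> \<open>The factor p^(-k - 2 s) that a term gains when its vector is multiplied by
    p.\<close>
  define w0 where "w0 = of_nat p powi (- k) * complex_of_real (1 / (real p)\<^sup>2) powr s"
  define e where "e Q = eterm k s D (Gpl (int p) Q x y z)" for Q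
  have p0: "p > 0" using assms(1) prime_gt_0_nat by blast
  have pI: "prime (int p)" using assms(1) by simp
  have D0: "D > 0" using p0 z by (simp add: D_def)
  have scale: "eterm k s D (of_nat p * X) = w0 * eterm k s D X" for X
    using eterm_scale[of "real p" k s D X] p0 by (simp add: w0_def)
  \<comment> \<open>The determinant D / p^2 at ((x + b) / p, y, z) cancels the division of the form
    by p inside the power s, leaving just p^k. The factor p^k before the first series compensates
    for this.\<close>
  have scale': "eterm k s (D / (real p)\<^sup>2) (X / of_nat p) = of_nat p powi k * eterm k s D X" for X
    using p0 by (simp add: eterm_def norm_divide power_divide power_int_divide_distrib power_int_minus field_simps)
  let ?ci = "\<lambda>Q. if cond_inf p Q then 1 else w0" and ?cf = "\<lambda>b Q. if cond_fin p b Q then 1 else w0"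
  have i: "((\<lambda>Q. ?ci Q * e Q) has_sum EisP k s (of_nat p * x) (of_nat p * y) z) (isotropic p)"
  proof -
    have im: "Im (of_nat p * x) * Im z - (Im (of_nat p * y))\<^sup>2 = D"
      by (simp add: D_def power2_eq_square algebra_simps)
    have "(\<lambda>P. eterm k s D (Fpl P (of_nat p * x) (of_nat p * y) z)) summable_on isotropic 1"
      using eterm_summable(1)[of "of_nat p * x" z "of_nat p * y" s k] x p0 D0 ks unfolding im by simp
    then have "((\<lambda>P. eterm k s D (Fpl P (of_nat p * x) (of_nat p * y) z)) has_sum EisP k s (of_nat p * x) (of_nat p * y) z) (isotropic 1)"
      unfolding EisP_def im by (rule has_sum_infsum)
    then have "((\<lambda>Q. eterm k s D (Fpl (down_inf p Q) (of_nat p * x) (of_nat p * y) z)) has_sum EisP k s (of_nat p * x) (of_nat p * y) z) (isotropic p)"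
      by (rule iffD2[OF has_sum_reindex_bij_betw[OF bij_down_inf[OF pI],
            of "\<lambda>P. eterm k s D (Fpl P (of_nat p * x) (of_nat p * y) z)"]])
    moreover have "eterm k s D (Fpl (down_inf p Q) (of_nat p * x) (of_nat p * y) z) = ?ci Q * e Q" for Q
      using Fpl_down_inf[of "int p" Q x y z] p0 by (simp add: e_def scale)
    ultimately show ?thesis by simp
  qed
  have f: "((\<lambda>Q. of_nat p powi k * (?cf (int b) Q * e Q)) has_sum EisP k s ((x + of_nat b) / of_nat p) y z) (isotropic p)" for b
  proof -
    let ?x = "(x + of_nat b) / of_nat p"
    have im: "Im ?x * Im z - (Im y)\<^sup>2 = D / (real p)\<^sup>2"
      using p0 by (simp add: D_def power2_eq_square field_simps)
    have "(\<lambda>P. eterm k s (D / (real p)\<^sup>2) (Fpl P ?x y z)) summable_on isotropic 1"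
      using eterm_summable(1)[of ?x z y s k] x p0 D0 ks unfolding im by simp
    then have "((\<lambda>P. eterm k s (D / (real p)\<^sup>2) (Fpl P ?x y z)) has_sum EisP k s ?x y z) (isotropic 1)"
      unfolding EisP_def im by (rule has_sum_infsum)
    then have "((\<lambda>Q. eterm k s (D / (real p)\<^sup>2) (Fpl (down_fin p b Q) ?x y z)) has_sum EisP k s ?x y z) (isotropic p)"
      by (rule iffD2[OF has_sum_reindex_bij_betw[OF bij_down_fin[OF pI],
            of "\<lambda>P. eterm k s (D / (real p)\<^sup>2) (Fpl P ?x y z)"]])
    moreover have "eterm k s (D / (real p)\<^sup>2) (Fpl (down_fin p b Q) ?x y z) = of_nat p powi k * (?cf (int b) Q * e Q)" for Q
    proof -
      have "Fpl (down_fin p b Q) ?x y z = ((if cond_fin p b Q then 1 else of_nat p) * Gpl p Q x y z) / of_nat p"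
        using Fpl_down_fin[of "int p" "int b" Q x y z] p0 by simp
      then show ?thesis by (simp add: e_def scale scale')
    qed
    ultimately show ?thesis by simp
  qed
  have weights: "?ci Q + (\<Sum>b<p. ?cf (int b) Q) = 1 + of_nat p * w0" if Q: "Q \<in> isotropic p" for Q
  proof (cases "cond_inf p Q")
    case True
    then show ?thesis using cond_fin_unique(1)[OF pI Q True] by simp
  next
    case False
    obtain b0 where b0: "b0 \<in> {0..<int p}" "\<forall>b\<in>{0..<int p}. cond_fin p b Q \<longleftrightarrow> b = b0"
      using cond_fin_unique(2)[OF pI Q False] by blast
    have "(\<Sum>b<p. ?cf (int b) Q) = (\<Sum>b<p. w0 + (if b = nat b0 then 1 - w0 else 0))"
      using b0 by (intro sum.cong) auto
    also have "\<dots> = of_nat p * w0 + (1 - w0)"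
      using b0(1) by (simp add: sum.distrib) linarith
    finally show ?thesis using False by simp
  qed
  have "((\<lambda>Q. of_nat p powi k * (?ci Q * e Q) + (\<Sum>b<p. of_nat p powi k * (?cf (int b) Q * e Q))) has_sum
      (of_nat p powi k * EisP k s (of_nat p * x) (of_nat p * y) z + (\<Sum>b<p. EisP k s ((x + of_nat b) / of_nat p) y z)))
      (isotropic p)"
    by (intro has_sum_add has_sum_cmult_right i has_sum_sum_finite f) simp
  also have "?this \<longleftrightarrow> ((\<lambda>Q. of_nat p powi k * (1 + of_nat p * w0) * e Q) has_sum
      (of_nat p powi k * EisP k s (of_nat p * x) (of_nat p * y) z + (\<Sum>b<p. EisP k s ((x + of_nat b) / of_nat p) y z)))
      (isotropic p)"
  proof (rule has_sum_cong)
    fix Q assume Q: "Q \<in> isotropic p"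
    have "of_nat p powi k * (?ci Q * e Q) + (\<Sum>b<p. of_nat p powi k * (?cf (int b) Q * e Q))
        = of_nat p powi k * (?ci Q + (\<Sum>b<p. ?cf (int b) Q)) * e Q"
      by (simp only: sum_distrib_left[symmetric] sum_distrib_right[symmetric] distrib_left distrib_right mult.assoc)
    then show "of_nat p powi k * (?ci Q * e Q) + (\<Sum>b<p. of_nat p powi k * (?cf (int b) Q * e Q))
        = of_nat p powi k * (1 + of_nat p * w0) * e Q" by (simp only: weights[OF Q])
  qed
  finally have "of_nat p powi k * EisP k s (of_nat p * x) (of_nat p * y) z + (\<Sum>b<p. EisP k s ((x + of_nat b) / of_nat p) y z)
     = infsum (\<lambda>Q. of_nat p powi k * (1 + of_nat p * w0) * e Q) (isotropic p)"
    by (rule infsumI[symmetric])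
  also have "\<dots> = of_nat p powi k * (1 + of_nat p * w0) * EisG p k s x y z"
    by (simp add: infsum_cmult_right' EisG_def e_def D_def)
  finally show ?thesis by (simp only: w0_def)
qed

text \<open>\<open>Hecke_sum\<close> is applied at (x, y, z) and at (z, y, x). The right sides agree
  by \<open>EisG_swap\<close>, and \<open>EisP_swap\<close> restores the order of the
  variables.\<close>

lemma Hecke_symmetric:
  fixes p :: nat
  assumes "prime p" and x: "Im x > 0" and z: "Im x * Im z > real p * (Im y)\<^sup>2" and ks: "2 * Re s + of_int k > 3"
  shows "of_nat p powi k * EisP k s (of_nat p * x) (of_nat p * y) z
      + (\<Sum>b<p. EisP k s ((x + of_nat b) / of_nat p) y z)
    = of_nat p powi k * EisP k s x (of_nat p * y) (of_nat p * z)
      + (\<Sum>b<p. EisP k s x y ((z + of_nat b) / of_nat p))"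
proof -
  have "Im x * Im z > 0" using z by (smt (verit) mult_nonneg_nonneg of_nat_0_le_iff zero_le_power2)
  then have z0: "Im z > 0" using x by (simp add: zero_less_mult_iff)
  have z': "Im z * Im x > real p * (Im y)\<^sup>2" using z by (simp add: mult.commute)
  show ?thesis
    using trans[OF Hecke_sum[OF assms, unfolded EisG_swap[of p k s x y z]]
        Hecke_sum[OF assms(1) z0 z' ks, symmetric]]
    by (simp only: EisP_swap[of k s _ _ x])
qed

section \<open>Fourier coefficients\<close>

text \<open>Both sides are the integral of g over [0, p], once by rescaling and once cut into unit
  intervals. Dilation and contraction of Fourier series both rest on this.\<close>

lemma integral_stretch_eq_sum:
  fixes g :: "real \<Rightarrow> complex"
  assumes "continuous_on UNIV g" "p > 0"
  shows "of_nat p * integral {0..1} (\<lambda>x. g (real p * x)) = (\<Sum>b<p. integral {0..1} (\<lambda>x. g (x + real b)))"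
proof -
  have int: "g integrable_on {a..b}" for a b
    using assms(1) by (intro integrable_continuous_real continuous_on_subset[OF assms(1)]) auto
  have "(\<lambda>x. x / real p) ` {0..real p} = {0..1}"
  proof -
    have "(\<lambda>x. x / real p) ` {0..real p} = {0 / real p..real p / real p}"
      using assms(2) by (intro image_divide_atLeastAtMost) simp
    then show ?thesis using assms(2) by simp
  qed
  then have "integral {0..1} (\<lambda>x. g (real p * x)) = (1 / real p) *\<^sub>R integral {0..real p} g"
    using integral_stretch_real[of "real p" 0 "real p" g] assms(2) by simp
  moreover have "integral {0..real q} g = (\<Sum>b<q. integral {0..1} (\<lambda>x. g (x + real b)))" for q
  proof (induction q)
    case (Suc q)
    have "integral {0..real (Suc q)} g = integral {0..real q} g + integral {real q..real (Suc q)} g"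
      using Henstock_Kurzweil_Integration.integral_combine[OF _ _ int, of 0 "real q" "real (Suc q)"] by simp
    also have "integral {real q..real (Suc q)} g = integral {0..1} (\<lambda>x. g (x + real q))"
      using integral_shift_Icc_real[of 0 1 g "real q"] by (simp add: o_def add.commute)
    finally show ?case using Suc by simp
  qed simp
  ultimately show ?thesis using assms(2) by (simp add: scaleR_conv_of_real)
qed

definition e1 :: "real \<Rightarrow> complex" where
  "e1 t = exp (- (2 * complex_of_real pi * \<i> * complex_of_real t))"

lemma e1_add: "e1 (s + t) = e1 s * e1 t"
  by (simp add: e1_def exp_add[symmetric] algebra_simps)

lemma e1_int [simp]: "e1 (of_int n) = 1"
proof -
  have "e1 (of_int n) = exp (2 * of_real pi * \<i> * of_int (- n))" by (simp add: e1_def algebra_simps)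
  also have "\<dots> = 1" by (subst exp_eq_1) (auto intro!: exI[of _ "- n"])
  finally show ?thesis .
qed

lemma continuous_on_e1 [continuous_intros]:
  "continuous_on S f \<Longrightarrow> continuous_on S (\<lambda>x. e1 (f x))"
  unfolding e1_def by (intro continuous_intros)

lemma sum_e1:
  assumes "p > 0"
  shows "(\<Sum>b<p. e1 (of_int n * real b / real p)) = (if int p dvd n then of_nat p else 0)"
proof -
  have pw: "e1 (of_int n * real b / real p) = e1 (of_int n / real p) ^ b" for b
  proof (induction b)
    case (Suc b)
    have "of_int n * real (Suc b) / real p = of_int n / real p + of_int n * real b / real p"
      using assms by (simp add: field_simps)
    then show ?case by (simp only: e1_add Suc power_Suc)
  qed (use e1_int[of 0] in simp)
  show ?thesis
  proof (cases "int p dvd n")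
    case True
    then obtain m where n: "n = int p * m" by (rule dvdE)
    have "of_int n / real p = of_int m" using assms by (simp add: n)
    then have "e1 (of_int n / real p) = 1" by (simp only: e1_int)
    then show ?thesis using True by (simp add: pw)
  next
    case False
    let ?q = "e1 (of_int n / real p)"
    have "?q \<noteq> 1"
    proof
      assume "?q = 1"
      then obtain j :: int where "- (2 * pi * (of_int n / real p)) = of_int (2 * j) * pi"
        unfolding e1_def exp_eq_1 by auto
      then have "pi * (of_int n / real p) = pi * of_int (- j)" by (simp add: algebra_simps)
      then have "of_int n / real p = of_int (- j)" by (simp only: mult_cancel_left pi_neq_zero simp_thms)
      then have "real_of_int n = of_int (int p * (- j))" using assms by (simp add: field_simps)
      then have "n = int p * (- j)" by (simp only: of_int_eq_iff)
      then show False using False by simp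
    qed
    moreover have "?q ^ p = 1"
    proof -
      have "of_int n * real p / real p = of_int n" using assms by simp
      then show ?thesis using pw[of p] by simp
    qed
    ultimately show ?thesis using False by (simp add: pw geometric_sum)
  qed
qed

lemma periodic_add_nat:
  fixes \<psi> :: "real \<Rightarrow> complex"
  assumes "\<And>x. \<psi> (x + 1) = \<psi> x"
  shows "\<psi> (x + real b) = \<psi> x"
proof (induction b)
  case (Suc b)
  have "\<psi> (x + real (Suc b)) = \<psi> ((x + real b) + 1)" by (simp add: add_ac)
  then show ?case using assms Suc by simp
qed simp

text \<open>After rescaling, the integral extends over p periods, on which the integrand repeats up
  to the values \<open>e1 (n b / p)\<close>. Their sum vanishes unless p divides n.\<close>

lemma integral_dilate_periodic:
  fixes \<psi> :: "real \<Rightarrow> complex"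
  assumes c: "continuous_on UNIV \<psi>" and per: "\<And>x. \<psi> (x + 1) = \<psi> x" and p: "p > 0"
  shows "integral {0..1} (\<lambda>x. \<psi> (real p * x) * e1 (of_int n * x)) =
    (if int p dvd n then integral {0..1} (\<lambda>x. \<psi> x * e1 (of_int (n div int p) * x)) else 0)"
proof -
  define g where "g y = \<psi> y * e1 (of_int n * y / real p)" for y
  have cg: "continuous_on UNIV g" unfolding g_def using p by (intro continuous_intros c) auto
  have sh: "g (x + real b) = g x * e1 (of_int n * real b / real p)" for x b
  proof -
    have "of_int n * (x + real b) / real p = of_int n * x / real p + of_int n * real b / real p"
      using p by (simp add: field_simps)
    then show ?thesis by (simp only: g_def e1_add periodic_add_nat[of \<psi>, OF per] mult.assoc)
  qed
  have "of_nat p * integral {0..1} (\<lambda>x. \<psi> (real p * x) * e1 (of_int n * x)) = of_nat p * integral {0..1} (\<lambda>x. g (real p * x))"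
    using p by (simp add: g_def)
  also have "\<dots> = (\<Sum>b<p. integral {0..1} g * e1 (of_int n * real b / real p))"
    unfolding integral_stretch_eq_sum[OF cg p] sh by simp
  also have "\<dots> = integral {0..1} g * (if int p dvd n then of_nat p else 0)"
    by (simp only: sum_distrib_left[symmetric] sum_e1[OF p])
  finally have 1: "of_nat p * integral {0..1} (\<lambda>x. \<psi> (real p * x) * e1 (of_int n * x))
      = integral {0..1} g * (if int p dvd n then of_nat p else 0)" .
  show ?thesis
  proof (cases "int p dvd n")
    case True
    then obtain m where n: "n = int p * m" by (rule dvdE)
    have "g = (\<lambda>x. \<psi> x * e1 (of_int (n div int p) * x))" using p by (simp add: g_def n fun_eq_iff)
    then show ?thesis using 1 True p by simp
  qed (use 1 p in simp)
qed

text \<open>The p translates sweep out the interval [0, p], the character being unchanged because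
  \<open>e1 (n b) = 1\<close>. Rescaling back to [0, 1] turns the frequency n into p n.\<close>

lemma sum_integral_contract:
  fixes \<psi> :: "real \<Rightarrow> complex"
  assumes c: "continuous_on UNIV \<psi>" and p: "p > 0"
  shows "(\<Sum>b<p. integral {0..1} (\<lambda>x. \<psi> ((x + real b) / real p) * e1 (of_int n * x))) =
    of_nat p * integral {0..1} (\<lambda>x. \<psi> x * e1 (of_int (int p * n) * x))"
proof -
  define g where "g y = \<psi> (y / real p) * e1 (of_int n * y)" for y
  have cg: "continuous_on UNIV g"
    unfolding g_def using p by (intro continuous_intros continuous_on_compose2[OF c]) auto
  have "g (x + real b) = \<psi> ((x + real b) / real p) * e1 (of_int n * x)" for x b
  proof -
    have "e1 (of_int n * (x + real b)) = e1 (of_int n * x) * e1 (of_int (n * int b))"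
      unfolding e1_add[symmetric] by (simp add: algebra_simps)
    then show ?thesis unfolding g_def by (simp only: e1_int mult_1_right)
  qed
  moreover have "g (real p * x) = \<psi> x * e1 (of_int (int p * n) * x)" for x
    using p by (simp add: g_def mult_ac)
  ultimately show ?thesis using integral_stretch_eq_sum[OF cg p] by simp
qed

section \<open>Fourier coefficients of functions of three real variables\<close>

definition cont3 :: "(real \<Rightarrow> real \<Rightarrow> real \<Rightarrow> complex) \<Rightarrow> bool" where
  "cont3 \<phi> \<longleftrightarrow> continuous_on UNIV (\<lambda>(x1, x2, x3). \<phi> x1 x2 x3)"

definition cube_integral :: "(real \<Rightarrow> real \<Rightarrow> real \<Rightarrow> complex) \<Rightarrow> complex" where
  "cube_integral \<phi> = integral (cbox (0, 0, 0) (1, 1, 1)) (\<lambda>(x1, x2, x3). \<phi> x1 x2 x3)"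

lemma cont3_comp:
  assumes "cont3 \<phi>" "continuous_on S a" "continuous_on S b" "continuous_on S c"
  shows "continuous_on S (\<lambda>t. \<phi> (a t) (b t) (c t))"
  using continuous_on_compose2[OF assms(1)[unfolded cont3_def], of S "\<lambda>t. (a t, b t, c t)"] assms(2-)
  by (simp add: continuous_on_Pair)

lemma cont3_integrable:
  "cont3 \<phi> \<Longrightarrow> (\<lambda>(x1, x2, x3). \<phi> x1 x2 x3) integrable_on cbox (0, 0, 0) (1, 1, 1)"
  unfolding cont3_def by (intro integrable_continuous) (auto elim: continuous_on_subset)

lemma cube_integral_add:
  "cont3 f \<Longrightarrow> cont3 g \<Longrightarrow> cube_integral (\<lambda>x y z. f x y z + g x y z) = cube_integral f + cube_integral g"
  unfolding cube_integral_def
  using integral_add[OF cont3_integrable cont3_integrable, of f g] by (simp add: case_prod_unfold)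

lemma cube_integral_cmult: "cube_integral (\<lambda>x y z. c * f x y z) = c * cube_integral f"
  unfolding cube_integral_def using integral_mult_right[of _ c "\<lambda>(x, y, z). f x y z"]
  by (simp add: case_prod_unfold)

text \<open>The one-variable lemmas act on the innermost integral. Hence three orders of iteration:
  z innermost here, y in \<open>cube_integral_inner2\<close>, x in
  \<open>cube_integral_inner1\<close>.\<close>

lemma cube_integral_inner3:
  assumes "cont3 f"
  shows "cube_integral f = integral {0..1} (\<lambda>x. integral {0..1} (\<lambda>y. integral {0..1} (\<lambda>z. f x y z)))"
proof -
  have "cube_integral f = integral (cbox 0 1) (\<lambda>x. integral (cbox (0, 0) (1, 1)) (\<lambda>q. case (x, q) of (x, y, z) \<Rightarrow> f x y z))"
    unfolding cube_integral_def
    by (rule integral_prod_continuous) (simp add: case_prod_unfold, intro continuous_intros cont3_comp[OF assms])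
  also have "\<dots> = integral (cbox 0 1) (\<lambda>x. integral (cbox 0 1) (\<lambda>y. integral (cbox 0 1) (\<lambda>z. case (x, y, z) of (x, y, z) \<Rightarrow> f x y z)))"
    by (intro integral_cong integral_prod_continuous) (simp add: case_prod_unfold, intro continuous_intros cont3_comp[OF assms])
  finally show ?thesis by (simp add: cbox_interval)
qed

lemma cube_integral_inner2:
  assumes "cont3 f"
  shows "cube_integral f = integral {0..1} (\<lambda>x. integral {0..1} (\<lambda>z. integral {0..1} (\<lambda>y. f x y z)))"
  unfolding cube_integral_inner3[OF assms]
proof (rule integral_cong)
  fix x :: real
  have "continuous_on (cbox (0, 0) (1, 1)) (\<lambda>(y, z). f x y z)"
    by (simp add: case_prod_unfold, intro continuous_intros cont3_comp[OF assms])
  from integral_swap_continuous[OF this]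
  show "integral {0..1} (\<lambda>y. integral {0..1} (\<lambda>z. f x y z)) = integral {0..1} (\<lambda>z. integral {0..1} (\<lambda>y. f x y z))"
    by (simp add: cbox_interval)
qed

lemma cube_integral_swap:
  assumes "cont3 f"
  shows "cube_integral f = cube_integral (\<lambda>x y z. f z y x)"
proof -
  have sw: "integral {0..1} (\<lambda>x. integral {0..1} (\<lambda>y. h x y)) = integral {0..1} (\<lambda>y. integral {0..1} (\<lambda>x. h x y))"
    if "continuous_on UNIV (\<lambda>(x, y). h x y)" for h :: "real \<Rightarrow> real \<Rightarrow> complex"
    using integral_swap_continuous[of 0 0 1 1 h] continuous_on_subset[OF that] by (simp add: cbox_interval)
  have c': "cont3 (\<lambda>x y z. f y x z)" "cont3 (\<lambda>x y z. f z y x)"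
    unfolding cont3_def by (simp add: case_prod_unfold, intro continuous_intros cont3_comp[OF assms])+
  have "cube_integral f = integral (cbox (0, 0, 0) (1, 1, 1)) (\<lambda>(x, q). case q of (y, z) \<Rightarrow> f x y z)"
    by (simp add: cube_integral_def)
  also have "\<dots> = integral (cbox 0 1) (\<lambda>x. integral (cbox (0, 0) (1, 1)) (\<lambda>q. case q of (y, z) \<Rightarrow> f x y z))"
    using integral_prod_continuous[of 0 "(0, 0)" 1 "(1, 1)" "\<lambda>(x, q). case q of (y, z) \<Rightarrow> f x y z"]
      continuous_on_subset[OF assms[unfolded cont3_def]] by simp
  also have "\<dots> = integral (cbox (0, 0) (1, 1)) (\<lambda>q. integral (cbox 0 1) (\<lambda>x. case q of (y, z) \<Rightarrow> f x y z))"
    using continuous_on_subset[OF assms[unfolded cont3_def]] by (intro integral_swap_continuous) auto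
  also have "\<dots> = integral (cbox 0 1) (\<lambda>y. integral (cbox 0 1) (\<lambda>z. integral (cbox 0 1) (\<lambda>x. f x y z)))"
  proof -
    have "continuous_on UNIV (\<lambda>q. integral (cbox 0 1) (\<lambda>x. case q of (y, z) \<Rightarrow> f x y z))"
      by (rule integral_continuous_on_param) (simp add: case_prod_unfold, intro continuous_intros cont3_comp[OF assms])
    from integral_prod_continuous[OF continuous_on_subset[OF this]] show ?thesis by simp
  qed
  also have "\<dots> = integral (cbox 0 1) (\<lambda>z. integral (cbox 0 1) (\<lambda>y. integral (cbox 0 1) (\<lambda>x. f x y z)))"
  proof -
    have "continuous_on UNIV (\<lambda>q. integral (cbox 0 1) (\<lambda>x. case q of (y, z) \<Rightarrow> f x y z))"
      by (rule integral_continuous_on_param) (simp add: case_prod_unfold, intro continuous_intros cont3_comp[OF assms])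
    then show ?thesis
      by (intro integral_swap_continuous) (auto simp: case_prod_unfold elim: continuous_on_subset)
  qed
  also have "\<dots> = cube_integral (\<lambda>x y z. f z y x)"
    unfolding cube_integral_inner3[OF c'(2)] by (simp add: cbox_interval)
  finally show ?thesis .
qed

lemma cube_integral_inner1:
  assumes "cont3 f"
  shows "cube_integral f = integral {0..1} (\<lambda>z. integral {0..1} (\<lambda>y. integral {0..1} (\<lambda>x. f x y z)))"
proof -
  have "cont3 (\<lambda>x y z. f z y x)"
    unfolding cont3_def by (simp add: case_prod_unfold, intro continuous_intros cont3_comp[OF assms])
  then show ?thesis by (simp only: cube_integral_swap[OF assms] cube_integral_inner3)
qed

definition fcoeff :: "(real \<Rightarrow> real \<Rightarrow> real \<Rightarrow> complex) \<Rightarrow> int \<Rightarrow> int \<Rightarrow> int \<Rightarrow> complex" where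
  "fcoeff \<phi> n r m = cube_integral (\<lambda>x y z. \<phi> x y z * (e1 (of_int n * x) * e1 (of_int r * y) * e1 (of_int m * z)))"

lemma cont3I: "continuous_on UNIV (\<lambda>q. f (fst q) (fst (snd q)) (snd (snd q))) \<Longrightarrow> cont3 f"
  by (simp add: cont3_def case_prod_unfold)

lemma cont3_char:
  assumes "cont3 \<phi>"
  shows "cont3 (\<lambda>x y z. \<phi> x y z * (e1 (of_int n * x) * e1 (of_int r * y) * e1 (of_int m * z)))"
  by (rule cont3I, intro continuous_intros cont3_comp[OF assms])

lemma fcoeff_add: "cont3 f \<Longrightarrow> cont3 g \<Longrightarrow> fcoeff (\<lambda>x y z. f x y z + g x y z) n r m = fcoeff f n r m + fcoeff g n r m"
  unfolding fcoeff_def distrib_right by (intro cube_integral_add cont3_char)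

lemma fcoeff_cmult: "fcoeff (\<lambda>x y z. c * f x y z) n r m = c * fcoeff f n r m"
  unfolding fcoeff_def mult.assoc by (rule cube_integral_cmult)

text \<open>Reduces operations on z to operations on x.\<close>

lemma fcoeff_swap:
  assumes "cont3 \<phi>"
  shows "fcoeff (\<lambda>x y z. \<phi> z y x) m r n = fcoeff \<phi> n r m"
proof -
  have "cont3 (\<lambda>x y z. \<phi> z y x)" by (rule cont3I, intro continuous_intros cont3_comp[OF assms])
  from cube_integral_swap[OF cont3_char[OF this]] show ?thesis
    by (simp add: fcoeff_def mult_ac)
qed

lemma cont3_dilate1: "cont3 \<phi> \<Longrightarrow> cont3 (\<lambda>x y z. \<phi> (c * x) y z)"
  by (rule cont3I, rule cont3_comp) (auto intro!: continuous_intros)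

lemma cont3_dilate2: "cont3 \<phi> \<Longrightarrow> cont3 (\<lambda>x y z. \<phi> x (c * y) z)"
  by (rule cont3I, rule cont3_comp) (auto intro!: continuous_intros)

lemma fcoeff_dilate1:
  assumes c: "cont3 \<phi>" and per: "\<And>x y z. \<phi> (x + 1) y z = \<phi> x y z" and p: "p > 0"
  shows "fcoeff (\<lambda>x y z. \<phi> (real p * x) y z) n r m = (if int p dvd n then fcoeff \<phi> (n div int p) r m else 0)"
proof -
  have cx: "continuous_on UNIV (\<lambda>x. \<phi> x y z)" for y z by (intro cont3_comp[OF c] continuous_intros)
  have "fcoeff (\<lambda>x y z. \<phi> (real p * x) y z) n r m = integral {0..1} (\<lambda>z. integral {0..1} (\<lambda>y.
      integral {0..1} (\<lambda>x. (\<phi> (real p * x) y z * e1 (of_int n * x)) * (e1 (of_int r * y) * e1 (of_int m * z)))))"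
    unfolding fcoeff_def by (subst cube_integral_inner1[OF cont3_char[OF cont3_dilate1[OF c]]]) (simp only: mult.assoc)
  also have "\<dots> = (if int p dvd n then integral {0..1} (\<lambda>z. integral {0..1} (\<lambda>y.
      integral {0..1} (\<lambda>x. (\<phi> x y z * e1 (of_int (n div int p) * x)) * (e1 (of_int r * y) * e1 (of_int m * z))))) else 0)"
    unfolding integral_mult_left by (simp only: integral_dilate_periodic[OF cx per p]) simp
  also have "integral {0..1} (\<lambda>z. integral {0..1} (\<lambda>y.
      integral {0..1} (\<lambda>x. (\<phi> x y z * e1 (of_int (n div int p) * x)) * (e1 (of_int r * y) * e1 (of_int m * z)))))
      = fcoeff \<phi> (n div int p) r m"
    unfolding fcoeff_def by (subst cube_integral_inner1[OF cont3_char[OF c]]) (simp only: mult.assoc)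
  finally show ?thesis .
qed

lemma fcoeff_dilate2:
  assumes c: "cont3 \<phi>" and per: "\<And>x y z. \<phi> x (y + 1) z = \<phi> x y z" and p: "p > 0"
  shows "fcoeff (\<lambda>x y z. \<phi> x (real p * y) z) n r m = (if int p dvd r then fcoeff \<phi> n (r div int p) m else 0)"
proof -
  have cy: "continuous_on UNIV (\<lambda>y. \<phi> x y z)" for x z by (intro cont3_comp[OF c] continuous_intros)
  have com: "a * (b * d * e) = (a * d) * (b * e)" for a b d e :: complex by simp
  have "fcoeff (\<lambda>x y z. \<phi> x (real p * y) z) n r m = integral {0..1} (\<lambda>x. integral {0..1} (\<lambda>z.
      integral {0..1} (\<lambda>y. (\<phi> x (real p * y) z * e1 (of_int r * y)) * (e1 (of_int n * x) * e1 (of_int m * z)))))"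
    unfolding fcoeff_def by (subst cube_integral_inner2[OF cont3_char[OF cont3_dilate2[OF c]]]) (simp only: com)
  also have "\<dots> = (if int p dvd r then integral {0..1} (\<lambda>x. integral {0..1} (\<lambda>z.
      integral {0..1} (\<lambda>y. (\<phi> x y z * e1 (of_int (r div int p) * y)) * (e1 (of_int n * x) * e1 (of_int m * z))))) else 0)"
    unfolding integral_mult_left by (simp only: integral_dilate_periodic[OF cy per p]) simp
  also have "integral {0..1} (\<lambda>x. integral {0..1} (\<lambda>z.
      integral {0..1} (\<lambda>y. (\<phi> x y z * e1 (of_int (r div int p) * y)) * (e1 (of_int n * x) * e1 (of_int m * z)))))
      = fcoeff \<phi> n (r div int p) m"
    unfolding fcoeff_def by (subst cube_integral_inner2[OF cont3_char[OF c]]) (simp only: com)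
  finally show ?thesis .
qed

lemma fcoeff_contract1:
  assumes c: "cont3 \<phi>" and p: "p > 0"
  shows "fcoeff (\<lambda>x y z. \<Sum>b<p. \<phi> ((x + real b) / real p) y z) n r m = of_nat p * fcoeff \<phi> (int p * n) r m"
proof -
  have cx: "continuous_on UNIV (\<lambda>x. \<phi> x y z)" for y z by (intro cont3_comp[OF c] continuous_intros)
  have c': "cont3 (\<lambda>x y z. \<Sum>b<p. \<phi> ((x + real b) / real p) y z)"
    using p by (intro cont3I) (intro continuous_intros cont3_comp[OF c]; simp)
  have int: "(\<lambda>x. \<phi> ((x + real b) / real p) y z * e1 (of_int n * x)) integrable_on {0..1}" for b y z
    using p by (intro integrable_continuous_real) (intro continuous_intros cont3_comp[OF c]; simp)
  have "integral {0..1} (\<lambda>x. \<Sum>b<p. \<phi> ((x + real b) / real p) y z * e1 (of_int n * x))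
      = of_nat p * integral {0..1} (\<lambda>x. \<phi> x y z * e1 (of_int (int p * n) * x))" for y z
    using integral_sum[of "{..<p}" "\<lambda>b x. \<phi> ((x + real b) / real p) y z * e1 (of_int n * x)" "{0..1}"] int
      sum_integral_contract[OF cx p] by simp
  then have inner: "integral {0..1} (\<lambda>x. (\<Sum>b<p. \<phi> ((x + real b) / real p) y z) * e1 (of_int n * x))
      = of_nat p * integral {0..1} (\<lambda>x. \<phi> x y z * e1 (of_int (int p * n) * x))" for y z
    by (simp only: sum_distrib_right)
  have "fcoeff (\<lambda>x y z. \<Sum>b<p. \<phi> ((x + real b) / real p) y z) n r m = integral {0..1} (\<lambda>z. integral {0..1} (\<lambda>y.
      integral {0..1} (\<lambda>x. ((\<Sum>b<p. \<phi> ((x + real b) / real p) y z) * e1 (of_int n * x)) * (e1 (of_int r * y) * e1 (of_int m * z)))))"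
    unfolding fcoeff_def by (subst cube_integral_inner1[OF cont3_char[OF c']]) (simp only: mult.assoc)
  also have "\<dots> = of_nat p * integral {0..1} (\<lambda>z. integral {0..1} (\<lambda>y.
      integral {0..1} (\<lambda>x. (\<phi> x y z * e1 (of_int (int p * n) * x)) * (e1 (of_int r * y) * e1 (of_int m * z)))))"
    unfolding integral_mult_left inner by (simp only: mult.assoc integral_mult_right)
  also have "integral {0..1} (\<lambda>z. integral {0..1} (\<lambda>y.
      integral {0..1} (\<lambda>x. (\<phi> x y z * e1 (of_int (int p * n) * x)) * (e1 (of_int r * y) * e1 (of_int m * z)))))
      = fcoeff \<phi> (int p * n) r m"
    unfolding fcoeff_def by (subst cube_integral_inner1[OF cont3_char[OF c]]) (simp only: mult.assoc)
  finally show ?thesis .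
qed

section \<open>Coefficients of the Eisenstein series\<close>

definition EisR :: "int \<Rightarrow> complex \<Rightarrow> real \<Rightarrow> real \<Rightarrow> real \<Rightarrow> real \<Rightarrow> real \<Rightarrow> real \<Rightarrow> complex" where
  "EisR k s y1 y2 y3 x1 x2 x3 = EisP k s (Complex x1 y1) (Complex x2 y2) (Complex x3 y3)"

lemma EisR_periodic:
  "EisR k s y1 y2 y3 (x1 + 1) x2 x3 = EisR k s y1 y2 y3 x1 x2 x3"
  "EisR k s y1 y2 y3 x1 (x2 + 1) x3 = EisR k s y1 y2 y3 x1 x2 x3"
proof -
  have C: "Complex (x + 1) y = Complex x y + of_int 1" for x y by (simp add: complex_eq_iff)
  show "EisR k s y1 y2 y3 (x1 + 1) x2 x3 = EisR k s y1 y2 y3 x1 x2 x3"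
    using EisP_periodic[of k s "Complex x1 y1" 1 "Complex x2 y2" 0 "Complex x3 y3" 0] by (simp add: EisR_def C)
  show "EisR k s y1 y2 y3 x1 (x2 + 1) x3 = EisR k s y1 y2 y3 x1 x2 x3"
    using EisP_periodic[of k s "Complex x1 y1" 0 "Complex x2 y2" 1 "Complex x3 y3" 0] by (simp add: EisR_def C)
qed

lemma EisR_swap: "EisR k s y3 y2 y1 x3 x2 x1 = EisR k s y1 y2 y3 x1 x2 x3"
  unfolding EisR_def by (rule EisP_swap)

lemma cont3_EisR:
  assumes "y1 > 0" "y1 * y3 > y2\<^sup>2" "2 * Re s + of_int k > 3"
  shows "cont3 (EisR k s y1 y2 y3)"
  using continuous_EisP[of y1 y3 y2 s k] assms
  by (simp add: cont3_def EisR_def case_prod_unfold)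

lemma Eis2_coeff_eq_fcoeff:
  assumes "even k" "y1 > 0" "y1 * y3 > y2\<^sup>2" "2 * Re s + of_int k > 3"
  shows "2 * Eis2_coeff k s (sym2 (of_int n) (of_int r / 2) (of_int m)) (sym2 y1 y2 y3)
    = fcoeff (EisR k s y1 y2 y3) n r m"
proof -
  let ?N = "sym2 (of_int n) (of_int r / 2) (of_int m) :: real^2^2"
  have "half_integral ?N" by (auto simp: half_integral_def)
  have pt: "siegel_point (sym2 x1 x2 x3) (sym2 y1 y2 y3) = sym2 (Complex x1 y1) (Complex x2 y2) (Complex x3 y3)" for x1 x2 x3
    by (simp add: siegel_point_def vec_eq_iff forall_2)
  \<comment> \<open>The entry r / 2 occurs twice in the trace, so the frequency in x2 is the integer
    r.\<close>
  have tr: "trace (?N ** sym2 x1 x2 x3) = of_int n * x1 + of_int r * x2 + of_int m * x3" for x1 x2 x3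
    by (simp add: trace_def matrix_matrix_mult_def sum_2)
  have E: "Eis2 k s (sym2 (Complex x1 y1) (Complex x2 y2) (Complex x3 y3)) = 1 / 2 * EisR k s y1 y2 y3 x1 x2 x3" for x1 x2 x3
    unfolding EisR_def using Eis2_eq_EisP[OF assms(1), of "Complex x1 y1" "Complex x2 y2" "Complex x3 y3" s]
      eterm_summable[of "Complex x1 y1" "Complex x3 y3" "Complex x2 y2" s k] assms
    by (simp add: mult.commute)
  have "Eis2_coeff k s ?N (sym2 y1 y2 y3) = cube_integral (\<lambda>x1 x2 x3. 1 / 2 * (EisR k s y1 y2 y3 x1 x2 x3
      * (e1 (of_int n * x1) * e1 (of_int r * x2) * e1 (of_int m * x3))))"
    unfolding Eis2_coeff_def Let_def cube_integral_def pt tr E e1_add[symmetric] using \<open>half_integral ?N\<close>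
    by (simp add: e1_def)
  then show ?thesis by (simp only: cube_integral_cmult fcoeff_def) simp
qed

lemma Eis2_coeff_eq_0: "\<not> half_integral N \<Longrightarrow> Eis2_coeff k s N Y = 0"
  by (simp add: Eis2_coeff_def)

lemma half_integral_div:
  assumes "p > 0"
  shows "half_integral (sym2 (of_int n / real p) (of_int r / (2 * real p)) (of_int m)) \<longleftrightarrow> int p dvd n \<and> int p dvd r"
    and "half_integral (sym2 (of_int m) (of_int r / (2 * real p)) (of_int n / real p)) \<longleftrightarrow> int p dvd n \<and> int p dvd r"
proof -
  have eq: "of_int a = real_of_int b / real p \<longleftrightarrow> b = int p * a" for a b
  proof -
    have "of_int a = real_of_int b / real p \<longleftrightarrow> real_of_int b = real_of_int (int p * a)"
      using assms by (auto simp: eq_divide_eq mult.commute)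
    then show ?thesis by (simp only: of_int_eq_iff)
  qed
  have inj: "sym2 a b c = sym2 a' b' c' \<longleftrightarrow> a = a' \<and> b = b' \<and> c = c'" for a b c a' b' c' :: real
    by (auto simp: vec_eq_iff forall_2)
  have half: "of_int a / 2 = of_int b / (2 * real p) \<longleftrightarrow> of_int a = real_of_int b / real p" for a b
    by simp
  show "half_integral (sym2 (of_int n / real p) (of_int r / (2 * real p)) (of_int m)) \<longleftrightarrow> int p dvd n \<and> int p dvd r"
    "half_integral (sym2 (of_int m) (of_int r / (2 * real p)) (of_int n / real p)) \<longleftrightarrow> int p dvd n \<and> int p dvd r"
    unfolding half_integral_def inj eq_commute[of "_ / real p"] eq_commute[of "_ / (2 * real p)"] half eq
    by (auto simp: dvd_def)
qed

lemma fcoeff_dilate12: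
  assumes c: "cont3 \<phi>" and p: "p > 0"
    and per: "\<And>x y z. \<phi> (x + 1) y z = \<phi> x y z" "\<And>x y z. \<phi> x (y + 1) z = \<phi> x y z"
  shows "fcoeff (\<lambda>x y z. \<phi> (real p * x) (real p * y) z) n r m =
    (if int p dvd n \<and> int p dvd r then fcoeff \<phi> (n div int p) (r div int p) m else 0)"
proof -
  have "fcoeff (\<lambda>x y z. \<phi> (real p * x) (real p * y) z) n r m
      = (if int p dvd n then fcoeff (\<lambda>x y z. \<phi> x (real p * y) z) (n div int p) r m else 0)"
    by (rule fcoeff_dilate1[OF cont3_dilate2[OF c] _ p]) (rule per(1))
  then show ?thesis by (simp add: fcoeff_dilate2[OF c per(2) p])
qed

text \<open>The convention A(N) = 0 for N not half-integral matches the dilated function, whose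
  coefficients vanish unless p divides both n and r.\<close>

lemma coeff_dilated:
  assumes "even k" "y1 > 0" "y1 * y3 > y2\<^sup>2" "2 * Re s + of_int k > 3" and p: "p > 0"
  shows "fcoeff (\<lambda>x1 x2 x3. EisR k s y1 y2 y3 (real p * x1) (real p * x2) x3) n r m
    = 2 * Eis2_coeff k s (sym2 (of_int n / real p) (of_int r / (2 * real p)) (of_int m)) (sym2 y1 y2 y3)"
proof -
  note c = cont3_EisR[OF assms(2-4)]
  note * = fcoeff_dilate12[OF c p, OF EisR_periodic, of n r m]
  show ?thesis
  proof (cases "int p dvd n \<and> int p dvd r")
    case True
    then obtain n' r' where nr: "n = int p * n'" "r = int p * r'" by (meson dvdE)
    have "sym2 (of_int n / real p) (of_int r / (2 * real p)) (of_int m) = (sym2 (of_int n') (of_int r' / 2) (of_int m) :: real^2^2)"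
      using p by (simp add: nr)
    then show ?thesis
      unfolding * using Eis2_coeff_eq_fcoeff[OF assms(1-4), of n' r' m] p by (simp add: nr)
  next
    case False
    have "Eis2_coeff k s (sym2 (of_int n / real p) (of_int r / (2 * real p)) (of_int m)) (sym2 y1 y2 y3) = 0"
      using False by (intro Eis2_coeff_eq_0) (simp only: half_integral_div[OF p] simp_thms)
    then show ?thesis unfolding * if_not_P[OF False] by simp
  qed
qed

lemma sym2_scaled:
  "p *\<^sub>R sym2 y1 y2 y3 = sym2 (p * y1) (p * y2) (p * y3)" for p :: real
  by (simp add: vec_eq_iff forall_2)

lemma gbracket_diag:
  "gbracket (sym2 y1 y2 y3) (sym2 a 0 b) = sym2 (a\<^sup>2 * y1) (a * b * y2) (b\<^sup>2 * y3)"
  by (simp add: vec_eq_iff forall_2 gbracket_def matrix_matrix_mult_def sum_2 transpose_def power2_eq_square)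

lemma pos_def_symE:
  assumes "pos_def_sym Y"
  obtains y1 y2 y3 where "Y = sym2 y1 y2 y3" "y1 > 0" "y1 * y3 > y2\<^sup>2"
proof -
  have "transpose Y $ 2 $ 1 = Y $ 2 $ 1" using assms by (simp add: pos_def_sym_def)
  then have t: "Y $ 1 $ 2 = Y $ 2 $ 1" by (simp add: transpose_def)
  define y1 y2 y3 where "y1 = Y $ 1 $ 1" and "y2 = Y $ 1 $ 2" and "y3 = Y $ 2 $ 2"
  have Y: "Y = sym2 y1 y2 y3" by (simp add: vec_eq_iff forall_2 y1_def y2_def y3_def t)
  have q: "a * (y1 * a + y2 * b) + b * (y2 * a + y3 * b) > 0" if "a \<noteq> 0 \<or> b \<noteq> 0" for a b
  proof -
    have "vector [a, b] \<noteq> (0 :: real^2)" using that by (auto simp: vec_eq_iff forall_2)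
    then have "vector [a, b] \<bullet> (Y *v vector [a, b]) > 0" using assms by (simp add: pos_def_sym_def)
    then show ?thesis by (simp add: Y inner_vec_def sum_2 matrix_vector_mult_def)
  qed
  have y1: "y1 > 0" using q[of 1 0] by simp
  \<comment> \<open>At the vector (-y2, y1) the quadratic form equals y1 times the
    determinant.\<close>
  have "(- y2) * (y1 * (- y2) + y2 * y1) + y1 * (y2 * (- y2) + y3 * y1) > 0" using q[of "- y2" y1] y1 by simp
  then have "y1 * (y1 * y3 - y2\<^sup>2) > 0" by (simp add: power2_eq_square algebra_simps)
  then have "y1 * y3 > y2\<^sup>2" using y1 by (simp add: zero_less_mult_iff)
  with Y y1 show ?thesis by (rule that)
qed

lemma coeff_identity:
  assumes k: "even k" "2 * Re s + of_int k > 3" and p: "prime p" and y: "y1 > 0" "y1 * y3 > y2\<^sup>2"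
  defines "A \<equiv> Eis2_coeff k s"
  shows "of_nat p powi k * A (sym2 (of_int n / real p) (of_int r / (2 * real p)) (of_int m)) (sym2 (p * y1) (p * y2) (p * y3))
      + of_nat p * A (sym2 (of_int (int p * n)) (of_int r / 2) (of_int m)) (sym2 (y1 / p) y2 (p * y3))
    = of_nat p powi k * A (sym2 (of_int n) (of_int r / (2 * real p)) (of_int m / real p)) (sym2 y1 (p * y2) ((real p)\<^sup>2 * y3))
      + of_nat p * A (sym2 (of_int n) (of_int r / 2) (of_int (int p * m))) (sym2 y1 y2 y3)"
proof -
  have p0: "p > 0" using p prime_gt_0_nat by blast
  have "y1 * y3 > 0" using y(2) zero_le_power2[of y2] by linarith
  then have y3: "y3 > 0" using y(1) by (simp add: zero_less_mult_iff)
  let ?E = "EisR k s"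
  have pos1: "real p * y1 > 0" "real p * y1 * (real p * y3) > (real p * y2)\<^sup>2"
    using y p0 by (simp_all add: power_mult_distrib power2_eq_square[of "real p"] mult.assoc mult.left_commute[of y1])
  have pos2: "y1 / p > 0" "y1 / p * (p * y3) > y2\<^sup>2"
    using y p0 by simp_all
  have pos3: "(real p)\<^sup>2 * y3 > 0" "(real p)\<^sup>2 * y3 * y1 > (real p * y2)\<^sup>2"
    using y y3 p0 by (simp_all add: power_mult_distrib mult.assoc mult.commute[of y3])
  have pos3': "y1 * ((real p)\<^sup>2 * y3) > (real p * y2)\<^sup>2" using pos3(2) by (simp add: mult_ac)
  have pos4: "y3 * y1 > y2\<^sup>2" using y by (simp add: mult.commute)
  note c1 = cont3_EisR[OF pos1 k(2)] and c2 = cont3_EisR[OF pos2 k(2)] and c3 = cont3_EisR[OF y(1) pos3' k(2)]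
    and c4 = cont3_EisR[OF y k(2)]
  note d3 = cont3_EisR[OF pos3 k(2)] and d4 = cont3_EisR[OF y3 pos4 k(2)]
  let ?L1 = "\<lambda>x1 x2 x3. ?E (p * y1) (p * y2) (p * y3) (real p * x1) (real p * x2) x3"
  let ?L2 = "\<lambda>x1 x2 x3. \<Sum>b<p. ?E (y1 / p) y2 (p * y3) ((x1 + real b) / real p) x2 x3"
  let ?R1 = "\<lambda>x1 x2 x3. ?E y1 (p * y2) ((real p)\<^sup>2 * y3) x1 (real p * x2) (real p * x3)"
  let ?R2 = "\<lambda>x1 x2 x3. \<Sum>b<p. ?E y1 y2 y3 x1 x2 ((x3 + real b) / real p)"
  have H: "of_nat p powi k * ?L1 x1 x2 x3 + ?L2 x1 x2 x3 = of_nat p powi k * ?R1 x1 x2 x3 + ?R2 x1 x2 x3" for x1 x2 x3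
  proof -
    have C: "of_nat p * Complex a b = Complex (real p * a) (real p * b)" for a b by (simp add: complex_eq_iff)
    have D: "(Complex a b + of_nat j) / of_nat p = Complex ((a + real j) / real p) (b / real p)" for a b j
      using p0 by (simp add: complex_eq_iff)
    have "y1 * (real p * y3) > real p * y2\<^sup>2" using y p0 by (simp add: mult.left_commute[of y1])
    then show ?thesis
      using Hecke_symmetric[OF p, where x = "Complex x1 y1" and y = "Complex x2 y2" and z = "Complex x3 (p * y3)"
          and s = s and k = k] y k p0
      by (simp add: C D EisR_def power2_eq_square mult.assoc)
  qed
  have cL1: "cont3 (\<lambda>x y z. c * ?L1 x y z)" and cL2: "cont3 ?L2" and cR1: "cont3 (\<lambda>x y z. c * ?R1 x y z)" and cR2: "cont3 ?R2" for c
    using p0 by - (rule cont3I,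
        intro continuous_intros cont3_comp[OF c1] cont3_comp[OF c2] cont3_comp[OF c3] cont3_comp[OF c4]; simp)+
  \<comment> \<open>The terms rescaled in z are reflected by \<open>fcoeff_swap\<close> and
    \<open>EisR_swap\<close>, handled by the lemmas for x and y, and reflected back.\<close>
  have R1: "fcoeff ?R1 n r m = 2 * A (sym2 (of_int n) (of_int r / (2 * real p)) (of_int m / real p)) (sym2 y1 (p * y2) ((real p)\<^sup>2 * y3))"
  proof -
    have "fcoeff ?R1 n r m = fcoeff (\<lambda>x y z. ?R1 z y x) m r n"
      by (rule fcoeff_swap[symmetric]) (rule cont3I, intro continuous_intros cont3_comp[OF c3])
    also have "\<dots> = fcoeff (\<lambda>x1 x2 x3. ?E ((real p)\<^sup>2 * y3) (p * y2) y1 (real p * x1) (real p * x2) x3) m r n"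
      by (simp only: EisR_swap[of k s y1])
    also have "\<dots> = (if int p dvd m \<and> int p dvd r then fcoeff (?E ((real p)\<^sup>2 * y3) (p * y2) y1) (m div int p) (r div int p) n else 0)"
      by (rule fcoeff_dilate12) (use d3 p0 EisR_periodic in \<open>auto simp: mult_ac\<close>)
    also have "\<dots> = 2 * A (sym2 (of_int n) (of_int r / (2 * real p)) (of_int m / real p)) (sym2 y1 (p * y2) ((real p)\<^sup>2 * y3))"
    proof (cases "int p dvd m \<and> int p dvd r")
      case True
      then obtain m' r' where mr: "m = int p * m'" "r = int p * r'" by (meson dvdE)
      have "sym2 (of_int n) (of_int r / (2 * real p)) (of_int m / real p) = (sym2 (of_int n) (of_int r' / 2) (of_int m') :: real^2^2)"
        using p0 by (simp add: mr)
      moreover have "fcoeff (?E ((real p)\<^sup>2 * y3) (p * y2) y1) m' r' n = fcoeff (?E y1 (p * y2) ((real p)\<^sup>2 * y3)) n r' m'"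
        using fcoeff_swap[OF c3, of m' r' n] by (simp only: EisR_swap[of k s y1])
      ultimately show ?thesis
        using Eis2_coeff_eq_fcoeff[OF k(1) y(1) pos3' k(2), of n r' m'] p0 by (simp add: mr A_def)
    next
      case False
      have "A (sym2 (of_int n) (of_int r / (2 * real p)) (of_int m / real p)) (sym2 y1 (p * y2) ((real p)\<^sup>2 * y3)) = 0"
        unfolding A_def using False by (intro Eis2_coeff_eq_0) (simp only: half_integral_div[OF p0] simp_thms)
      then show ?thesis unfolding if_not_P[OF False] by simp
    qed
    finally show ?thesis .
  qed
  have R2: "fcoeff ?R2 n r m = 2 * (of_nat p * A (sym2 (of_int n) (of_int r / 2) (of_int (int p * m))) (sym2 y1 y2 y3))"
  proof -
    have "fcoeff ?R2 n r m = fcoeff (\<lambda>x y z. ?R2 z y x) m r n"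
      by (rule fcoeff_swap[symmetric]) (rule cR2)
    also have "\<dots> = fcoeff (\<lambda>x1 x2 x3. \<Sum>b<p. ?E y3 y2 y1 ((x1 + real b) / real p) x2 x3) m r n"
      by (simp only: EisR_swap[of k s y1])
    also have "\<dots> = of_nat p * fcoeff (?E y3 y2 y1) (int p * m) r n"
      by (rule fcoeff_contract1[OF d4 p0])
    also have "fcoeff (?E y3 y2 y1) (int p * m) r n = fcoeff (?E y1 y2 y3) n r (int p * m)"
      using fcoeff_swap[OF c4, of "int p * m" r n] by (simp only: EisR_swap[of k s y1])
    finally show ?thesis
      using Eis2_coeff_eq_fcoeff[OF k(1) y k(2), of n r "int p * m"] by (simp add: A_def)
  qed
  have L1: "fcoeff ?L1 n r m = 2 * A (sym2 (of_int n / real p) (of_int r / (2 * real p)) (of_int m)) (sym2 (p * y1) (p * y2) (p * y3))"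
    unfolding A_def by (rule coeff_dilated[OF k(1) pos1 k(2) p0])
  have L2: "fcoeff ?L2 n r m = 2 * (of_nat p * A (sym2 (of_int (int p * n)) (of_int r / 2) (of_int m)) (sym2 (y1 / p) y2 (p * y3)))"
    unfolding fcoeff_contract1[OF c2 p0] A_def
    using Eis2_coeff_eq_fcoeff[OF k(1) pos2 k(2), of "int p * n" r m] by simp
  have "of_nat p powi k * fcoeff ?L1 n r m + fcoeff ?L2 n r m = fcoeff (\<lambda>x1 x2 x3. of_nat p powi k * ?L1 x1 x2 x3 + ?L2 x1 x2 x3) n r m"
    by (simp only: fcoeff_add[OF cL1 cL2] fcoeff_cmult)
  also have "\<dots> = of_nat p powi k * fcoeff ?R1 n r m + fcoeff ?R2 n r m"
    by (simp only: H fcoeff_add[OF cR1 cR2] fcoeff_cmult)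
  finally have "of_nat p powi k * fcoeff ?L1 n r m + fcoeff ?L2 n r m = of_nat p powi k * fcoeff ?R1 n r m + fcoeff ?R2 n r m" .
  moreover have "c * a + b = c * a' + b'" if "c * (2 * a) + 2 * b = c * (2 * a') + 2 * b'" for a b c a' b' :: complex
  proof -
    have "2 * (c * a + b) = 2 * (c * a' + b')" using that by (simp add: algebra_simps)
    then show ?thesis by (simp only: mult_cancel_left) simp
  qed
  ultimately show ?thesis unfolding L1 L2 R1 R2 by blast
qed

theorem mainTheorem1:
  fixes k :: int and s :: complex and p :: nat and n r m :: int and Y :: "real^2^2"
  assumes "even k"
    and "2 * Re s + of_int k > 3"
    and "prime p"
    and "pos_def_sym Y"
  shows
    "of_nat p powi (k - 1) *
       Eis2_coeff k s (sym2 (of_int n / of_nat p) (of_int r / (2 * of_nat p)) (of_int m)) (real p *\<^sub>R Y)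
     - Eis2_coeff k s (sym2 (of_int n) (of_int r / 2) (of_nat p * of_int m)) Y
     = of_nat p powi (k - 1) *
       Eis2_coeff k s (sym2 (of_int n) (of_int r / (2 * of_nat p)) (of_int m / of_nat p))
         (gbracket Y (sym2 1 0 (real p)))
     - Eis2_coeff k s (sym2 (of_nat p * of_int n) (of_int r / 2) (of_int m))
         (gbracket Y (sym2 (real p powr (- 1 / 2)) 0 (real p powr (1 / 2))))"
proof -
  have p0: "p > 0" using assms(3) prime_gt_0_nat by blast
  obtain y1 y2 y3 where Y: "Y = sym2 y1 y2 y3" and y: "y1 > 0" "y1 * y3 > y2\<^sup>2"
    using pos_def_symE[OF assms(4)] .
  have h: "(real p powr (- 1 / 2))\<^sup>2 = 1 / real p" "(real p powr (1 / 2))\<^sup>2 = real p"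
      "real p powr (- 1 / 2) * real p powr (1 / 2) = 1"
    using p0 by (simp_all add: power2_eq_square powr_add[symmetric] powr_minus_divide)
  have g: "gbracket Y (sym2 1 0 (real p)) = sym2 y1 (p * y2) ((real p)\<^sup>2 * y3)"
    "gbracket Y (sym2 (real p powr (- 1 / 2)) 0 (real p powr (1 / 2))) = sym2 (y1 / p) y2 (p * y3)"
    unfolding Y gbracket_diag h by simp_all
  have pk: "of_nat p powi k = of_nat p * (of_nat p powi (k - 1) :: complex)"
    using p0 power_int_add[of "of_nat p :: complex" 1 "k - 1"] by simp
  \<comment> \<open>The sum over b gained a factor p, so \<open>coeff_identity\<close> is p times
    the claim. After division, with p^k reduced to p^(k - 1), the contracted terms change
    sides.\<close>
  have cancel: "a - d = b - c" if "of_nat p * (a + c) = of_nat p * (b + d)" for a b c d :: complex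
  proof -
    have "a + c = b + d" using that p0 by simp
    then show ?thesis by (simp add: algebra_simps)
  qed
  show ?thesis
    unfolding g unfolding Y sym2_scaled
    using cancel[OF coeff_identity[OF assms(1-3) y, of n r m, unfolded pk mult.assoc distrib_left[symmetric]]]
    by simp
qed

end
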